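(* If $G$ is a finite nilpotent group of class $2$, then $P(G)=0=E(G)$.
   Context: $K$ is an algebraically closed field of characteristic $0$; $G^{ab}=G/[G,G]$. Gliders. A glider of length at most $1$ of $G$ (for $K\subset K[G]$) is a $K[G]$-module $\Omega$ with finite-dimensional $K$-subspaces $M_{-1}\subseteq M_0\subseteq\Omega$ with $K[G]M_{-1}\subseteq M_0$; it has length $0$ if $M_{-1}=0$ and length $1$ otherwise. A morphism to $(N_{-1}\subseteq N_0)$ is a $K$-linear $f:M_0\to N_0$ with $f(M_{-1})\subseteq N_{-1}$ and $f(xm)=xf(m)$ for $x\in K[G]$, $m\in M_{-1}$. Direct sums and tensor products (diagonal $G$-action) are formed levelwise. A glider of length $1$ is irreducible iff $\dim M_{-1}=1$ and $M_0=K[G]M_{-1}$. $\overline{R}_1(\widetilde G)$ is the subring generated by the classes of irreducible gliders of length $1$ in the quotient of the split Grothendieck ring of gliders of length $\le 1$ by the ideal additively generated by gliders of length $0$. In it $[Ku\subset U]\cdot[Kv\subset V]=[K(u\otimes v)\subset K[G](u\otimes v)]$. Put $\mathbb{Q}(\widetilde G)=\mathbb{Q}\otimes_{\mathbb Z}\overline R_1(\widetilde G)$. Parametrization. Fix an isomorphism $z\mapsto T_z$ from $G^{ab}$ to the group of one-dimensional $K[G]$-modules. $\mathcal{S}_G$ is the set of subsets $B$ of $\bigsqcup_{U\in\mathrm{Irr}(G),\dim U>1}\mathrm{Gr}(U)$, $\mathrm{Gr}(U)=\bigsqcup_{j=1}^{\dim U}\mathrm{Gr}(j,U)$, containing at most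 one point $W_U$ of each $\mathrm{Gr}(U)$. For $A\subseteq G^{ab}$, $B\in\mathcal S_G$, not both empty, $M_{(A,B)}$ is the class of the irreducible glider $Kv\subset\bigoplus_{z\in A}T_z\oplus\bigoplus_U U^{\oplus m_U}$ with $m_U=\dim W_U$ ($0$ if $B\cap\mathrm{Gr}(U)=\emptyset$), where $v$ has nonzero component in each $T_z$ and its components in the copies of $U$ form a basis of $W_U$. Every irreducible glider of length $1$ is isomorphic to exactly one of these. $P(G)$ is the $\mathbb{Q}$-span in $\mathbb{Q}(\widetilde G)$ of those $M_{(A,B)}$ whose powers form an infinite cyclic semigroup. If $M_{(A,B)}\notin P(G)$, the finite semigroup $\langle M_{(A,B)}\rangle$ contains a unique idempotent $e(A,B)$. $E(G)$ is the $\mathbb{Q}$-span of those $M_{(A,B)}$ for which $e(A,B)=M_{(\emptyset,D)}$ for some $D\in\mathcal{S}_G$. *)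

theory Defs
  imports
    "HOL-Algebra.Algebra"
    "HOL-Algebra.Algebraic_Closure_Type"
    "HOL-Library.Function_Algebras"
    "HOL-Library.Nat_Bijection"
    "HOL-Computational_Algebra.Computational_Algebra"
begin

section \<open>Coordinate vector spaces\<close>

text \<open>
  A Grothendieck ring needs a set of isomorphism classes, so all modules live in one fixed
  vector space: the ambient module of a glider is the space of finitely supported functions on
  some index set \<open>I \<subseteq> \<nat>\<close>. The index set may be infinite, and the group acts by arbitrary
  linear maps. No isomorphism class of gliders is lost, because a glider is isomorphic to one with
  ambient module \<open>K[G]M\<^sub>-\<^sub>1 \<oplus> C\<close>, where \<open>C\<close> is a vector space complement of \<open>K[G]M\<^sub>-\<^sub>1\<close> in
  \<open>M\<^sub>0\<close> with trivial action: morphisms only see \<open>M\<^sub>-\<^sub>1 \<subseteq> M\<^sub>0\<close> and the products \<open>xm\<close>,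
  \<open>m \<in> M\<^sub>-\<^sub>1\<close>.
\<close>

type_synonym 'k vec = "nat \<Rightarrow> 'k"

definition smul :: "'k::field \<Rightarrow> 'k vec \<Rightarrow> 'k vec" where
  "smul c x = (\<lambda>i. c * x i)"

global_interpretation vs: vector_space "smul :: 'k::field \<Rightarrow> 'k vec \<Rightarrow> 'k vec"
  by unfold_locales (auto simp: smul_def fun_eq_iff algebra_simps)

definition unit_vec :: "nat \<Rightarrow> 'k::field vec" where
  "unit_vec i = (\<lambda>j. if j = i then 1 else 0)"

definition finite_dim :: "'k::field vec set \<Rightarrow> bool" where
  "finite_dim S \<longleftrightarrow> (\<exists>B. finite B \<and> vs.span B = S)"

definition linear_on :: "'k::field vec set \<Rightarrow> ('k vec \<Rightarrow> 'k vec) \<Rightarrow> bool" where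
  "linear_on S f \<longleftrightarrow> (\<forall>x\<in>S. \<forall>y\<in>S. f (x + y) = f x + f y) \<and> (\<forall>c. \<forall>x\<in>S. f (smul c x) = smul c (f x))"


section \<open>Modules over the group algebra\<close>

record ('g, 'k) kgmod =
  index :: "nat set"
  act :: "'g \<Rightarrow> 'k vec \<Rightarrow> 'k vec"

definition vecs :: "('g, 'k::field) kgmod \<Rightarrow> 'k vec set" where
  "vecs V = {x. finite {i. x i \<noteq> 0} \<and> {i. x i \<noteq> 0} \<subseteq> index V}"

definition kg_module :: "('g, 'm) monoid_scheme \<Rightarrow> ('g, 'k::field) kgmod \<Rightarrow> bool" where
  "kg_module G V \<longleftrightarrow>
     (\<forall>g\<in>carrier G. act V g ` vecs V \<subseteq> vecs V \<and> linear_on (vecs V) (act V g)) \<and>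
     (\<forall>x\<in>vecs V. act V \<one>\<^bsub>G\<^esub> x = x) \<and>
     (\<forall>g\<in>carrier G. \<forall>h\<in>carrier G. \<forall>x\<in>vecs V. act V (g \<otimes>\<^bsub>G\<^esub> h) x = act V g (act V h x))"

text \<open>The action of the element \<open>\<Sum>\<^sub>g a(g) g\<close> of \<open>K[G]\<close>, for finite \<open>G\<close>.\<close>

definition alg_act ::
    "('g, 'm) monoid_scheme \<Rightarrow> ('g, 'k::field) kgmod \<Rightarrow> ('g \<Rightarrow> 'k) \<Rightarrow> 'k vec \<Rightarrow> 'k vec" where
  "alg_act G V a x = (\<Sum>g\<in>carrier G. smul (a g) (act V g x))"

definition alg_span ::
    "('g, 'm) monoid_scheme \<Rightarrow> ('g, 'k::field) kgmod \<Rightarrow> 'k vec set \<Rightarrow> 'k vec set" where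
  "alg_span G V S = vs.span {alg_act G V a x | a x. x \<in> S}"

definition kg_iso ::
    "('g, 'm) monoid_scheme \<Rightarrow> ('g, 'k::field) kgmod \<Rightarrow> ('g, 'k) kgmod \<Rightarrow> bool" where
  "kg_iso G V W \<longleftrightarrow>
     (\<exists>f. bij_betw f (vecs V) (vecs W) \<and> linear_on (vecs V) f \<and>
          (\<forall>g\<in>carrier G. \<forall>x\<in>vecs V. f (act V g x) = act W g (f x)))"

definition kg_irreducible :: "('g, 'm) monoid_scheme \<Rightarrow> ('g, 'k::field) kgmod \<Rightarrow> bool" where
  "kg_irreducible G U \<longleftrightarrow> kg_module G U \<and> vecs U \<noteq> {0} \<and>
     (\<forall>S. vs.subspace S \<and> S \<subseteq> vecs U \<and> (\<forall>g\<in>carrier G. act U g ` S \<subseteq> S)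
          \<longrightarrow> S = {0} \<or> S = vecs U)"

definition trivial_mod :: "('g, 'k::field) kgmod" where
  "trivial_mod = \<lparr>index = {0}, act = (\<lambda>g x. x)\<rparr>"

text \<open>
  Coordinate \<open>i\<close> of the \<open>s\<close>-th summand of \<open>V\<^sub>0 \<oplus> \<dots> \<oplus> V\<^sub>n\<^sub>-\<^sub>1\<close> is stored at
  \<open>prod_encode (s, i)\<close>.
\<close>

definition dsum_vec :: "'k::field vec list \<Rightarrow> 'k vec" where
  "dsum_vec xs = (\<lambda>k. case prod_decode k of (s, i) \<Rightarrow> if s < length xs then (xs ! s) i else 0)"

definition component :: "nat \<Rightarrow> 'k vec \<Rightarrow> 'k vec" where
  "component s x = (\<lambda>i. x (prod_encode (s, i)))"

definition dsum_mod :: "('g, 'k::field) kgmod list \<Rightarrow> ('g, 'k) kgmod" where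
  "dsum_mod Vs =
     \<lparr>index = {prod_encode (s, i) | s i. s < length Vs \<and> i \<in> index (Vs ! s)},
      act = (\<lambda>g x. dsum_vec (map (\<lambda>s. act (Vs ! s) g (component s x)) [0..<length Vs]))\<rparr>"

text \<open>
  The coordinates of \<open>x \<otimes> y\<close> are the products \<open>x(i) y(j)\<close>, stored at \<open>prod_encode (i, j)\<close>.
  The diagonal action is given on the basis by \<open>g(e\<^sub>i \<otimes> e\<^sub>j) = g e\<^sub>i \<otimes> g e\<^sub>j\<close> and extended linearly.
\<close>

definition tensor_vec :: "'k::field vec \<Rightarrow> 'k vec \<Rightarrow> 'k vec" where
  "tensor_vec x y = (\<lambda>k. case prod_decode k of (i, j) \<Rightarrow> x i * y j)"

definition tensor_mod ::
    "('g, 'k::field) kgmod \<Rightarrow> ('g, 'k) kgmod \<Rightarrow> ('g, 'k) kgmod" where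
  "tensor_mod V W =
     \<lparr>index = prod_encode ` (index V \<times> index W),
      act = (\<lambda>g x. \<Sum>k | x k \<noteq> 0. smul (x k)
               (case prod_decode k of (i, j) \<Rightarrow>
                  tensor_vec (act V g (unit_vec i)) (act W g (unit_vec j))))\<rparr>"


section \<open>Gliders of length at most one\<close>

text \<open>The fields \<open>low\<close> and \<open>high\<close> are \<open>M\<^sub>-\<^sub>1\<close> and \<open>M\<^sub>0\<close>.\<close>

record ('g, 'k) glider =
  amb :: "('g, 'k) kgmod"
  low :: "'k vec set"
  high :: "'k vec set"

definition is_glider :: "('g, 'm) monoid_scheme \<Rightarrow> ('g, 'k::field) glider \<Rightarrow> bool" where
  "is_glider G M \<longleftrightarrow>
     kg_module G (amb M) \<and>
     vs.subspace (low M) \<and> finite_dim (low M) \<and>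
     vs.subspace (high M) \<and> finite_dim (high M) \<and>
     low M \<subseteq> high M \<and> high M \<subseteq> vecs (amb M) \<and>
     alg_span G (amb M) (low M) \<subseteq> high M"

definition glider_hom ::
    "('g, 'm) monoid_scheme \<Rightarrow> ('g, 'k::field) glider \<Rightarrow> ('g, 'k) glider \<Rightarrow>
     ('k vec \<Rightarrow> 'k vec) \<Rightarrow> bool" where
  "glider_hom G M N f \<longleftrightarrow>
     f ` high M \<subseteq> high N \<and> linear_on (high M) f \<and> f ` low M \<subseteq> low N \<and>
     (\<forall>a. \<forall>m\<in>low M. f (alg_act G (amb M) a m) = alg_act G (amb N) a (f m))"

definition glider_iso ::
    "('g, 'm) monoid_scheme \<Rightarrow> ('g, 'k::field) glider \<Rightarrow> ('g, 'k) glider \<Rightarrow> bool" where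
  "glider_iso G M N \<longleftrightarrow>
     (\<exists>f h. glider_hom G M N f \<and> glider_hom G N M h \<and>
            (\<forall>x\<in>high M. h (f x) = x) \<and> (\<forall>y\<in>high N. f (h y) = y))"

definition glider_dsum ::
    "('g, 'k::field) glider \<Rightarrow> ('g, 'k) glider \<Rightarrow> ('g, 'k) glider" where
  "glider_dsum M N =
     \<lparr>amb = dsum_mod [amb M, amb N],
      low = {dsum_vec [x, y] | x y. x \<in> low M \<and> y \<in> low N},
      high = {dsum_vec [x, y] | x y. x \<in> high M \<and> y \<in> high N}\<rparr>"

definition glider_tensor ::
    "('g, 'k::field) glider \<Rightarrow> ('g, 'k) glider \<Rightarrow> ('g, 'k) glider" where
  "glider_tensor M N =
     \<lparr>amb = tensor_mod (amb M) (amb N),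
      low = vs.span {tensor_vec x y | x y. x \<in> low M \<and> y \<in> low N},
      high = vs.span {tensor_vec x y | x y. x \<in> high M \<and> y \<in> high N}\<rparr>"

definition glider_unit :: "('g, 'k::field) glider" where
  "glider_unit = \<lparr>amb = trivial_mod, low = vecs (trivial_mod :: ('g, 'k) kgmod),
                  high = vecs (trivial_mod :: ('g, 'k) kgmod)\<rparr>"

definition irreducible_glider1 :: "('g, 'm) monoid_scheme \<Rightarrow> ('g, 'k::field) glider \<Rightarrow> bool" where
  "irreducible_glider1 G M \<longleftrightarrow>
     is_glider G M \<and> vs.dim (low M) = 1 \<and> high M = alg_span G (amb M) (low M)"


section \<open>Rings of gliders\<close>

definition monoid_ring :: "('a, 'm) monoid_scheme \<Rightarrow> ('a \<Rightarrow>\<^sub>0 int) ring" where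
  "monoid_ring A =
     \<lparr>carrier = carrier (free_Abelian_group (carrier A)),
      monoid.mult = (\<lambda>c d. \<Sum>x\<in>Poly_Mapping.keys c. \<Sum>y\<in>Poly_Mapping.keys d.
                frag_cmul (Poly_Mapping.lookup c x * Poly_Mapping.lookup d y)
                  (frag_of (x \<otimes>\<^bsub>A\<^esub> y))),
      monoid.one = frag_of \<one>\<^bsub>A\<^esub>,
      ring.zero = 0,
      add = (+)\<rparr>"

abbreviation add_span :: "('a, 'm) ring_scheme \<Rightarrow> 'a set \<Rightarrow> 'a set" where
  "add_span R S \<equiv> generate (add_monoid R) S"

definition glider_class ::
    "('g, 'm) monoid_scheme \<Rightarrow> ('g, 'k::field) glider \<Rightarrow> ('g, 'k) glider set" where
  "glider_class G M = {N. is_glider G N \<and> glider_iso G M N}"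

definition glider_classes :: "('g, 'm) monoid_scheme \<Rightarrow> ('g, 'k::field) glider set monoid" where
  "glider_classes G =
     \<lparr>carrier = {glider_class G M | M. is_glider G M},
      monoid.mult = (\<lambda>C D. {L. is_glider G L \<and> (\<exists>M\<in>C. \<exists>N\<in>D. glider_iso G L (glider_tensor M N))}),
      monoid.one = glider_class G glider_unit\<rparr>"

text \<open>
  The free abelian group on the isomorphism classes with product induced by \<open>\<otimes>\<close>, modulo the
  subgroup spanned by the elements \<open>[M \<oplus> N] - [M] - [N]\<close>, which is an ideal since \<open>\<otimes>\<close>
  distributes over \<open>\<oplus>\<close>.
\<close>

definition split_relations ::
    "('g, 'm) monoid_scheme \<Rightarrow> (('g, 'k::field) glider set \<Rightarrow>\<^sub>0 int) set" where
  "split_relations G = add_span (monoid_ring (glider_classes G))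
     {frag_of (glider_class G (glider_dsum M N)) - frag_of (glider_class G M)
        - frag_of (glider_class G N) | M N. is_glider G M \<and> is_glider G N}"

definition split_ring ::
    "('g, 'm) monoid_scheme \<Rightarrow> (('g, 'k::field) glider set \<Rightarrow>\<^sub>0 int) set ring" where
  "split_ring G = monoid_ring (glider_classes G) Quot split_relations G"

definition split_class ::
    "('g, 'm) monoid_scheme \<Rightarrow> ('g, 'k::field) glider \<Rightarrow> (('g, 'k) glider set \<Rightarrow>\<^sub>0 int) set" where
  "split_class G M =
     split_relations G +>\<^bsub>monoid_ring (glider_classes G)\<^esub> frag_of (glider_class G M)"

definition length0_ideal ::
    "('g, 'm) monoid_scheme \<Rightarrow> (('g, 'k::field) glider set \<Rightarrow>\<^sub>0 int) set set" where
  "length0_ideal G = add_span (split_ring G) {split_class G M | M. is_glider G M \<and> low M = {0}}"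

definition red_split_ring ::
    "('g, 'm) monoid_scheme \<Rightarrow> (('g, 'k::field) glider set \<Rightarrow>\<^sub>0 int) set set ring" where
  "red_split_ring G = split_ring G Quot length0_ideal G"

definition red_class ::
    "('g, 'm) monoid_scheme \<Rightarrow> ('g, 'k::field) glider \<Rightarrow>
     (('g, 'k) glider set \<Rightarrow>\<^sub>0 int) set set" where
  "red_class G M = length0_ideal G +>\<^bsub>split_ring G\<^esub> split_class G M"

definition rep_ring ::
    "('g, 'm) monoid_scheme \<Rightarrow> (('g, 'k::field) glider set \<Rightarrow>\<^sub>0 int) set set ring" where
  "rep_ring G = red_split_ring G
     \<lparr>carrier := generate_ring (red_split_ring G) {red_class G M | M. irreducible_glider1 G M}\<rparr>"


section \<open>Extension of scalars to the rationals\<close>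

definition tensor_relations ::
    "('a, 'm) ring_scheme \<Rightarrow> ('b, 'n) ring_scheme \<Rightarrow> ('a \<times> 'b \<Rightarrow>\<^sub>0 int) set" where
  "tensor_relations A B = add_span (monoid_ring (A \<times>\<times> B))
     ({frag_of (a \<oplus>\<^bsub>A\<^esub> a', b) - frag_of (a, b) - frag_of (a', b) | a a' b.
         a \<in> carrier A \<and> a' \<in> carrier A \<and> b \<in> carrier B} \<union>
      {frag_of (a, b \<oplus>\<^bsub>B\<^esub> b') - frag_of (a, b) - frag_of (a, b') | a b b'.
         a \<in> carrier A \<and> b \<in> carrier B \<and> b' \<in> carrier B})"

definition tensor_ring ::
    "('a, 'm) ring_scheme \<Rightarrow> ('b, 'n) ring_scheme \<Rightarrow> ('a \<times> 'b \<Rightarrow>\<^sub>0 int) set ring" where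
  "tensor_ring A B = monoid_ring (A \<times>\<times> B) Quot tensor_relations A B"

definition pure_tensor ::
    "('a, 'm) ring_scheme \<Rightarrow> ('b, 'n) ring_scheme \<Rightarrow> 'a \<Rightarrow> 'b \<Rightarrow> ('a \<times> 'b \<Rightarrow>\<^sub>0 int) set" where
  "pure_tensor A B a b = tensor_relations A B +>\<^bsub>monoid_ring (A \<times>\<times> B)\<^esub> frag_of (a, b)"

abbreviation rat_ring :: "rat ring" where
  "rat_ring \<equiv> ring_of_type_algebra"

type_synonym ('g, 'k) qelem = "(rat \<times> (('g, 'k) glider set \<Rightarrow>\<^sub>0 int) set set \<Rightarrow>\<^sub>0 int) set"

definition Q_glider :: "('g, 'm) monoid_scheme \<Rightarrow> ('g, 'k::field) qelem ring" where
  "Q_glider G = tensor_ring rat_ring (rep_ring G)"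

definition Q_class :: "('g, 'm) monoid_scheme \<Rightarrow> ('g, 'k::field) glider \<Rightarrow> ('g, 'k) qelem" where
  "Q_class G M = pure_tensor rat_ring (rep_ring G) 1 (red_class G M)"

definition Q_span ::
    "('g, 'm) monoid_scheme \<Rightarrow> ('g, 'k::field) qelem set \<Rightarrow> ('g, 'k) qelem set" where
  "Q_span G S = add_span (Q_glider G)
     {pure_tensor rat_ring (rep_ring G) q \<one>\<^bsub>rep_ring G\<^esub> \<otimes>\<^bsub>Q_glider G\<^esub> x | q x. x \<in> S}"


section \<open>Parametrization of the irreducible gliders of length one\<close>

definition abelianization :: "('g, 'm) monoid_scheme \<Rightarrow> 'g set monoid" where
  "abelianization G = G Mod derived G (carrier G)"

definition kg_class ::
    "('g, 'm) monoid_scheme \<Rightarrow> ('g, 'k::field) kgmod \<Rightarrow> ('g, 'k) kgmod set" where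
  "kg_class G V = {W. kg_module G W \<and> kg_iso G V W}"

text \<open>The group, under \<open>\<otimes>\<close>, of isomorphism classes of one-dimensional modules.\<close>

definition onedim_group :: "('g, 'm) monoid_scheme \<Rightarrow> ('g, 'k::field) kgmod set monoid" where
  "onedim_group G =
     \<lparr>carrier = {kg_class G V | V. kg_module G V \<and> vs.dim (vecs V) = 1},
      monoid.mult = (\<lambda>C D. {L. kg_module G L \<and> (\<exists>V\<in>C. \<exists>W\<in>D. kg_iso G L (tensor_mod V W))}),
      monoid.one = kg_class G trivial_mod\<rparr>"

definition onedim_param ::
    "('g, 'm) monoid_scheme \<Rightarrow> ('g set \<Rightarrow> ('g, 'k::field) kgmod) \<Rightarrow> bool" where
  "onedim_param G T \<longleftrightarrow>
     (\<forall>z\<in>carrier (abelianization G). kg_module G (T z)) \<and>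
     (\<lambda>z. kg_class G (T z)) \<in> iso (abelianization G) (onedim_group G)"

definition irr_reps :: "('g, 'm) monoid_scheme \<Rightarrow> ('g, 'k::field) kgmod set \<Rightarrow> bool" where
  "irr_reps G Irr \<longleftrightarrow>
     (\<forall>U\<in>Irr. kg_irreducible G U) \<and>
     (\<forall>V. kg_irreducible G V \<longrightarrow> (\<exists>!U. U \<in> Irr \<and> kg_iso G V U))"

definition Gr :: "nat \<Rightarrow> ('g, 'k::field) kgmod \<Rightarrow> 'k vec set set" where
  "Gr j U = {W. vs.subspace W \<and> W \<subseteq> vecs U \<and> vs.dim W = j}"

definition Gr_all :: "('g, 'k::field) kgmod \<Rightarrow> 'k vec set set" where
  "Gr_all U = (\<Union>j\<in>{1..vs.dim (vecs U)}. Gr j U)"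

text \<open>The point \<open>W\<close> of \<open>Gr(U)\<close> is represented in the disjoint union over \<open>U\<close> by \<open>(U, W)\<close>.\<close>

definition S_G ::
    "('g, 'k::field) kgmod set \<Rightarrow> (('g, 'k) kgmod \<times> 'k vec set) set set" where
  "S_G Irr = {B. B \<subseteq> (SIGMA U:{U \<in> Irr. vs.dim (vecs U) > 1}. Gr_all U) \<and>
                 (\<forall>U W W'. (U, W) \<in> B \<and> (U, W') \<in> B \<longrightarrow> W = W')}"

definition vector_glider :: "(('g, 'k::field) kgmod \<times> 'k vec) list \<Rightarrow> ('g, 'k) glider" where
  "vector_glider xs =
     (let V = dsum_mod (map fst xs) in
      \<lparr>amb = V, low = vs.span {dsum_vec (map snd xs)}, high = vecs V\<rparr>)"

text \<open>
  A list of summands together with the components of \<open>v\<close>: the \<open>T\<^sub>z\<close>, \<open>z \<in> A\<close>, with nonzero vectors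
  \<open>t z\<close>, and for each \<open>(U, W) \<in> B\<close> as many copies of \<open>U\<close> as the basis \<open>b (U, W)\<close> of \<open>W\<close> has elements,
  with these elements as components. Such lists exist because \<open>A\<close> and \<open>B\<close> are finite, \<open>G\<close> having only
  finitely many irreducible modules. A different choice of the list gives an isomorphic glider.
\<close>

definition presents ::
    "('g set \<Rightarrow> ('g, 'k::field) kgmod) \<Rightarrow> 'g set set \<Rightarrow> (('g, 'k) kgmod \<times> 'k vec set) set \<Rightarrow>
     (('g, 'k) kgmod \<times> 'k vec) list \<Rightarrow> bool" where
  "presents T A B xs \<longleftrightarrow>
     (\<exists>zs t Bs b.
        distinct zs \<and> set zs = A \<and> (\<forall>z\<in>A. t z \<in> vecs (T z) \<and> t z \<noteq> 0) \<and>
        distinct Bs \<and> set Bs = B \<and>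
        (\<forall>(U, W)\<in>B. distinct (b (U, W)) \<and> vs.independent (set (b (U, W))) \<and>
                    vs.span (set (b (U, W))) = W) \<and>
        xs = map (\<lambda>z. (T z, t z)) zs @
             concat (map (\<lambda>(U, W). map (\<lambda>w. (U, w)) (b (U, W))) Bs))"

definition glider_M ::
    "('g, 'm) monoid_scheme \<Rightarrow> ('g set \<Rightarrow> ('g, 'k::field) kgmod) \<Rightarrow> 'g set set \<Rightarrow>
     (('g, 'k) kgmod \<times> 'k vec set) set \<Rightarrow> ('g, 'k) qelem" where
  "glider_M G T A B = Q_class G (vector_glider (SOME xs. presents T A B xs))"

definition params ::
    "('g, 'm) monoid_scheme \<Rightarrow> ('g, 'k::field) kgmod set \<Rightarrow>
     ('g set set \<times> (('g, 'k) kgmod \<times> 'k vec set) set) set" where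
  "params G Irr = {(A, B). A \<subseteq> carrier (abelianization G) \<and> B \<in> S_G Irr \<and> \<not> (A = {} \<and> B = {})}"


section \<open>The subspaces \<open>P(G)\<close> and \<open>E(G)\<close>\<close>

definition cyclic_semigroup :: "('a, 'm) monoid_scheme \<Rightarrow> 'a \<Rightarrow> 'a set" where
  "cyclic_semigroup R x = {x [^]\<^bsub>R\<^esub> n | n :: nat. n \<ge> 1}"

definition idempotent_of :: "('a, 'm) monoid_scheme \<Rightarrow> 'a \<Rightarrow> 'a" where
  "idempotent_of R x = (THE e. e \<in> cyclic_semigroup R x \<and> e \<otimes>\<^bsub>R\<^esub> e = e)"

definition P_space ::
    "('g, 'm) monoid_scheme \<Rightarrow> ('g set \<Rightarrow> ('g, 'k::field) kgmod) \<Rightarrow> ('g, 'k) kgmod set \<Rightarrow>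
     ('g, 'k) qelem set" where
  "P_space G T Irr = Q_span G {glider_M G T A B | A B. (A, B) \<in> params G Irr \<and>
     infinite (cyclic_semigroup (Q_glider G) (glider_M G T A B))}"

definition E_space ::
    "('g, 'm) monoid_scheme \<Rightarrow> ('g set \<Rightarrow> ('g, 'k::field) kgmod) \<Rightarrow> ('g, 'k) kgmod set \<Rightarrow>
     ('g, 'k) qelem set" where
  "E_space G T Irr = Q_span G {glider_M G T A B | A B. (A, B) \<in> params G Irr \<and>
     glider_M G T A B \<notin> P_space G T Irr \<and>
     (\<exists>D. ({}, D) \<in> params G Irr \<and>
          idempotent_of (Q_glider G) (glider_M G T A B) = glider_M G T {} D)}"


section \<open>Nilpotency class\<close>

fun lower_central :: "('g, 'm) monoid_scheme \<Rightarrow> nat \<Rightarrow> 'g set" where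
  "lower_central G 0 = carrier G"
| "lower_central G (Suc n) = generate G
     {x \<otimes>\<^bsub>G\<^esub> y \<otimes>\<^bsub>G\<^esub> inv\<^bsub>G\<^esub> x \<otimes>\<^bsub>G\<^esub> inv\<^bsub>G\<^esub> y | x y. x \<in> lower_central G n \<and> y \<in> carrier G}"

definition nilpotent_of_class :: "('g, 'm) monoid_scheme \<Rightarrow> nat \<Rightarrow> bool" where
  "nilpotent_of_class G c \<longleftrightarrow>
     lower_central G c = {\<one>\<^bsub>G\<^esub>} \<and> (\<forall>d<c. lower_central G d \<noteq> {\<one>\<^bsub>G\<^esub>})"

end

theory Submission
  imports Defs
begin

text \<open>
  An irreducible glider \<open>K u \<subseteq> K[G] u\<close> is determined by the annihilator of \<open>u\<close> in \<open>K[G]\<close>, hence by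
  the orthogonal space of the annihilator. This is the coefficient space \<open>C(u)\<close>, which consists of
  the functions \<open>g \<mapsto> \<phi>(g u)\<close> on \<open>G\<close> for linear functionals \<open>\<phi>\<close>. Since the coordinates of
  \<open>g (u \<otimes> v)\<close> are products of coordinates of \<open>g u\<close> and \<open>g v\<close>, the space \<open>C(u \<otimes> v)\<close> is the span
  \<open>C(u) C(v)\<close> of the pointwise products. So the powers of \<open>M\<^sub>(\<^sub>A\<^sub>,\<^sub>B\<^sub>)\<close> are determined by the powers \<open>C\<^sup>n\<close> of one
  nonzero translation invariant space \<open>C\<close> of functions on the finite group \<open>G\<close>
  (lemmas \<open>red_class_coeffs\<close>, \<open>coeffs_tensor\<close>, \<open>cyclic_power\<close>).

  Let \<open>f \<in> C\<close> be nonzero. The sum of all translates of \<open>f\<^sup>n\<close> lies in \<open>C\<^sup>n\<close> and is the constant function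
  with value \<open>\<Sum>\<^sub>g f(g)\<^sup>n\<close>. In characteristic \<open>0\<close> the power sums of finitely many numbers that are not
  all zero cannot all vanish, so \<open>1 \<in> C\<^sup>N\<close> for some \<open>N \<ge> 1\<close> (lemma \<open>unit_fun_in_power\<close>). Therefore
  \<open>C\<^sup>n \<subseteq> C\<^sup>n\<^sup>+\<^sup>N\<close> for all \<open>n\<close>, and as ascending chains of spaces of functions on \<open>G\<close> stabilize, there are only
  finitely many different powers. This gives \<open>P(G) = 0\<close>. The idempotent power is \<open>C\<^sup>K\<^sup>N\<close> for large \<open>K\<close>,
  and it contains \<open>1\<close> (lemma \<open>cyclic_glider_powers\<close>).

  Consider the element \<open>s = \<Sum>\<^sub>g g\<close> of \<open>K[G]\<close>. If \<open>1 \<in> C(w)\<close>, then \<open>s w \<noteq> 0\<close>, because \<open>s\<close> pairs with the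
  function \<open>1\<close> to \<open>|G| \<noteq> 0\<close>. On an irreducible module of dimension greater than \<open>1\<close> the element \<open>s\<close>
  acts as \<open>0\<close>, so it kills the generator of \<open>M\<^sub>(\<^sub>\<emptyset>\<^sub>,\<^sub>D\<^sub>)\<close>. The rank of \<open>s\<close> on \<open>M\<^sub>-\<^sub>1\<close> is an isomorphism
  invariant of gliders which is additive on direct sums and vanishes for gliders of length \<open>0\<close>, so it
  defines an additive function on \<open>Q_glider G\<close> that separates the two kinds of classes
  (lemma \<open>Q_class_eq_average_rank\<close>). Hence no \<open>e(A,B)\<close> is of the form \<open>M\<^sub>(\<^sub>\<emptyset>\<^sub>,\<^sub>D\<^sub>)\<close>, and \<open>E(G) = 0\<close>.

  The definition of \<open>M\<^sub>(\<^sub>A\<^sub>,\<^sub>B\<^sub>)\<close> chooses a finite list of summands, and such a list exists because \<open>G\<close> has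
  only finitely many irreducible modules (lemma \<open>finite_irr_reps\<close>).
\<close>



section \<open>Rings without associativity\<close>

text \<open>
  Products of classes are computed on representatives by bilinearity alone. Associativity enters
  only through the powers of a class, and there it is read off from coefficient spaces.
\<close>

locale nonassoc_ring = abelian_group R for R (structure) +
  assumes mult_closed: "\<lbrakk>a \<in> carrier R; b \<in> carrier R\<rbrakk> \<Longrightarrow> a \<otimes> b \<in> carrier R"
    and mult_add_left: "\<lbrakk>a \<in> carrier R; b \<in> carrier R; c \<in> carrier R\<rbrakk>
          \<Longrightarrow> (a \<oplus> b) \<otimes> c = a \<otimes> c \<oplus> b \<otimes> c"
    and mult_add_right: "\<lbrakk>a \<in> carrier R; b \<in> carrier R; c \<in> carrier R\<rbrakk>
          \<Longrightarrow> c \<otimes> (a \<oplus> b) = c \<otimes> a \<oplus> c \<otimes> b"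
begin

lemma mult_zero_left: assumes "a \<in> carrier R" shows "\<zero> \<otimes> a = \<zero>"
proof -
  have "\<zero> \<otimes> a \<oplus> \<zero> \<otimes> a = \<zero> \<otimes> a \<oplus> \<zero>"
    using mult_add_left[of \<zero> \<zero> a] assms mult_closed by simp
  then show ?thesis using assms mult_closed by (metis add.l_cancel zero_closed)
qed

lemma mult_zero_right: assumes "a \<in> carrier R" shows "a \<otimes> \<zero> = \<zero>"
proof -
  have "a \<otimes> \<zero> \<oplus> a \<otimes> \<zero> = a \<otimes> \<zero> \<oplus> \<zero>"
    using mult_add_right[of \<zero> \<zero> a] assms mult_closed by simp
  then show ?thesis using assms mult_closed by (metis add.l_cancel zero_closed)
qed

lemma mult_minus_left: assumes "a \<in> carrier R" "b \<in> carrier R" shows "(\<ominus> a) \<otimes> b = \<ominus> (a \<otimes> b)"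
proof -
  have "(\<ominus> a) \<otimes> b \<oplus> a \<otimes> b = \<zero>"
    using mult_add_left[of "\<ominus> a" a b] assms by (simp add: l_neg mult_zero_left)
  then show ?thesis using assms mult_closed by (simp add: minus_equality)
qed

lemma mult_minus_right: assumes "a \<in> carrier R" "b \<in> carrier R" shows "a \<otimes> (\<ominus> b) = \<ominus> (a \<otimes> b)"
proof -
  have "a \<otimes> (\<ominus> b) \<oplus> a \<otimes> b = \<zero>"
    using mult_add_right[of "\<ominus> b" b a] assms by (simp add: l_neg mult_zero_right)
  then show ?thesis using assms mult_closed by (simp add: minus_equality)
qed

lemma additive_subgroup_add_span:
  assumes "S \<subseteq> carrier R" shows "additive_subgroup (add_span R S) R"
  using add.generate_is_subgroup assms by (auto intro!: additive_subgroup.intro)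

lemma add_span_minimal:
  assumes "additive_subgroup J R" "S \<subseteq> J" shows "add_span R S \<subseteq> J"
  using add.generate_subgroup_incl[of S J] assms additive_subgroup.a_subgroup by blast

end

locale nonassoc_ideal = nonassoc_ring R + additive_subgroup J R for J and R (structure) +
  assumes absorb_left: "\<lbrakk>j \<in> J; r \<in> carrier R\<rbrakk> \<Longrightarrow> j \<otimes> r \<in> J"
    and absorb_right: "\<lbrakk>j \<in> J; r \<in> carrier R\<rbrakk> \<Longrightarrow> r \<otimes> j \<in> J"
begin

sublocale abelian_subgroup J R
  by (rule abelian_subgroupI3) unfold_locales

lemma coset_mult:
  assumes "a \<in> carrier R" "b \<in> carrier R"
  shows "(J +> a) \<otimes>\<^bsub>R Quot J\<^esub> (J +> b) = J +> (a \<otimes> b)"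
proof -
  have "J +> (a' \<otimes> b') = J +> (a \<otimes> b)" if ab: "a' \<in> J +> a" "b' \<in> J +> b" for a' b'
  proof -
    obtain i j where ij: "i \<in> J" "a' = i \<oplus> a" "j \<in> J" "b' = j \<oplus> b"
      using ab by (auto simp: a_r_coset_def')
    have c: "i \<in> carrier R" "j \<in> carrier R" using ij by auto
    have "a' \<otimes> b' = (i \<otimes> j \<oplus> i \<otimes> b \<oplus> a \<otimes> j) \<oplus> a \<otimes> b"
      using ij c assms mult_closed by (simp add: mult_add_left mult_add_right a_ac)
    moreover have "i \<otimes> j \<oplus> i \<otimes> b \<oplus> a \<otimes> j \<in> J"
      using ij c assms absorb_left absorb_right by simp
    ultimately have "a' \<otimes> b' \<in> J +> (a \<otimes> b)"
      by (auto simp: a_r_coset_def')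
    then show ?thesis using a_repr_independence' assms mult_closed by metis
  qed
  moreover have "a \<in> J +> a" "b \<in> J +> b" using assms a_rcos_self by auto
  ultimately have "(\<Union>x\<in>J +> a. \<Union>y\<in>J +> b. J +> (x \<otimes> y)) = J +> (a \<otimes> b)" by blast
  then show ?thesis by (simp add: FactRing_def rcoset_mult_def)
qed

lemma coset_add:
  assumes "a \<in> carrier R" "b \<in> carrier R"
  shows "(J +> a) \<oplus>\<^bsub>R Quot J\<^esub> (J +> b) = J +> (a \<oplus> b)"
  using assms a_rcos_sum by (simp add: FactRing_def)

lemma coset_closed: "a \<in> carrier R \<Longrightarrow> J +> a \<in> carrier (R Quot J)"
  by (simp add: FactRing_def a_rcosetsI a_subset)

lemma coset_cases:
  assumes "Q \<in> carrier (R Quot J)" obtains a where "a \<in> carrier R" "Q = J +> a"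
  using assms by (auto simp: FactRing_def A_RCOSETS_def')

lemma coset_eq_iff:
  assumes "a \<in> carrier R" "b \<in> carrier R"
  shows "J +> a = J +> b \<longleftrightarrow> a \<ominus> b \<in> J"
proof -
  have "J +> a = J +> b \<longleftrightarrow> a \<in> J +> b"
    using assms a_repr_independence' a_rcos_self by metis
  also have "\<dots> \<longleftrightarrow> a \<ominus> b \<in> J"
    using a_rcos_module[of b a] assms by (simp add: a_minus_def)
  finally show ?thesis .
qed

lemma zero_quot: "\<zero>\<^bsub>R Quot J\<^esub> = J +> \<zero>"
  by (simp add: FactRing_def a_coset_add_zero a_subset)

lemma quotient_nonassoc_ring: "nonassoc_ring (R Quot J)"
proof -
  have "add_monoid (R Quot J) = R A_Mod J"
    by (simp add: FactRing_def A_FactGroup_def' set_add_def)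
  then have "comm_group (add_monoid (R Quot J))"
    using a_factorgroup_is_comm_group by simp
  then interpret QR: abelian_group "R Quot J"
    by (metis abelian_group.intro abelian_group_axioms.intro abelian_monoid.intro comm_group_def)
  show ?thesis
  proof
    fix Q Y assume "Q \<in> carrier (R Quot J)" "Y \<in> carrier (R Quot J)"
    then show "Q \<otimes>\<^bsub>R Quot J\<^esub> Y \<in> carrier (R Quot J)"
      by (auto elim!: coset_cases simp: coset_mult coset_closed mult_closed)
  next
    fix Q Y Z assume "Q \<in> carrier (R Quot J)" "Y \<in> carrier (R Quot J)" "Z \<in> carrier (R Quot J)"
    then obtain x y z where "x \<in> carrier R" "Q = J +> x" "y \<in> carrier R" "Y = J +> y"
      "z \<in> carrier R" "Z = J +> z" by (metis coset_cases)
    then show "(Q \<oplus>\<^bsub>R Quot J\<^esub> Y) \<otimes>\<^bsub>R Quot J\<^esub> Z = Q \<otimes>\<^bsub>R Quot J\<^esub> Z \<oplus>\<^bsub>R Quot J\<^esub> Y \<otimes>\<^bsub>R Quot J\<^esub> Z"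
      and "Z \<otimes>\<^bsub>R Quot J\<^esub> (Q \<oplus>\<^bsub>R Quot J\<^esub> Y) = Z \<otimes>\<^bsub>R Quot J\<^esub> Q \<oplus>\<^bsub>R Quot J\<^esub> Z \<otimes>\<^bsub>R Quot J\<^esub> Y"
      by (simp_all add: coset_add coset_mult mult_closed mult_add_left mult_add_right)
  qed
qed

lemma quotient_generated:
  assumes "T \<subseteq> carrier R" "carrier R = add_span R T"
  shows "carrier (R Quot J) = add_span (R Quot J) ((+>) J ` T)"
proof -
  interpret QR: nonassoc_ring "R Quot J" by (rule quotient_nonassoc_ring)
  have T: "(+>) J ` T \<subseteq> carrier (R Quot J)" using assms coset_closed by blast
  interpret S: additive_subgroup "add_span (R Quot J) ((+>) J ` T)" "R Quot J"
    by (rule QR.additive_subgroup_add_span[OF T])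
  have hom: "J +> (\<ominus> a) = \<ominus>\<^bsub>R Quot J\<^esub> (J +> a)" if "a \<in> carrier R" for a
  proof (rule QR.minus_equality[symmetric])
    show "(J +> (\<ominus> a)) \<oplus>\<^bsub>R Quot J\<^esub> (J +> a) = \<zero>\<^bsub>R Quot J\<^esub>"
      using that by (simp add: coset_add l_neg zero_quot)
  qed (use that coset_closed in auto)
  have "J +> a \<in> add_span (R Quot J) ((+>) J ` T)" if "a \<in> add_span R T" for a
    using that
  proof (induction rule: generate.induct)
    case one
    then show ?case using S.zero_closed by (simp add: zero_quot)
  next
    case (incl h)
    then show ?case by (simp add: generate.incl)
  next
    case (inv h)
    then have "J +> h \<in> add_span (R Quot J) ((+>) J ` T)" by (blast intro: generate.incl)
    moreover have "h \<in> carrier R" using inv assms by blast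
    ultimately show ?case using S.a_inv_closed hom[of h] by (simp add: a_inv_def[symmetric])
  next
    case (eng a b)
    then show ?case using assms(2) S.a_closed[OF eng.IH] coset_add[of a b] by simp
  qed
  then show ?thesis using assms(2) S.a_subset by (auto elim!: coset_cases)
qed

end

text \<open>
  For a fixed factor, the elements whose product with it lies in the subgroup form a subgroup. So it
  suffices to multiply generators with generators.
\<close>

lemma nonassoc_idealI:
  fixes R (structure)
  assumes "nonassoc_ring R" "S \<subseteq> carrier R" "T \<subseteq> carrier R" "carrier R = add_span R T"
    and left: "\<And>s t. \<lbrakk>s \<in> S; t \<in> T\<rbrakk> \<Longrightarrow> s \<otimes> t \<in> add_span R S"
    and right: "\<And>s t. \<lbrakk>s \<in> S; t \<in> T\<rbrakk> \<Longrightarrow> t \<otimes> s \<in> add_span R S"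
  shows "nonassoc_ideal (add_span R S) R"
proof -
  interpret nonassoc_ring R by fact
  interpret J: additive_subgroup "add_span R S" R by (rule additive_subgroup_add_span) fact
  have 1: "s \<otimes> r \<in> add_span R S \<and> r \<otimes> s \<in> add_span R S" if "s \<in> S" "r \<in> add_span R T" for s r
    using that(2)
  proof (induction rule: generate.induct)
    case one
    then show ?case using that(1) assms(2) by (auto simp: mult_zero_left mult_zero_right)
  next
    case (incl h)
    then show ?case using left right that(1) by blast
  next
    case (inv h)
    then have "h \<in> carrier R" "s \<in> carrier R" using assms(2,3) that(1) by auto
    then show ?case
      using inv left[of s h] right[of s h] that(1)
      by (simp add: a_inv_def[symmetric] mult_minus_left mult_minus_right J.a_inv_closed)
  next
    case (eng a b)
    then have "a \<in> carrier R" "b \<in> carrier R" "s \<in> carrier R" using assms(2,4) that(1) by auto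
    then show ?case using eng by (simp add: mult_add_left mult_add_right)
  qed
  have 2: "j \<otimes> r \<in> add_span R S \<and> r \<otimes> j \<in> add_span R S" if "j \<in> add_span R S" "r \<in> carrier R" for j r
    using that(1)
  proof (induction rule: generate.induct)
    case one
    then show ?case using that(2) by (auto simp: mult_zero_left mult_zero_right)
  next
    case (incl h)
    then show ?case using 1 that(2) assms(4) by blast
  next
    case (inv h)
    then have "h \<in> carrier R" using assms(2) by auto
    then show ?case
      using inv 1[of h r] that(2) assms(4)
      by (simp add: a_inv_def[symmetric] mult_minus_left mult_minus_right J.a_inv_closed)
  next
    case (eng a b)
    then have "a \<in> carrier R" "b \<in> carrier R" using J.a_subset by auto
    then show ?case using eng that(2) by (simp add: mult_add_left mult_add_right)
  qed
  show ?thesis by unfold_locales (use 2 in auto)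
qed

lemma (in nonassoc_ring) generate_ring_closed:
  assumes "H \<subseteq> carrier R" "\<one> \<in> carrier R"
  shows "generate_ring R H \<subseteq> carrier R"
proof
  show "x \<in> carrier R" if "x \<in> generate_ring R H" for x
    using that by induction (use assms mult_closed in auto)
qed

lemma (in nonassoc_ring) nonassoc_ring_generate_ring:
  assumes "H \<subseteq> carrier R" "\<one> \<in> carrier R"
  shows "nonassoc_ring (R\<lparr>carrier := generate_ring R H\<rparr>)"
proof -
  let ?H = "generate_ring R H"
  have H: "\<And>x. x \<in> ?H \<Longrightarrow> x \<in> carrier R" using generate_ring_closed[OF assms] by blast
  have zero: "\<zero> \<in> ?H"
    using generate_ring.eng_add[OF generate_ring.one generate_ring.a_inv[OF generate_ring.one], of R H]
      assms(2) by (simp add: r_neg)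
  interpret S: abelian_group "R\<lparr>carrier := ?H\<rparr>"
  proof (rule abelian_groupI, goal_cases)
    case (6 x)
    then show ?case using generate_ring.a_inv[of x R H] H by (auto intro!: bexI[of _ "\<ominus> x"] simp: l_neg)
  qed (use H zero in \<open>auto simp: a_ac generate_ring.eng_add\<close>)
  show ?thesis
    by unfold_locales (use H in \<open>auto simp: generate_ring.eng_mult mult_add_left mult_add_right\<close>)
qed


section \<open>Monoid rings\<close>

lemma monoid_ring_mult:
  "c \<otimes>\<^bsub>monoid_ring A\<^esub> d = frag_extend (\<lambda>x. frag_extend (\<lambda>y. frag_of (x \<otimes>\<^bsub>A\<^esub> y)) d) c"
  by (simp add: monoid_ring_def frag_extend_def frag_cmul_sum)

lemma monoid_ring_mult_frag_of [simp]:
  "frag_of x \<otimes>\<^bsub>monoid_ring A\<^esub> frag_of y = frag_of (x \<otimes>\<^bsub>A\<^esub> y)"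
  by (simp add: monoid_ring_mult)

lemma monoid_ring_simps [simp]:
  "c \<in> carrier (monoid_ring A) \<longleftrightarrow> Poly_Mapping.keys c \<subseteq> carrier A"
  "c \<oplus>\<^bsub>monoid_ring A\<^esub> d = c + d" "\<zero>\<^bsub>monoid_ring A\<^esub> = 0"
  "\<one>\<^bsub>monoid_ring A\<^esub> = frag_of \<one>\<^bsub>A\<^esub>"
  by (simp_all add: monoid_ring_def)

lemma add_monoid_monoid_ring: "add_monoid (monoid_ring A) = free_Abelian_group (carrier A)"
  by (simp add: monoid_ring_def free_Abelian_group_def)

lemma a_inv_monoid_ring [simp]:
  "Poly_Mapping.keys c \<subseteq> carrier A \<Longrightarrow> \<ominus>\<^bsub>monoid_ring A\<^esub> c = - c"
  unfolding a_inv_def add_monoid_monoid_ring by (rule inv_free_Abelian_group)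

lemma a_minus_monoid_ring [simp]:
  "Poly_Mapping.keys c \<subseteq> carrier A \<Longrightarrow> d \<ominus>\<^bsub>monoid_ring A\<^esub> c = d - c"
  by (simp add: a_minus_def)

lemma frag_extend_fun_add: "frag_extend (\<lambda>x. f x + g x) c = frag_extend f c + frag_extend g c"
  by (simp add: frag_extend_def frag_cmul_distrib2 sum.distrib)

lemma nonassoc_ring_monoid_ring:
  assumes "\<And>x y. \<lbrakk>x \<in> carrier A; y \<in> carrier A\<rbrakk> \<Longrightarrow> x \<otimes>\<^bsub>A\<^esub> y \<in> carrier A"
  shows "nonassoc_ring (monoid_ring A)"
proof -
  have "comm_group (add_monoid (monoid_ring A))"
    unfolding add_monoid_monoid_ring by (rule abelian_free_Abelian_group)
  then interpret abelian_group "monoid_ring A"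
    by (metis abelian_group.intro abelian_group_axioms.intro abelian_monoid.intro comm_group_def)
  show ?thesis
  proof
    fix c d assume "c \<in> carrier (monoid_ring A)" "d \<in> carrier (monoid_ring A)"
    then have cd: "Poly_Mapping.keys c \<subseteq> carrier A" "Poly_Mapping.keys d \<subseteq> carrier A" by auto
    have "Poly_Mapping.keys (frag_extend (\<lambda>y. frag_of (x \<otimes>\<^bsub>A\<^esub> y)) d) \<subseteq> carrier A" if "x \<in> carrier A" for x
      by (rule order_trans[OF keys_frag_extend]) (use assms that cd in auto)
    then have "Poly_Mapping.keys (c \<otimes>\<^bsub>monoid_ring A\<^esub> d) \<subseteq> carrier A"
      unfolding monoid_ring_mult by (intro order_trans[OF keys_frag_extend]) (use cd in blast)
    then show "c \<otimes>\<^bsub>monoid_ring A\<^esub> d \<in> carrier (monoid_ring A)" by simp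
  qed (simp_all add: monoid_ring_mult frag_extend_add frag_extend_fun_add)
qed

lemma carrier_monoid_ring_generated:
  assumes "nonassoc_ring (monoid_ring A)"
  shows "carrier (monoid_ring A) = add_span (monoid_ring A) (frag_of ` carrier A)"
proof -
  interpret nonassoc_ring "monoid_ring A" by fact
  have sub: "frag_of ` carrier A \<subseteq> carrier (monoid_ring A)" by auto
  interpret S: additive_subgroup "add_span (monoid_ring A) (frag_of ` carrier A)" "monoid_ring A"
    by (rule additive_subgroup_add_span[OF sub])
  have "c \<in> add_span (monoid_ring A) (frag_of ` carrier A)"
    if "Poly_Mapping.keys c \<subseteq> carrier A" for c
  proof (rule free_Abelian_group_induct[OF that])
    show "0 \<in> add_span (monoid_ring A) (frag_of ` carrier A)" using S.zero_closed by simp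
  next
    fix x y
    assume "Poly_Mapping.keys y \<subseteq> carrier A"
      and "x \<in> add_span (monoid_ring A) (frag_of ` carrier A)"
      and "y \<in> add_span (monoid_ring A) (frag_of ` carrier A)"
    then show "x - y \<in> add_span (monoid_ring A) (frag_of ` carrier A)"
      using S.a_closed[of x "- y"] S.a_inv_closed[of y] by simp
  next
    fix a assume "a \<in> carrier A"
    then show "frag_of a \<in> add_span (monoid_ring A) (frag_of ` carrier A)"
      by (blast intro: generate.incl)
  qed
  then show ?thesis using S.a_subset by auto
qed


section \<open>Additive functions on quotients\<close>

text \<open>
  Rational additive functions serve to show that classes in a quotient are different.
\<close>

definition additive_on :: "('a, 'm) ring_scheme \<Rightarrow> ('a \<Rightarrow> rat) \<Rightarrow> bool" where
  "additive_on R \<phi> \<longleftrightarrow> (\<forall>a\<in>carrier R. \<forall>b\<in>carrier R. \<phi> (a \<oplus>\<^bsub>R\<^esub> b) = \<phi> a + \<phi> b)"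

lemma (in nonassoc_ring) additive_on_add_span_zero:
  assumes "additive_on R \<phi>" "S \<subseteq> carrier R" "\<And>s. s \<in> S \<Longrightarrow> \<phi> s = 0" "a \<in> add_span R S"
  shows "\<phi> a = 0"
proof -
  interpret J: additive_subgroup "add_span R S" R by (rule additive_subgroup_add_span) fact
  have add: "\<phi> (x \<oplus> y) = \<phi> x + \<phi> y" if "x \<in> carrier R" "y \<in> carrier R" for x y
    using assms(1) that by (simp add: additive_on_def)
  have 0: "\<phi> \<zero> = 0" using add[of \<zero> \<zero>] by simp
  have minus: "\<phi> (\<ominus> x) = - \<phi> x" if "x \<in> carrier R" for x
    using add[of "\<ominus> x" x] that 0 by (simp add: l_neg)
  show ?thesis using assms(4)
  proof (induction rule: generate.induct)
    case (inv h)
    then have "h \<in> carrier R" using assms(2) by blast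
    then show ?case using inv assms(3) minus[of h] by (simp add: a_inv_def)
  next
    case (eng a b)
    then show ?case using add[of a b] J.a_subset by auto
  qed (use 0 assms(3) in auto)
qed

text \<open>
  The function induced on cosets. It is only meaningful if \<open>\<phi>\<close> vanishes on the subgroup.
\<close>

definition quot_fun :: "('a \<Rightarrow> rat) \<Rightarrow> 'a set \<Rightarrow> rat" where
  "quot_fun \<phi> Q = \<phi> (SOME a. a \<in> Q)"

lemma (in nonassoc_ideal) quot_fun_coset:
  assumes "additive_on R \<phi>" "\<And>j. j \<in> J \<Longrightarrow> \<phi> j = 0" "a \<in> carrier R"
  shows "quot_fun \<phi> (J +> a) = \<phi> a"
proof -
  have "(SOME x. x \<in> J +> a) \<in> J +> a" using a_rcos_self[OF assms(3)] by (rule someI)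
  then obtain j where "j \<in> J" "(SOME x. x \<in> J +> a) = j \<oplus> a"
    by (auto simp: a_r_coset_def')
  then show ?thesis using assms by (auto simp: quot_fun_def additive_on_def)
qed

lemma (in nonassoc_ideal) additive_on_quot_fun:
  assumes "additive_on R \<phi>" "\<And>j. j \<in> J \<Longrightarrow> \<phi> j = 0"
  shows "additive_on (R Quot J) (quot_fun \<phi>)"
  unfolding additive_on_def
  by (auto elim!: coset_cases simp: coset_add quot_fun_coset[OF assms])
     (use assms(1) in \<open>simp add: additive_on_def\<close>)

definition frag_eval :: "('a \<Rightarrow> rat) \<Rightarrow> ('a \<Rightarrow>\<^sub>0 int) \<Rightarrow> rat" where
  "frag_eval f c = (\<Sum>x\<in>Poly_Mapping.keys c. of_int (Poly_Mapping.lookup c x) * f x)"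

lemma frag_eval_superset:
  assumes "finite Q" "Poly_Mapping.keys c \<subseteq> Q"
  shows "frag_eval f c = (\<Sum>x\<in>Q. of_int (Poly_Mapping.lookup c x) * f x)"
  unfolding frag_eval_def
  by (rule sum.mono_neutral_left) (use assms in \<open>auto simp: in_keys_iff\<close>)

lemma frag_eval_add: "frag_eval f (c + d) = frag_eval f c + frag_eval f d"
proof -
  let ?Q = "Poly_Mapping.keys c \<union> Poly_Mapping.keys d"
  have "Poly_Mapping.keys (c + d) \<subseteq> ?Q" by (rule keys_add)
  then show ?thesis
    using frag_eval_superset[of ?Q c f] frag_eval_superset[of ?Q d f] frag_eval_superset[of ?Q "c + d" f]
    by (simp add: lookup_add algebra_simps sum.distrib)
qed

lemma frag_eval_frag_of [simp]: "frag_eval f (frag_of x) = f x"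
  by (simp add: frag_eval_def)

lemma frag_eval_diff: "frag_eval f (c - d) = frag_eval f c - frag_eval f d"
  using frag_eval_add[of f "c - d" d] by simp

lemma additive_on_frag_eval: "additive_on (monoid_ring A) (frag_eval f)"
  by (simp add: additive_on_def frag_eval_add)


section \<open>Powers of spaces of functions on a group\<close>

definition fsmul :: "'k::field \<Rightarrow> ('a \<Rightarrow> 'k) \<Rightarrow> 'a \<Rightarrow> 'k" where
  "fsmul c f = (\<lambda>a. c * f a)"

global_interpretation fs: vector_space "fsmul :: 'k::field \<Rightarrow> ('a \<Rightarrow> 'k) \<Rightarrow> 'a \<Rightarrow> 'k"
  by unfold_locales (auto simp: fsmul_def fun_eq_iff algebra_simps)

lemma fsmul_times: "fsmul c f * g = fsmul c (f * g)" "g * fsmul c f = fsmul c (g * f)"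
  by (auto simp: fsmul_def fun_eq_iff)

definition fun_on :: "'a set \<Rightarrow> ('a \<Rightarrow> 'k::field) set" where
  "fun_on S = {f. \<forall>a. a \<notin> S \<longrightarrow> f a = 0}"

text \<open>
  The function \<open>1\<close>, extended by \<open>0\<close> outside of \<open>S\<close>. With this convention the functions on a subset
  of a type form a vector space.
\<close>

definition unit_fun :: "'a set \<Rightarrow> 'a \<Rightarrow> 'k::field" where
  "unit_fun S a = (if a \<in> S then 1 else 0)"

lemma fun_on_unit_fun [simp]: "unit_fun S \<in> fun_on S"
  by (simp add: fun_on_def unit_fun_def)

lemma subspace_fun_on [simp]: "fs.subspace (fun_on S)"
  by (auto simp: fun_on_def fs.subspace_def fsmul_def)

lemma fun_on_times: "f \<in> fun_on S \<Longrightarrow> f * g \<in> fun_on S"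
  by (simp add: fun_on_def)

lemma times_unit_fun: "f \<in> fun_on S \<Longrightarrow> f * unit_fun S = f"
  by (auto simp: fun_on_def unit_fun_def fun_eq_iff)

lemma fun_on_spanned:
  assumes "finite S" "f \<in> fun_on S"
  shows "f \<in> fs.span ((\<lambda>s. unit_fun {s}) ` S)"
proof -
  have "f = (\<Sum>s\<in>S. fsmul (f s) (unit_fun {s}))"
  proof
    fix a
    have "(\<Sum>s\<in>S. fsmul (f s) (unit_fun {s})) a = (\<Sum>s\<in>S. if a = s then f s else 0)"
      by (induction rule: infinite_finite_induct[of _ S]) (auto simp: fsmul_def unit_fun_def)
    also have "\<dots> = f a" using assms by (auto simp: fun_on_def)
    finally show "f a = (\<Sum>s\<in>S. fsmul (f s) (unit_fun {s})) a" by simp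
  qed
  also have "\<dots> \<in> fs.span ((\<lambda>s. unit_fun {s}) ` S)"
    by (rule fs.span_sum, rule fs.span_scale, rule fs.span_base) blast
  finally show ?thesis .
qed

definition fprod :: "('a \<Rightarrow> 'k::field) set \<Rightarrow> ('a \<Rightarrow> 'k) set \<Rightarrow> ('a \<Rightarrow> 'k) set" where
  "fprod C D = fs.span {f * g | f g. f \<in> C \<and> g \<in> D}"

lemma subspace_fprod [simp]: "fs.subspace (fprod C D)"
  by (simp add: fprod_def)

lemma fprod_mono: "\<lbrakk>C \<subseteq> C'; D \<subseteq> D'\<rbrakk> \<Longrightarrow> fprod C D \<subseteq> fprod C' D'"
  unfolding fprod_def by (rule fs.span_mono) blast

lemma times_in_fprod: "\<lbrakk>f \<in> C; g \<in> D\<rbrakk> \<Longrightarrow> f * g \<in> fprod C D"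
  unfolding fprod_def by (rule fs.span_base) blast

lemma fprod_fun_on: assumes "C \<subseteq> fun_on S" shows "fprod C D \<subseteq> fun_on S"
  unfolding fprod_def by (rule fs.span_minimal) (use assms fun_on_times in auto)

lemma times_in_span:
  assumes "f \<in> fs.span S" "g \<in> fs.span T"
  shows "f * g \<in> fs.span {f * g | f g. f \<in> S \<and> g \<in> T}" (is "_ \<in> ?R")
proof -
  have 1: "f * g \<in> ?R" if "f \<in> S" "g \<in> fs.span T" for f g
    using that(2)
  proof (induction rule: fs.span_induct_alt)
    case base
    show ?case unfolding mult_zero_right by (rule fs.span_zero)
  next
    case (step c x y)
    have "f * x \<in> ?R" using step(1) that(1) by (auto intro!: fs.span_base)
    then show ?case
      unfolding distrib_left fsmul_times using step.IH by (intro fs.span_add fs.span_scale)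
  qed
  from assms(1) show ?thesis
  proof (induction rule: fs.span_induct_alt)
    case base
    show ?case unfolding mult_zero_left by (rule fs.span_zero)
  next
    case (step c x y)
    have "x * g \<in> ?R" using step(1) assms(2) 1 by blast
    then show ?case
      unfolding distrib_right fsmul_times using step.IH by (intro fs.span_add fs.span_scale)
  qed
qed

lemma fprod_span:
  "fprod (fs.span S) (fs.span T) = fs.span {f * g | f g. f \<in> S \<and> g \<in> T}"
proof
  show "fprod (fs.span S) (fs.span T) \<subseteq> fs.span {f * g | f g. f \<in> S \<and> g \<in> T}"
    unfolding fprod_def by (rule fs.span_minimal) (use times_in_span in auto)
  show "fs.span {f * g | f g. f \<in> S \<and> g \<in> T} \<subseteq> fprod (fs.span S) (fs.span T)"
    unfolding fprod_def by (rule fs.span_mono) (blast intro: fs.span_base)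
qed

lemma fprod_assoc:
  assumes "fs.subspace C" "fs.subspace D" "fs.subspace E"
  shows "fprod (fprod C D) E = fprod C (fprod D E)"
proof -
  let ?CD = "{f * g | f g. f \<in> C \<and> g \<in> D}" and ?DE = "{g * h | g h. g \<in> D \<and> h \<in> E}"
  have span: "fs.span C = C" "fs.span E = E" using assms by simp_all
  have "{f * h | f h. f \<in> ?CD \<and> h \<in> E} = {f * h | f h. f \<in> C \<and> h \<in> ?DE}"
  proof (intro equalityI subsetI)
    fix a assume "a \<in> {f * h | f h. f \<in> ?CD \<and> h \<in> E}"
    then obtain f g h where "a = f * g * h" "f \<in> C" "g \<in> D" "h \<in> E" by blast
    then show "a \<in> {f * h | f h. f \<in> C \<and> h \<in> ?DE}" unfolding mult.assoc by blast
  next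
    fix a assume "a \<in> {f * h | f h. f \<in> C \<and> h \<in> ?DE}"
    then obtain f g h where "a = f * (g * h)" "f \<in> C" "g \<in> D" "h \<in> E" by blast
    then show "a \<in> {f * h | f h. f \<in> ?CD \<and> h \<in> E}" unfolding mult.assoc[symmetric] by blast
  qed
  moreover have "fprod (fprod C D) E = fs.span {f * h | f h. f \<in> ?CD \<and> h \<in> E}"
    using fprod_span[of ?CD E] unfolding span fprod_def[of C D] .
  moreover have "fprod C (fprod D E) = fs.span {f * h | f h. f \<in> C \<and> h \<in> ?DE}"
    using fprod_span[of C ?DE] unfolding span fprod_def[of D E] .
  ultimately show ?thesis by (simp only:)
qed

lemma fprod_unit:
  assumes "fs.subspace C" "C \<subseteq> fun_on S"
  shows "fprod C (fs.span {unit_fun S}) = C"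
proof -
  have "fprod C (fs.span {unit_fun S}) = fs.span {f * g | f g. f \<in> C \<and> g \<in> {unit_fun S}}"
    using fprod_span[of C "{unit_fun S}"] assms(1)
    by (simp only: fs.span_eq_iff[THEN iffD2])
  also have "{f * g | f g. f \<in> C \<and> g \<in> {unit_fun S}} = (\<lambda>f. f * unit_fun S) ` C" by blast
  also have "\<dots> = (\<lambda>f. f) ` C"
    by (rule image_cong[OF refl]) (rule times_unit_fun, use assms(2) in blast)
  also have "(\<lambda>f. f) ` C = C" by (rule image_ident)
  also have "fs.span C = C" using assms(1) by simp
  finally show ?thesis .
qed

fun fpow :: "'a set \<Rightarrow> ('a \<Rightarrow> 'k::field) set \<Rightarrow> nat \<Rightarrow> ('a \<Rightarrow> 'k) set" where
  "fpow S C 0 = fs.span {unit_fun S}"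
| "fpow S C (Suc n) = fprod (fpow S C n) C"

lemma subspace_fpow [simp]: "fs.subspace (fpow S C n)"
  by (cases n) auto

lemma fpow_fun_on: "fpow S C n \<subseteq> fun_on S"
proof (induction n)
  case 0
  show ?case unfolding fpow.simps by (rule fs.span_minimal) auto
next
  case (Suc n)
  then show ?case by (simp add: fprod_fun_on)
qed

lemma fpow_add:
  assumes "fs.subspace C"
  shows "fpow S C (m + n) = fprod (fpow S C m) (fpow S C n)"
  by (induction n) (simp_all add: fprod_unit fpow_fun_on fprod_assoc assms)

lemma power_in_fpow: assumes "f \<in> C" "C \<subseteq> fun_on S" shows "f ^ Suc n \<in> fpow S C (Suc n)"
proof (induction n)
  case 0
  have "unit_fun S * f \<in> fpow S C 1"
    using assms by (auto intro!: times_in_fprod fs.span_base)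
  then show ?case using assms times_unit_fun[of f S] by (auto simp: mult.commute)
next
  case (Suc n)
  then have "f ^ Suc n * f \<in> fpow S C (Suc (Suc n))"
    unfolding fpow.simps(2)[of S C "Suc n"] using assms(1) by (rule times_in_fprod)
  then show ?case by (simp only: power_Suc2)
qed

lemma ascending_chain_stabilizes:
  fixes D :: "nat \<Rightarrow> ('a \<Rightarrow> 'k::field) set"
  assumes "finite S" "\<And>k. fs.subspace (D k)" "\<And>k. D k \<subseteq> fun_on S" "\<And>k. D k \<subseteq> D (Suc k)"
  obtains K where "\<And>k. k \<ge> K \<Longrightarrow> D k = D K"
proof -
  let ?U = "\<Union>k. D k"
  have mono: "D i \<subseteq> D j" if "i \<le> j" for i j
    using assms(4) that by (rule lift_Suc_mono_le)
  obtain B where B: "B \<subseteq> ?U" "fs.independent B" "?U \<subseteq> fs.span B"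
    using fs.maximal_independent_subset[of ?U] by blast
  have "B \<subseteq> fs.span ((\<lambda>s. unit_fun {s}) ` S)"
    using B(1) assms(1,3) fun_on_spanned by blast
  then have "finite B"
    using fs.independent_span_bound[OF finite_imageI[OF assms(1)] B(2)] by blast
  have "\<forall>b\<in>B. \<exists>k. b \<in> D k" using B(1) by blast
  then obtain \<kappa> where \<kappa>: "\<And>b. b \<in> B \<Longrightarrow> b \<in> D (\<kappa> b)" by metis
  define K where "K = (\<Sum>b\<in>B. \<kappa> b)"
  have "B \<subseteq> D K"
  proof
    fix b assume "b \<in> B"
    then have "\<kappa> b \<le> K" unfolding K_def using \<open>finite B\<close> by (intro member_le_sum) auto
    then show "b \<in> D K" using \<kappa>[OF \<open>b \<in> B\<close>] mono by blast
  qed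
  then have "?U \<subseteq> D K" using B(3) assms(2) fs.span_minimal by blast
  then have "D k = D K" if "k \<ge> K" for k using mono[OF that] by blast
  then show ?thesis using that by blast
qed

text \<open>
  If a power \<open>C\<^sup>N\<close> contains \<open>1\<close> then \<open>C\<^sup>n = C\<^sup>n \<cdot> 1 \<subseteq> C\<^sup>n\<^sup>+\<^sup>N\<close>, so the powers \<open>C\<^sup>k\<^sup>N\<close> form an
  ascending chain in a finite-dimensional space.
\<close>

lemma fpow_multiples_stabilize:
  assumes "finite S" "fs.subspace C" "unit_fun S \<in> fpow S C N"
  obtains K where "K \<ge> 1" "\<And>k. k \<ge> K \<Longrightarrow> fpow S C (k * N) = fpow S C (K * N)"
    "\<And>k. unit_fun S \<in> fpow S C (k * N)"
proof -
  have unit: "fs.span {unit_fun S} \<subseteq> fpow S C N"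
    using assms(3) by (intro fs.span_minimal) auto
  have step: "fpow S C n \<subseteq> fpow S C (n + N)" for n
  proof -
    have "fpow S C n = fprod (fpow S C n) (fs.span {unit_fun S})"
      by (simp add: fprod_unit fpow_fun_on)
    also have "\<dots> \<subseteq> fprod (fpow S C n) (fpow S C N)" by (rule fprod_mono) (use unit in auto)
    finally show ?thesis by (simp add: fpow_add assms(2))
  qed
  have step': "fpow S C (k * N) \<subseteq> fpow S C (Suc k * N)" for k
    using step[of "k * N"] by (simp add: add.commute)
  obtain K where K: "\<And>k. k \<ge> K \<Longrightarrow> fpow S C (k * N) = fpow S C (K * N)"
    using ascending_chain_stabilizes[OF assms(1), of "\<lambda>k. fpow S C (k * N)"] step' fpow_fun_on
    by (metis subspace_fpow)
  have "unit_fun S \<in> fpow S C (k * N)" for k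
  proof (induction k)
    case 0
    then show ?case by (simp add: fs.span_base)
  next
    case (Suc k)
    then show ?case using step' by blast
  qed
  moreover have "fpow S C (k * N) = fpow S C (Suc K * N)" if "k \<ge> Suc K" for k
    using K[of k] K[of "Suc K"] that by simp
  ultimately show ?thesis using that[of "Suc K"] by simp
qed

text \<open>
  Let \<open>p = \<Prod>(x - v)\<close>, with \<open>v\<close> running over the values of \<open>f\<close> other than \<open>0\<close> and \<open>f(s\<^sub>0)\<close>. The
  polynomial \<open>x p\<close> vanishes at all values of \<open>f\<close> except \<open>f(s\<^sub>0)\<close>, so the sum of its values at the
  \<open>f(s)\<close> is a positive multiple of a nonzero number. As \<open>x p\<close> has no constant term, this sum is also a
  combination of power sums with positive exponents.
\<close>

lemma power_sum_nonzero:
  fixes f :: "'a \<Rightarrow> 'k::field_char_0"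
  assumes "finite S" "s\<^sub>0 \<in> S" "f s\<^sub>0 \<noteq> 0"
  shows "\<exists>n. (\<Sum>s\<in>S. f s ^ Suc n) \<noteq> 0"
proof (rule ccontr)
  assume "\<not> ?thesis"
  then have 0: "(\<Sum>s\<in>S. f s ^ Suc n) = 0" for n by blast
  define p where "p = (\<Prod>v\<in>f ` S - {0, f s\<^sub>0}. [:- v, 1:])"
  have "(\<Sum>s\<in>S. f s * poly p (f s)) = (\<Sum>s\<in>S. \<Sum>i\<le>degree p. coeff p i * f s ^ Suc i)"
    by (simp add: poly_altdef sum_distrib_left algebra_simps)
  also have "\<dots> = (\<Sum>i\<le>degree p. coeff p i * (\<Sum>s\<in>S. f s ^ Suc i))"
    by (subst sum.swap) (simp add: sum_distrib_left)
  also have "\<dots> = 0" using 0 by simp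
  finally have "(\<Sum>s\<in>S. f s * poly p (f s)) = 0" .
  moreover have "f s * poly p (f s) = (if f s = f s\<^sub>0 then f s\<^sub>0 * poly p (f s\<^sub>0) else 0)" if "s \<in> S" for s
    using that assms(1) by (auto simp: p_def poly_prod prod_zero_iff)
  ultimately have "(\<Sum>s\<in>S. if f s = f s\<^sub>0 then f s\<^sub>0 * poly p (f s\<^sub>0) else 0) = 0" by simp
  then have "of_nat (card {s \<in> S. f s = f s\<^sub>0}) * (f s\<^sub>0 * poly p (f s\<^sub>0)) = 0"
    using assms(1) by (simp add: sum.If_cases Int_def)
  moreover have "card {s \<in> S. f s = f s\<^sub>0} \<noteq> 0" using assms(1,2) by auto
  moreover have "poly p (f s\<^sub>0) \<noteq> 0" using assms(1) by (auto simp: p_def poly_prod)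
  ultimately show False using assms(3) by simp
qed

definition translate :: "('g, 'm) monoid_scheme \<Rightarrow> 'g \<Rightarrow> ('g \<Rightarrow> 'k::field) \<Rightarrow> 'g \<Rightarrow> 'k" where
  "translate G h f = (\<lambda>g. if g \<in> carrier G then f (h \<otimes>\<^bsub>G\<^esub> g) else 0)"

text \<open>
  Translation invariant spaces are the \<open>G\<close>-submodules of the space of functions on \<open>G\<close>.
\<close>

definition translation_invariant :: "('g, 'm) monoid_scheme \<Rightarrow> ('g \<Rightarrow> 'k::field) set \<Rightarrow> bool" where
  "translation_invariant G C \<longleftrightarrow> (\<forall>h\<in>carrier G. translate G h ` C \<subseteq> C)"

lemma translate_simps:
  "translate G h 0 = 0" "translate G h (f + g) = translate G h f + translate G h g"
  "translate G h (fsmul c f) = fsmul c (translate G h f)"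
  "translate G h (f * g) = translate G h f * translate G h g"
  by (auto simp: translate_def fsmul_def fun_eq_iff)

lemma translate_span:
  assumes "\<And>s. s \<in> S \<Longrightarrow> translate G h s \<in> fs.span T" "f \<in> fs.span S"
  shows "translate G h f \<in> fs.span T"
  using assms(2)
proof (induction rule: fs.span_induct_alt)
  case base
  show ?case unfolding translate_simps by (rule fs.span_zero)
next
  case (step c x y)
  show ?case unfolding translate_simps
    using assms(1)[OF step(1)] step(2) by (intro fs.span_add fs.span_scale)
qed

lemma translation_invariant_fprod:
  assumes "translation_invariant G C" "translation_invariant G D"
  shows "translation_invariant G (fprod C D)"
  unfolding translation_invariant_def fprod_def
proof (intro ballI image_subsetI)
  fix h f assume h: "h \<in> carrier G" and f: "f \<in> fs.span {f * g | f g. f \<in> C \<and> g \<in> D}"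
  show "translate G h f \<in> fs.span {f * g | f g. f \<in> C \<and> g \<in> D}"
  proof (rule translate_span[OF _ f])
    fix s assume "s \<in> {f * g | f g. f \<in> C \<and> g \<in> D}"
    then obtain a b where "s = a * b" "a \<in> C" "b \<in> D" by blast
    then have "translate G h s = translate G h a * translate G h b"
      "translate G h a \<in> C" "translate G h b \<in> D"
      using assms h by (simp_all add: translation_invariant_def translate_simps image_subset_iff)
    then show "translate G h s \<in> fs.span {f * g | f g. f \<in> C \<and> g \<in> D}"
      by (auto intro!: fs.span_base)
  qed
qed

lemma (in group) translation_invariant_fpow:
  fixes C :: "('a \<Rightarrow> 'k::field) set"
  assumes "translation_invariant G C"
  shows "translation_invariant G (fpow (carrier G) C n)"
proof (induction n)
  case 0
  have unit: "translate G h (unit_fun (carrier G)) = unit_fun (carrier G)" if "h \<in> carrier G" for h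
    using that by (auto simp: translate_def unit_fun_def fun_eq_iff)
  show ?case
    unfolding translation_invariant_def fpow.simps
  proof (intro ballI image_subsetI)
    fix h f assume "h \<in> carrier G" and f: "f \<in> fs.span {unit_fun (carrier G) :: 'a \<Rightarrow> 'k}"
    then show "translate G h f \<in> fs.span {unit_fun (carrier G)}"
      by (intro translate_span[OF _ f]) (auto simp: unit intro!: fs.span_base)
  qed
next
  case (Suc n)
  then show ?case by (simp add: translation_invariant_fprod assms)
qed

text \<open>
  The sum of all translates of \<open>f\<^sup>n\<close> is constant, and its value is a power sum of the values of \<open>f\<close>.
\<close>

lemma (in group) unit_fun_in_power:
  fixes C :: "('a \<Rightarrow> 'k::field_char_0) set"
  assumes fin: "finite (carrier G)" and inv: "translation_invariant G C"
    and C: "C \<subseteq> fun_on (carrier G)" "f \<in> C" "f \<noteq> 0"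
  obtains N where "N \<ge> 1" "unit_fun (carrier G) \<in> fpow (carrier G) C N"
proof -
  let ?P = "fpow (carrier G) C"
  obtain a where "f a \<noteq> 0" using C(3) by (auto simp: fun_eq_iff)
  moreover have "a \<in> carrier G" using C calculation by (auto simp: fun_on_def)
  ultimately obtain n where n: "(\<Sum>s\<in>carrier G. f s ^ Suc n) \<noteq> 0"
    using power_sum_nonzero[OF fin, of a f] by blast
  let ?c = "\<Sum>s\<in>carrier G. f s ^ Suc n"
  have pow: "(f ^ Suc n) g = f g ^ Suc n" for g by (induction n) auto
  have "translate G h (f ^ Suc n) \<in> ?P (Suc n)" if "h \<in> carrier G" for h
    using translation_invariant_fpow[OF inv, of "Suc n"] power_in_fpow[OF C(2,1), of n] that
    by (auto simp: translation_invariant_def simp del: power_Suc fpow.simps)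
  then have "(\<Sum>h\<in>carrier G. translate G h (f ^ Suc n)) \<in> ?P (Suc n)"
    by (rule fs.subspace_sum[OF subspace_fpow])
  also have "(\<Sum>h\<in>carrier G. translate G h (f ^ Suc n)) = fsmul ?c (unit_fun (carrier G))"
  proof
    fix g
    have app: "(\<Sum>h\<in>A. translate G h (f ^ Suc n)) g = (\<Sum>h\<in>A. translate G h (f ^ Suc n) g)" for A
      by (induction A rule: infinite_finite_induct) auto
    show "(\<Sum>h\<in>carrier G. translate G h (f ^ Suc n)) g = fsmul ?c (unit_fun (carrier G)) g"
    proof (cases "g \<in> carrier G")
      case True
      have "(\<Sum>h\<in>carrier G. translate G h (f ^ Suc n) g) = (\<Sum>h\<in>carrier G. f (h \<otimes> g) ^ Suc n)"
        unfolding translate_def pow using True by simp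
      also have "\<dots> = ?c"
        by (rule sum.reindex_bij_witness[where j = "\<lambda>h. h \<otimes> g" and i = "\<lambda>h. h \<otimes> inv g"])
           (use True in \<open>auto simp: m_assoc\<close>)
      finally show ?thesis using True by (simp only: app) (simp add: fsmul_def unit_fun_def)
    next
      case False
      then show ?thesis by (simp only: app) (simp add: translate_def fsmul_def unit_fun_def)
    qed
  qed
  finally have "fsmul (inverse ?c) (fsmul ?c (unit_fun (carrier G))) \<in> ?P (Suc n)"
    by (rule fs.subspace_scale[OF subspace_fpow])
  moreover have "fsmul (inverse ?c) (fsmul ?c (unit_fun (carrier G))) = unit_fun (carrier G)"
    using n by (simp add: fsmul_def fun_eq_iff)
  ultimately show ?thesis using that[of "Suc n"] by simp
qed


section \<open>Linear maps between coordinate spaces\<close>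

text \<open>
  Vectors are functions that are mostly treated as points of a vector space, so their pointwise
  operations should only be unfolded on demand.
\<close>

declare plus_fun_apply [simp del] zero_fun_apply [simp del] times_fun_apply [simp del]

lemma smul_apply: "smul c x i = c * x i"
  by (simp add: smul_def)

lemma sum_fun_apply: "(\<Sum>a\<in>A. f a) i = (\<Sum>a\<in>A. f a i)"
  by (induction A rule: infinite_finite_induct) (auto simp: plus_fun_apply zero_fun_apply)

lemmas vec_apply = smul_apply sum_fun_apply plus_fun_apply zero_fun_apply

lemma linear_on_subset: "\<lbrakk>linear_on T f; S \<subseteq> T\<rbrakk> \<Longrightarrow> linear_on S f"
  unfolding linear_on_def by blast

lemma linear_on_add: "\<lbrakk>linear_on S f; x \<in> S; y \<in> S\<rbrakk> \<Longrightarrow> f (x + y) = f x + f y"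
  by (simp add: linear_on_def)

lemma linear_on_smul: "\<lbrakk>linear_on S f; x \<in> S\<rbrakk> \<Longrightarrow> f (smul c x) = smul c (f x)"
  by (simp add: linear_on_def)

lemma linear_on_zero: assumes "linear_on S f" "vs.subspace S" shows "f 0 = 0"
  using linear_on_smul[OF assms(1) vs.subspace_0[OF assms(2)], of 0] by simp

lemma linear_on_diff:
  assumes "linear_on S f" "vs.subspace S" "x \<in> S" "y \<in> S" shows "f (x - y) = f x - f y"
  using linear_on_add[OF assms(1) vs.subspace_diff[OF assms(2-4)] assms(4)] by (simp add: algebra_simps)

lemma linear_on_sum:
  assumes "linear_on S f" "vs.subspace S" "\<And>i. i \<in> I \<Longrightarrow> x i \<in> S"
  shows "f (\<Sum>i\<in>I. x i) = (\<Sum>i\<in>I. f (x i))"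
  using assms(3)
proof (induction I rule: infinite_finite_induct)
  case (insert i I)
  have "(\<Sum>i\<in>I. x i) \<in> S" using insert assms(2) by (intro vs.subspace_sum) auto
  then show ?case using insert linear_on_add[OF assms(1), of "x i" "\<Sum>i\<in>I. x i"] by simp
qed (use linear_on_zero[OF assms(1,2)] in auto)

lemma linear_on_comp:
  "\<lbrakk>linear_on S f; f ` S \<subseteq> T; linear_on T g\<rbrakk> \<Longrightarrow> linear_on S (\<lambda>x. g (f x))"
  by (auto simp: linear_on_def image_subset_iff)

lemma subspace_linear_image:
  assumes "linear_on S f" "vs.subspace S" shows "vs.subspace (f ` S)"
proof (rule vs.subspaceI)
  show "0 \<in> f ` S" using linear_on_zero[OF assms] vs.subspace_0[OF assms(2)] by force
next
  fix x y assume "x \<in> f ` S" "y \<in> f ` S"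
  then obtain a b where "a \<in> S" "b \<in> S" "x = f a" "y = f b" by auto
  then have "x + y = f (a + b)" "a + b \<in> S"
    using linear_on_add[OF assms(1)] vs.subspace_add[OF assms(2)] by auto
  then show "x + y \<in> f ` S" by blast
next
  fix c x assume "x \<in> f ` S"
  then obtain a where "a \<in> S" "x = f a" by auto
  then have "smul c x = f (smul c a)" "smul c a \<in> S"
    using linear_on_smul[OF assms(1)] vs.subspace_scale[OF assms(2)] by auto
  then show "smul c x \<in> f ` S" by blast
qed

lemma subspace_linear_preimage:
  assumes "linear_on S f" "vs.subspace S" "vs.subspace T" shows "vs.subspace {x \<in> S. f x \<in> T}"
  using vs.subspace_0[OF assms(2)] vs.subspace_0[OF assms(3)] linear_on_zero[OF assms(1,2)]
  by (intro vs.subspaceI)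
     (simp_all add: linear_on_add[OF assms(1)] linear_on_smul[OF assms(1)]
       vs.subspace_add[OF assms(2)] vs.subspace_add[OF assms(3)]
       vs.subspace_scale[OF assms(2)] vs.subspace_scale[OF assms(3)])

lemma linear_on_span_closed:
  assumes "linear_on S f" "vs.subspace S" "B \<subseteq> S" "vs.subspace T" "\<And>x. x \<in> B \<Longrightarrow> f x \<in> T"
    "x \<in> vs.span B"
  shows "f x \<in> T"
proof -
  have "vs.span B \<subseteq> {x \<in> S. f x \<in> T}"
    by (rule vs.span_minimal[OF _ subspace_linear_preimage[OF assms(1,2,4)]]) (use assms in auto)
  then show ?thesis using assms(6) by blast
qed

lemma linear_on_span_eq:
  assumes "linear_on S f" "linear_on S g" "vs.subspace S" "B \<subseteq> S" "\<And>x. x \<in> B \<Longrightarrow> f x = g x"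
    "x \<in> vs.span B"
  shows "f x = g x"
proof -
  have "vs.span B \<subseteq> {x \<in> S. f x = g x}"
  proof (rule vs.span_minimal)
    show "vs.subspace {x \<in> S. f x = g x}"
      using vs.subspace_0[OF assms(3)] linear_on_zero[OF assms(1,3)] linear_on_zero[OF assms(2,3)]
      by (intro vs.subspaceI)
         (simp_all add: linear_on_add[OF assms(1)] linear_on_smul[OF assms(1)]
           linear_on_add[OF assms(2)] linear_on_smul[OF assms(2)]
           vs.subspace_add[OF assms(3)] vs.subspace_scale[OF assms(3)])
  qed (use assms in auto)
  then show ?thesis using assms(6) by blast
qed

lemma linear_on_image_span:
  assumes "linear_on S f" "vs.subspace S" "B \<subseteq> S" shows "f ` vs.span B = vs.span (f ` B)"
proof
  show "f ` vs.span B \<subseteq> vs.span (f ` B)"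
  proof
    fix y assume "y \<in> f ` vs.span B"
    then obtain x where x: "x \<in> vs.span B" "y = f x" by auto
    show "y \<in> vs.span (f ` B)" unfolding x(2)
      by (rule linear_on_span_closed[OF assms vs.subspace_span _ x(1)]) (simp add: vs.span_base)
  qed
  have "vs.span B \<subseteq> S" using assms(2,3) by (rule vs.span_minimal[rotated])
  then have "vs.subspace (f ` vs.span B)"
    using linear_on_subset[OF assms(1)] by (intro subspace_linear_image) auto
  then show "vs.span (f ` B) \<subseteq> f ` vs.span B"
    using vs.span_superset by (intro vs.span_minimal) auto
qed

lemma linear_on_extend:
  assumes "linear_on S f" "vs.subspace S"
  obtains F where "linear_on UNIV F" "\<And>x. x \<in> S \<Longrightarrow> F x = f x"
proof -
  interpret p: vector_space_pair "smul :: 'a \<Rightarrow> 'a vec \<Rightarrow> 'a vec" "smul :: 'a \<Rightarrow> 'a vec \<Rightarrow> 'a vec"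
    by unfold_locales
  obtain B where B: "B \<subseteq> S" "vs.independent B" "S \<subseteq> vs.span B"
    using vs.maximal_independent_subset[of S] by blast
  define F where "F = p.construct B f"
  have lin: "linear_on UNIV F"
    using p.linear_add[OF p.linear_construct[OF B(2), of f]]
      p.linear_scale[OF p.linear_construct[OF B(2), of f]]
    by (simp add: linear_on_def F_def)
  have "F x = f x" if "x \<in> S" for x
    using linear_on_span_eq[OF linear_on_subset[OF lin] assms(1,2) B(1), of x]
      p.construct_basis[OF B(2)] B(3) that by (auto simp: F_def)
  then show ?thesis using that lin by blast
qed

text \<open>
  The space of a module with the index set made explicit, so that it is also available for linear
  maps that do not come from a module action.
\<close>

definition fsv :: "nat set \<Rightarrow> 'k::field vec set" where
  "fsv I = {x. finite {i. x i \<noteq> 0} \<and> {i. x i \<noteq> 0} \<subseteq> I}"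

lemma vecs_fsv: "vecs V = fsv (index V)"
  by (simp add: vecs_def fsv_def)

lemma subspace_fsv [simp]: "vs.subspace (fsv I :: 'k::field vec set)"
proof (rule vs.subspaceI)
  fix x y :: "'k vec" assume "x \<in> fsv I" "y \<in> fsv I"
  moreover have "{i. (x + y) i \<noteq> 0} \<subseteq> {i. x i \<noteq> 0} \<union> {i. y i \<noteq> 0}"  by (auto simp: vec_apply)
  ultimately show "x + y \<in> fsv I" by (auto simp: fsv_def intro: finite_subset)
next
  fix c and x :: "'k vec" assume "x \<in> fsv I"
  moreover have "{i. smul c x i \<noteq> 0} \<subseteq> {i. x i \<noteq> 0}" by (auto simp: smul_apply)
  ultimately show "smul c x \<in> fsv I" by (auto simp: fsv_def intro: finite_subset)
qed (simp add: fsv_def vec_apply)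

lemma subspace_vecs [simp]: "vs.subspace (vecs V)"
  by (simp add: vecs_fsv)

lemma unit_vec_in_fsv: "i \<in> I \<Longrightarrow> unit_vec i \<in> fsv I"
  by (auto simp: fsv_def unit_vec_def)

lemma fsv_expand:
  fixes x :: "'k::field vec"
  assumes "finite J" "{i. x i \<noteq> 0} \<subseteq> J" shows "x = (\<Sum>i\<in>J. smul (x i) (unit_vec i))"
proof
  fix j
  have "(\<Sum>i\<in>J. smul (x i) (unit_vec i)) j = (\<Sum>i\<in>J. if j = i then x i else 0)"
    unfolding sum_fun_apply by (rule sum.cong) (auto simp: smul_apply unit_vec_def)
  also have "\<dots> = x j" using assms by auto
  finally show "x j = (\<Sum>i\<in>J. smul (x i) (unit_vec i)) j" by simp
qed

lemma fsv_span: "fsv I = (vs.span (unit_vec ` I) :: 'k::field vec set)"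
proof
  show "fsv I \<subseteq> (vs.span (unit_vec ` I) :: 'k vec set)"
  proof
    fix x :: "'k vec" assume x: "x \<in> fsv I"
    let ?J = "{i. x i \<noteq> 0}"
    have J: "finite ?J" "?J \<subseteq> I" using x by (auto simp: fsv_def)
    have "(\<Sum>i\<in>?J. smul (x i) (unit_vec i)) \<in> vs.span (unit_vec ` I)"
      by (rule vs.span_sum, rule vs.span_scale, rule vs.span_base) (use J in blast)
    moreover have "x = (\<Sum>i\<in>?J. smul (x i) (unit_vec i))"
      by (rule fsv_expand[OF J(1) order_refl])
    ultimately show "x \<in> vs.span (unit_vec ` I)" by metis
  qed
  show "vs.span (unit_vec ` I) \<subseteq> (fsv I :: 'k vec set)"
    by (rule vs.span_minimal) (auto intro: unit_vec_in_fsv)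
qed


section \<open>Modules over the group algebra\<close>

lemma kg_moduleD:
  assumes "kg_module G V" "g \<in> carrier G"
  shows act_closed: "x \<in> vecs V \<Longrightarrow> act V g x \<in> vecs V"
    and act_linear: "linear_on (vecs V) (act V g)"
    and act_mult: "\<lbrakk>h \<in> carrier G; x \<in> vecs V\<rbrakk> \<Longrightarrow> act V (g \<otimes>\<^bsub>G\<^esub> h) x = act V g (act V h x)"
  using assms by (auto simp: kg_module_def)

lemma act_one: "\<lbrakk>kg_module G V; x \<in> vecs V\<rbrakk> \<Longrightarrow> act V \<one>\<^bsub>G\<^esub> x = x"
  by (simp add: kg_module_def)

lemma alg_act_add: "alg_act G V (a + b) x = alg_act G V a x + alg_act G V b x"
  by (simp add: alg_act_def plus_fun_apply vs.scale_left_distrib sum.distrib)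

lemma alg_act_fsmul: "alg_act G V (fsmul c a) x = smul c (alg_act G V a x)"
  by (simp add: alg_act_def vs.scale_sum_right fsmul_def)

lemma alg_act_diff: "alg_act G V (a - b) x = alg_act G V a x - alg_act G V b x"
  by (simp add: alg_act_def vs.scale_left_diff_distrib sum_subtractf)

lemma alg_act_zero: "alg_act G V 0 x = 0"
  by (simp add: alg_act_def zero_fun_apply)

lemma alg_act_in_subspace:
  assumes "vs.subspace S" "\<And>g. g \<in> carrier G \<Longrightarrow> act V g x \<in> S"
  shows "alg_act G V a x \<in> S"
  unfolding alg_act_def using assms by (intro vs.subspace_sum vs.subspace_scale) auto

lemma alg_act_closed: "\<lbrakk>kg_module G V; x \<in> vecs V\<rbrakk> \<Longrightarrow> alg_act G V a x \<in> vecs V"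
  by (rule alg_act_in_subspace) (auto intro: act_closed)

lemma alg_act_linear: assumes "kg_module G V" shows "linear_on (vecs V) (alg_act G V a)"
  unfolding linear_on_def
proof (intro conjI ballI allI)
  fix x y assume "x \<in> vecs V" "y \<in> vecs V"
  then have "act V g (x + y) = act V g x + act V g y" if "g \<in> carrier G" for g
    using linear_on_add[OF act_linear[OF assms that]] by blast
  then show "alg_act G V a (x + y) = alg_act G V a x + alg_act G V a y"
    by (simp add: alg_act_def vs.scale_right_distrib sum.distrib)
next
  fix c x assume "x \<in> vecs V"
  then have "act V g (smul c x) = smul c (act V g x)" if "g \<in> carrier G" for g
    using linear_on_smul[OF act_linear[OF assms that]] by blast
  then show "alg_act G V a (smul c x) = smul c (alg_act G V a x)"
    by (simp add: alg_act_def vs.scale_sum_right mult.commute)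
qed

locale finite_group = group G for G (structure) +
  assumes finite_carrier: "finite (carrier G)"
begin

lemma alg_act_unit_fun: "g \<in> carrier G \<Longrightarrow> alg_act G V (unit_fun {g}) x = act V g x"
proof -
  assume g: "g \<in> carrier G"
  have "alg_act G V (unit_fun {g}) x = (\<Sum>h\<in>carrier G. if h = g then act V g x else 0)"
    unfolding alg_act_def by (rule sum.cong) (auto simp: unit_fun_def)
  also have "\<dots> = act V g x" using g finite_carrier by simp
  finally show ?thesis .
qed

lemma act_alg_act:
  assumes "kg_module G V" "h \<in> carrier G" "x \<in> vecs V"
  shows "act V h (alg_act G V a x) = alg_act G V (\<lambda>g. a (inv h \<otimes> g)) x"
proof -
  have "act V h (alg_act G V a x) = (\<Sum>g\<in>carrier G. smul (a g) (act V h (act V g x)))"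
    unfolding alg_act_def
    using linear_on_sum[OF act_linear[OF assms(1,2)] subspace_vecs, of "carrier G" "\<lambda>g. smul (a g) (act V g x)"]
      assms act_closed[OF assms(1) _ assms(3)]
    by (simp add: linear_on_smul[OF act_linear[OF assms(1,2)]] vs.subspace_scale[OF subspace_vecs])
  also have "\<dots> = (\<Sum>g\<in>carrier G. smul (a g) (act V (h \<otimes> g) x))"
    using assms by (simp add: act_mult)
  also have "\<dots> = (\<Sum>g\<in>carrier G. smul (a (inv h \<otimes> g)) (act V g x))"
    by (rule sum.reindex_bij_witness[where i = "\<lambda>g. inv h \<otimes> g" and j = "\<lambda>g. h \<otimes> g"])
       (use assms in \<open>auto simp: m_assoc[symmetric]\<close>)
  finally show ?thesis by (simp add: alg_act_def)
qed

text \<open>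
  By linearity in \<open>K[G]\<close>, group elements can replace general elements of the group algebra.
\<close>

lemma alg_span_subset_iff:
  assumes "vs.subspace H"
  shows "alg_span G V L \<subseteq> H \<longleftrightarrow> (\<forall>g\<in>carrier G. \<forall>x\<in>L. act V g x \<in> H)"
proof
  assume sub: "alg_span G V L \<subseteq> H"
  show "\<forall>g\<in>carrier G. \<forall>x\<in>L. act V g x \<in> H"
  proof (intro ballI)
    fix g x assume "g \<in> carrier G" "x \<in> L"
    then have "alg_act G V (unit_fun {g}) x \<in> alg_span G V L"
      unfolding alg_span_def by (intro vs.span_base) blast
    then show "act V g x \<in> H" using sub alg_act_unit_fun[OF \<open>g \<in> carrier G\<close>, of V x] by auto
  qed
next
  assume "\<forall>g\<in>carrier G. \<forall>x\<in>L. act V g x \<in> H"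
  then have "alg_act G V a x \<in> H" if "x \<in> L" for a x
    using that assms by (intro alg_act_in_subspace) auto
  then show "alg_span G V L \<subseteq> H"
    unfolding alg_span_def by (intro vs.span_minimal) (use assms in auto)
qed

lemma alg_span_cyclic:
  assumes "kg_module G V" "u \<in> vecs V"
  shows "alg_span G V (vs.span {u}) = range (\<lambda>a. alg_act G V a u)"
proof
  have sub: "vs.subspace (range (\<lambda>a. alg_act G V a u))"
  proof (rule vs.subspaceI)
    show "0 \<in> range (\<lambda>a. alg_act G V a u)" using alg_act_zero by (metis rangeI)
  qed (auto simp: alg_act_add[symmetric] alg_act_fsmul[symmetric])
  have "alg_act G V a x \<in> range (\<lambda>a. alg_act G V a u)" if x: "x \<in> vs.span {u}" for a x
  proof -
    obtain c where "x = smul c u" using x by (auto simp: vs.span_singleton)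
    then have "alg_act G V a x = alg_act G V (fsmul c a) u"
      using linear_on_smul[OF alg_act_linear[OF assms(1)] assms(2)] by (simp add: alg_act_fsmul)
    then show ?thesis by blast
  qed
  then show "alg_span G V (vs.span {u}) \<subseteq> range (\<lambda>a. alg_act G V a u)"
    unfolding alg_span_def by (intro vs.span_minimal[OF _ sub]) auto
  show "range (\<lambda>a. alg_act G V a u) \<subseteq> alg_span G V (vs.span {u})"
    unfolding alg_span_def by (blast intro: vs.span_base)
qed

section \<open>Gliders and their isomorphisms\<close>

lemma is_gliderI:
  assumes "kg_module G (amb M)" "vs.subspace (low M)" "finite_dim (low M)"
    "vs.subspace (high M)" "finite_dim (high M)" "low M \<subseteq> high M" "high M \<subseteq> vecs (amb M)"
    "\<And>g x. \<lbrakk>g \<in> carrier G; x \<in> low M\<rbrakk> \<Longrightarrow> act (amb M) g x \<in> high M"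
  shows "is_glider G M"
  using assms alg_span_subset_iff[OF assms(4)] by (simp add: is_glider_def)

lemma is_gliderD:
  assumes "is_glider G M"
  shows "kg_module G (amb M)" "vs.subspace (low M)" "finite_dim (low M)"
    "vs.subspace (high M)" "finite_dim (high M)" "low M \<subseteq> high M" "high M \<subseteq> vecs (amb M)"
    "low M \<subseteq> vecs (amb M)"
    and glider_act: "\<lbrakk>g \<in> carrier G; x \<in> low M\<rbrakk> \<Longrightarrow> act (amb M) g x \<in> high M"
  using assms alg_span_subset_iff[of "high M" "amb M" "low M"] by (auto simp: is_glider_def)

lemma glider_homD:
  assumes "glider_hom G M N f"
  shows "linear_on (high M) f" "f ` high M \<subseteq> high N" "f ` low M \<subseteq> low N"
  using assms by (simp_all add: glider_hom_def)

lemma glider_homI: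
  assumes "is_glider G M" "f ` high M \<subseteq> high N" "linear_on (high M) f" "f ` low M \<subseteq> low N"
    "\<And>g m. \<lbrakk>g \<in> carrier G; m \<in> low M\<rbrakk> \<Longrightarrow> f (act (amb M) g m) = act (amb N) g (f m)"
  shows "glider_hom G M N f"
proof -
  note M = is_gliderD[OF assms(1)]
  have "f (alg_act G (amb M) a m) = alg_act G (amb N) a (f m)" if "m \<in> low M" for a m
  proof -
    have "f (alg_act G (amb M) a m) = (\<Sum>g\<in>carrier G. f (smul (a g) (act (amb M) g m)))"
      unfolding alg_act_def
      by (rule linear_on_sum[OF assms(3) M(4)])
         (use that M glider_act[OF assms(1)] in \<open>auto intro: vs.subspace_scale\<close>)
    also have "\<dots> = (\<Sum>g\<in>carrier G. smul (a g) (act (amb N) g (f m)))"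
      by (rule sum.cong)
         (use that glider_act[OF assms(1)] assms(5) in \<open>auto simp: linear_on_smul[OF assms(3)]\<close>)
    finally show ?thesis by (simp add: alg_act_def)
  qed
  then show ?thesis using assms by (simp add: glider_hom_def)
qed

lemma glider_hom_act:
  assumes "glider_hom G M N f" "g \<in> carrier G" "m \<in> low M"
  shows "f (act (amb M) g m) = act (amb N) g (f m)"
  using assms alg_act_unit_fun[OF assms(2)] unfolding glider_hom_def by metis

text \<open>
  The inverse of a bijective morphism that maps \<open>M\<^sub>-\<^sub>1\<close> onto \<open>N\<^sub>-\<^sub>1\<close> is again a morphism.
\<close>

lemma glider_isoI:
  assumes M: "is_glider G M" and N: "is_glider G N"
    and f: "linear_on (high M) f" "bij_betw f (high M) (high N)" "f ` low M = low N"
    and equiv: "\<And>g m. \<lbrakk>g \<in> carrier G; m \<in> low M\<rbrakk> \<Longrightarrow> f (act (amb M) g m) = act (amb N) g (f m)"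
  shows "glider_iso G M N"
proof -
  define h where "h = the_inv_into (high M) f"
  note M' = is_gliderD[OF M] and N' = is_gliderD[OF N]
  have inj: "inj_on f (high M)" and im: "f ` high M = high N" using f(2) by (auto simp: bij_betw_def)
  have hf: "h (f x) = x" if "x \<in> high M" for x
    using that by (simp add: h_def the_inv_into_f_f[OF inj])
  have fh: "f (h y) = y" and h: "h y \<in> high M" if y: "y \<in> high N" for y
  proof -
    obtain x where "x \<in> high M" "y = f x" using y im by blast
    then show "f (h y) = y" "h y \<in> high M" using hf by auto
  qed
  have "linear_on (high N) h"
    unfolding linear_on_def
  proof (intro conjI ballI allI)
    fix x y assume xy: "x \<in> high N" "y \<in> high N"
    then have "f (h x + h y) = x + y" by (simp add: linear_on_add[OF f(1)] h fh)
    then show "h (x + y) = h x + h y" using hf[of "h x + h y"] vs.subspace_add[OF M'(4)] h xy by simp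
  next
    fix c x assume x: "x \<in> high N"
    then have "f (smul c (h x)) = smul c x" by (simp add: linear_on_smul[OF f(1)] h fh)
    then show "h (smul c x) = smul c (h x)"
      using hf[of "smul c (h x)"] vs.subspace_scale[OF M'(4)] h x by simp
  qed
  moreover have hlow: "h ` low N = low M"
  proof -
    have "h ` low N = (\<lambda>x. h (f x)) ` low M" unfolding f(3)[symmetric] image_image ..
    also have "\<dots> = (\<lambda>x. x) ` low M" by (rule image_cong) (use hf M'(6) in auto)
    finally show ?thesis by simp
  qed
  moreover have "h (act (amb N) g m) = act (amb M) g (h m)" if "g \<in> carrier G" "m \<in> low N" for g m
  proof -
    have "h m \<in> low M" using that hlow by blast
    then have "act (amb N) g m = f (act (amb M) g (h m))" "act (amb M) g (h m) \<in> high M"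
      using equiv[of g "h m"] that fh[of m] N'(6) glider_act[OF M] by auto
    then show ?thesis using hf by simp
  qed
  ultimately have "glider_hom G N M h" using h by (intro glider_homI[OF N]) auto
  moreover have "glider_hom G M N f" using assms im by (intro glider_homI[OF M]) auto
  ultimately show ?thesis unfolding glider_iso_def using hf fh by blast
qed

lemma glider_iso_refl: "glider_iso G M M"
  unfolding glider_iso_def
  by (rule exI[of _ "\<lambda>x. x"], rule exI[of _ "\<lambda>x. x"]) (auto simp: glider_hom_def linear_on_def)

lemma glider_iso_sym: "glider_iso G M N \<Longrightarrow> glider_iso G N M"
  unfolding glider_iso_def by metis

lemma glider_hom_comp:
  assumes "glider_hom G M N f" "glider_hom G N L h" shows "glider_hom G M L (\<lambda>x. h (f x))"
  using assms linear_on_comp[of "high M" f "high N" h]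
  by (simp add: glider_hom_def image_subset_iff)

lemma glider_iso_trans:
  assumes "glider_iso G M N" "glider_iso G N L" shows "glider_iso G M L"
proof -
  obtain f f' where f: "glider_hom G M N f" "glider_hom G N M f'"
    "\<And>x. x \<in> high M \<Longrightarrow> f' (f x) = x" "\<And>y. y \<in> high N \<Longrightarrow> f (f' y) = y"
    using assms(1) unfolding glider_iso_def by blast
  obtain h h' where h: "glider_hom G N L h" "glider_hom G L N h'"
    "\<And>x. x \<in> high N \<Longrightarrow> h' (h x) = x" "\<And>y. y \<in> high L \<Longrightarrow> h (h' y) = y"
    using assms(2) unfolding glider_iso_def by blast
  have "f ` high M \<subseteq> high N" "h' ` high L \<subseteq> high N" using f h by (auto simp: glider_hom_def)
  then show ?thesis
    unfolding glider_iso_def using f h glider_hom_comp[OF f(1) h(1)] glider_hom_comp[OF h(2) f(2)]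
    by (intro exI[of _ "\<lambda>x. h (f x)"] exI[of _ "\<lambda>x. f' (h' x)"]) (simp add: image_subset_iff)
qed

lemma glider_class_eq_iff:
  assumes "is_glider G M" "is_glider G N"
  shows "glider_class G M = glider_class G N \<longleftrightarrow> glider_iso G M N"
proof
  assume "glider_class G M = glider_class G N"
  moreover have "N \<in> glider_class G N" using assms by (simp add: glider_class_def glider_iso_refl)
  ultimately show "glider_iso G M N" by (auto simp: glider_class_def)
next
  assume "glider_iso G M N"
  then show "glider_class G M = glider_class G N"
    unfolding glider_class_def using glider_iso_trans glider_iso_sym by blast
qed

end


section \<open>Tensor products\<close>

lemma tensor_vec_apply [simp]: "tensor_vec x y (prod_encode (i, j)) = x i * y j"
  by (simp add: tensor_vec_def)

lemma vec_eq_pairsI: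
  assumes "\<And>i j. x (prod_encode (i, j)) = y (prod_encode (i, j))" shows "x = y"
proof
  fix k
  show "x k = y k" using assms[of "fst (prod_decode k)" "snd (prod_decode k)"] by simp
qed

lemma tensor_vec_linear_left: "linear_on S (\<lambda>x. tensor_vec x y)"
  by (auto simp: linear_on_def vec_apply algebra_simps intro!: vec_eq_pairsI)

lemma tensor_vec_linear_right: "linear_on S (tensor_vec x)"
  by (auto simp: linear_on_def vec_apply algebra_simps intro!: vec_eq_pairsI)

lemma tensor_unit_vec: "tensor_vec (unit_vec i) (unit_vec j) = unit_vec (prod_encode (i, j))"
  by (rule vec_eq_pairsI) (auto simp: unit_vec_def)

lemma tensor_vec_nonzero:
  assumes "x \<noteq> 0" "y \<noteq> 0" shows "tensor_vec x y \<noteq> (0 :: 'k::field vec)"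
proof -
  obtain i j where "x i \<noteq> 0" "y j \<noteq> 0" using assms by (auto simp: fun_eq_iff vec_apply)
  then have "tensor_vec x y (prod_encode (i, j)) \<noteq> 0" by simp
  then show ?thesis by (metis zero_fun_apply)
qed

lemma tensor_vec_in_fsv:
  assumes "x \<in> fsv I" "y \<in> fsv J" shows "tensor_vec x y \<in> fsv (prod_encode ` (I \<times> J))"
proof -
  have "{k. tensor_vec x y k \<noteq> 0} \<subseteq> prod_encode ` ({i. x i \<noteq> 0} \<times> {j. y j \<noteq> 0})"
  proof
    fix k assume "k \<in> {k. tensor_vec x y k \<noteq> 0}"
    moreover obtain i j where "k = prod_encode (i, j)" by (metis prod_decode_inverse surj_pair)
    ultimately show "k \<in> prod_encode ` ({i. x i \<noteq> 0} \<times> {j. y j \<noteq> 0})" by auto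
  qed
  moreover have "prod_encode ` ({i. x i \<noteq> 0} \<times> {j. y j \<noteq> 0}) \<subseteq> prod_encode ` (I \<times> J)"
    using assms by (auto simp: fsv_def)
  ultimately show ?thesis
    using assms finite_subset[of "{k. tensor_vec x y k \<noteq> 0}"] by (auto simp: fsv_def)
qed

definition tspan :: "'k::field vec set \<Rightarrow> 'k vec set \<Rightarrow> 'k vec set" where
  "tspan S T = vs.span {tensor_vec x y | x y. x \<in> S \<and> y \<in> T}"

lemma subspace_tspan [simp]: "vs.subspace (tspan S T)"
  by (simp add: tspan_def)

lemma tspan_base: "\<lbrakk>x \<in> S; y \<in> T\<rbrakk> \<Longrightarrow> tensor_vec x y \<in> tspan S T"
  unfolding tspan_def by (rule vs.span_base) blast

lemma tspan_minimal:
  "\<lbrakk>vs.subspace R; \<And>x y. \<lbrakk>x \<in> S; y \<in> T\<rbrakk> \<Longrightarrow> tensor_vec x y \<in> R\<rbrakk> \<Longrightarrow> tspan S T \<subseteq> R"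
  unfolding tspan_def by (rule vs.span_minimal) auto

lemma tspan_mono: "\<lbrakk>S \<subseteq> S'; T \<subseteq> T'\<rbrakk> \<Longrightarrow> tspan S T \<subseteq> tspan S' T'"
  by (rule tspan_minimal) (auto intro: tspan_base)

lemma tspan_span: "tspan (vs.span S) (vs.span T) = tspan S T"
proof
  have 1: "tensor_vec x y \<in> tspan S T" if "x \<in> S" "y \<in> vs.span T" for x y
    by (rule linear_on_span_closed[OF tensor_vec_linear_right vs.subspace_UNIV _ _ _ that(2)])
       (use that tspan_base in auto)
  have "tensor_vec x y \<in> tspan S T" if "x \<in> vs.span S" "y \<in> vs.span T" for x y
    by (rule linear_on_span_closed[OF tensor_vec_linear_left vs.subspace_UNIV _ _ _ that(1)])
       (use that 1 in auto)
  then show "tspan (vs.span S) (vs.span T) \<subseteq> tspan S T" by (intro tspan_minimal) auto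
  show "tspan S T \<subseteq> tspan (vs.span S) (vs.span T)"
    by (intro tspan_mono) (auto simp: vs.span_superset)
qed

lemma tspan_singleton: "tspan (vs.span {u}) (vs.span {v}) = vs.span {tensor_vec u v}"
  unfolding tspan_span by (simp add: tspan_def)

lemma finite_dim_tspan: assumes "finite_dim S" "finite_dim T" shows "finite_dim (tspan S T)"
proof -
  obtain A B where "finite A" "vs.span A = S" "finite B" "vs.span B = T"
    using assms unfolding finite_dim_def by blast
  then have "tspan S T = vs.span ((\<lambda>(x, y). tensor_vec x y) ` (A \<times> B))"
    using tspan_span[of A B] by (auto simp: tspan_def intro!: arg_cong[of _ _ vs.span])
  moreover have "finite ((\<lambda>(x, y). tensor_vec x y) ` (A \<times> B))"
    using \<open>finite A\<close> \<open>finite B\<close> by blast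
  ultimately show ?thesis unfolding finite_dim_def by metis
qed

lemma linear_on_tspan_eq:
  assumes "linear_on (tspan S T) f" "linear_on (tspan S T) h"
    "\<And>x y. \<lbrakk>x \<in> S; y \<in> T\<rbrakk> \<Longrightarrow> f (tensor_vec x y) = h (tensor_vec x y)" "t \<in> tspan S T"
  shows "f t = h t"
  by (rule linear_on_span_eq[OF assms(1,2) subspace_tspan _ _ assms(4)[unfolded tspan_def]])
     (use assms(3) tspan_base in auto)

lemma linear_on_tspan_closed:
  assumes "linear_on (tspan S T) f" "vs.subspace R"
    "\<And>x y. \<lbrakk>x \<in> S; y \<in> T\<rbrakk> \<Longrightarrow> f (tensor_vec x y) \<in> R" "t \<in> tspan S T"
  shows "f t \<in> R"
  by (rule linear_on_span_closed[OF assms(1) subspace_tspan _ assms(2) _ assms(4)[unfolded tspan_def]])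
     (use assms(3) tspan_base in auto)

lemma tspan_fsv: "tspan (fsv I) (fsv J) = (fsv (prod_encode ` (I \<times> J)) :: 'k::field vec set)"
proof
  show "tspan (fsv I) (fsv J) \<subseteq> (fsv (prod_encode ` (I \<times> J)) :: 'k vec set)"
    by (rule tspan_minimal) (auto intro: tensor_vec_in_fsv)
  have "unit_vec ` prod_encode ` (I \<times> J) \<subseteq> (tspan (fsv I) (fsv J) :: 'k vec set)"
    by (auto simp: tensor_unit_vec[symmetric] intro!: tspan_base unit_vec_in_fsv)
  then show "(fsv (prod_encode ` (I \<times> J)) :: 'k vec set) \<subseteq> tspan (fsv I) (fsv J)"
    unfolding fsv_span[of "prod_encode ` _"] by (intro vs.span_minimal) auto
qed

lemma vecs_tensor_mod: "vecs (tensor_mod V W) = tspan (vecs V) (vecs W)"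
  by (simp add: vecs_fsv tspan_fsv tensor_mod_def)

definition basis_extension :: "(nat \<Rightarrow> 'k::field vec) \<Rightarrow> 'k vec \<Rightarrow> 'k vec" where
  "basis_extension b x = (\<Sum>k | x k \<noteq> 0. smul (x k) (b k))"

lemma basis_extension_superset:
  "\<lbrakk>finite J; {k. x k \<noteq> 0} \<subseteq> J\<rbrakk> \<Longrightarrow> basis_extension b x = (\<Sum>k\<in>J. smul (x k) (b k))"
  unfolding basis_extension_def by (rule sum.mono_neutral_left) auto

lemma basis_extension_unit_vec: "basis_extension b (unit_vec k) = (b k :: 'k::field vec)"
  using basis_extension_superset[of "{k}" "unit_vec k :: 'k vec" b] by (auto simp: unit_vec_def)

lemma basis_extension_linear: "linear_on (fsv I) (basis_extension (b :: nat \<Rightarrow> 'k::field vec))"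
  unfolding linear_on_def
proof (intro conjI ballI allI)
  fix x y :: "'k vec" assume "x \<in> fsv I" "y \<in> fsv I"
  let ?J = "{k. x k \<noteq> 0} \<union> {k. y k \<noteq> 0}"
  have J: "finite ?J" using \<open>x \<in> fsv I\<close> \<open>y \<in> fsv I\<close> by (simp add: fsv_def)
  have sub: "{k. (x + y) k \<noteq> 0} \<subseteq> ?J" "{k. x k \<noteq> 0} \<subseteq> ?J" "{k. y k \<noteq> 0} \<subseteq> ?J"
    by (auto simp: vec_apply)
  show "basis_extension b (x + y) = basis_extension b x + basis_extension b y"
    unfolding basis_extension_superset[OF J sub(1)] basis_extension_superset[OF J sub(2)]
      basis_extension_superset[OF J sub(3)]
    by (simp add: plus_fun_apply vs.scale_left_distrib sum.distrib)
next
  fix c and x :: "'k vec" assume "x \<in> fsv I"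
  then have J: "finite {k. x k \<noteq> 0}" by (simp add: fsv_def)
  have sub: "{k. smul c x k \<noteq> 0} \<subseteq> {k. x k \<noteq> 0}" by (auto simp: vec_apply)
  show "basis_extension b (smul c x) = smul c (basis_extension b x)"
    unfolding basis_extension_superset[OF J sub] basis_extension_superset[OF J order_refl]
    by (simp only: smul_apply vs.scale_sum_right vs.scale_scale)
qed

text \<open>
  The map \<open>F \<otimes> H\<close>. The action on a tensor product and the tensor product of two morphisms are both
  of this form.
\<close>

definition tensor_map :: "('k::field vec \<Rightarrow> 'k vec) \<Rightarrow> ('k vec \<Rightarrow> 'k vec) \<Rightarrow> 'k vec \<Rightarrow> 'k vec" where
  "tensor_map F H = basis_extension
     (\<lambda>k. case prod_decode k of (i, j) \<Rightarrow> tensor_vec (F (unit_vec i)) (H (unit_vec j)))"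

lemma tensor_map_linear: "linear_on (fsv I) (tensor_map F H)"
  unfolding tensor_map_def by (rule basis_extension_linear)

lemma tensor_map_linear_tspan:
  assumes "S \<subseteq> vecs V" "T \<subseteq> vecs W" shows "linear_on (tspan S T) (tensor_map F H)"
  using linear_on_subset[OF tensor_map_linear tspan_mono[OF assms, unfolded vecs_fsv tspan_fsv]] .

text \<open>
  The definition of \<open>F \<otimes> H\<close> refers to basis vectors. Both sides are bilinear, so agreement there
  suffices.
\<close>

lemma tensor_map_tensor_vec:
  fixes x y :: "'k::field vec"
  assumes F: "linear_on (fsv I) F" and H: "linear_on (fsv J) H" and x: "x \<in> fsv I" and y: "y \<in> fsv J"
  shows "tensor_map F H (tensor_vec x y) = tensor_vec (F x) (H y)"
proof -
  have lin: "linear_on (fsv (prod_encode ` (I \<times> J))) (tensor_map F H)" by (rule tensor_map_linear)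
  have unit: "tensor_map F H (tensor_vec (unit_vec i) (unit_vec j))
    = tensor_vec (F (unit_vec i)) (H (unit_vec j))" for i j
    by (simp add: tensor_unit_vec tensor_map_def basis_extension_unit_vec)
  have 1: "tensor_map F H (tensor_vec x (unit_vec j)) = tensor_vec (F x) (H (unit_vec j))"
    if j: "j \<in> J" for j
  proof (rule linear_on_span_eq[where S = "fsv I" and B = "unit_vec ` I" and x = x
        and f = "\<lambda>x. tensor_map F H (tensor_vec x (unit_vec j))"
        and g = "\<lambda>x. tensor_vec (F x) (H (unit_vec j))"])
    show "linear_on (fsv I) (\<lambda>x. tensor_map F H (tensor_vec x (unit_vec j)))"
      by (rule linear_on_comp[OF tensor_vec_linear_left _ lin])
         (use tensor_vec_in_fsv unit_vec_in_fsv j in blast)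
    show "linear_on (fsv I) (\<lambda>x. tensor_vec (F x) (H (unit_vec j)))"
      by (rule linear_on_comp[OF F order_refl tensor_vec_linear_left])
  qed (use unit x in \<open>auto simp: fsv_span[symmetric] unit_vec_in_fsv\<close>)
  show ?thesis
  proof (rule linear_on_span_eq[where S = "fsv J" and B = "unit_vec ` J" and x = y
        and f = "\<lambda>y. tensor_map F H (tensor_vec x y)" and g = "\<lambda>y. tensor_vec (F x) (H y)"])
    show "linear_on (fsv J) (\<lambda>y. tensor_map F H (tensor_vec x y))"
      by (rule linear_on_comp[OF tensor_vec_linear_right _ lin]) (use tensor_vec_in_fsv x in blast)
    show "linear_on (fsv J) (\<lambda>y. tensor_vec (F x) (H y))"
      by (rule linear_on_comp[OF H order_refl tensor_vec_linear_right])
  qed (use 1 y in \<open>auto simp: fsv_span[symmetric] unit_vec_in_fsv\<close>)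
qed

lemma act_tensor_mod: "act (tensor_mod V W) g = tensor_map (act V g) (act W g)"
  by (simp add: tensor_mod_def tensor_map_def basis_extension_def fun_eq_iff)

lemma act_tensor_vec:
  assumes "kg_module G V" "kg_module G W" "g \<in> carrier G" "x \<in> vecs V" "y \<in> vecs W"
  shows "act (tensor_mod V W) g (tensor_vec x y) = tensor_vec (act V g x) (act W g y)"
  unfolding act_tensor_mod
  using tensor_map_tensor_vec act_linear[OF assms(1,3)] act_linear[OF assms(2,3)] assms(4,5)
  unfolding vecs_fsv by blast

lemma kg_module_tensor_mod:
  fixes G (structure)
  assumes "group G" and V: "kg_module G V" and W: "kg_module G W"
  shows "kg_module G (tensor_mod V W)"
proof -
  interpret group G by fact
  let ?T = "tensor_mod V W"
  have lin: "linear_on (tspan (vecs V) (vecs W)) (act ?T g)" for g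
    unfolding act_tensor_mod by (rule tensor_map_linear_tspan) (rule order_refl)+
  note tensor = act_tensor_vec[OF V W]
  have closed: "act ?T g t \<in> tspan (vecs V) (vecs W)"
    if "g \<in> carrier G" "t \<in> tspan (vecs V) (vecs W)" for g t
    by (rule linear_on_tspan_closed[OF lin subspace_tspan _ that(2)])
       (simp add: tensor that tspan_base act_closed[OF V] act_closed[OF W])
  have one: "act ?T \<one> t = t" if "t \<in> tspan (vecs V) (vecs W)" for t
    by (rule linear_on_tspan_eq[where h = "\<lambda>t. t", OF lin _ _ that])
       (simp_all add: tensor act_one[OF V] act_one[OF W] linear_on_def)
  have mult: "act ?T (g \<otimes> h) t = act ?T g (act ?T h t)"
    if "g \<in> carrier G" "h \<in> carrier G" "t \<in> tspan (vecs V) (vecs W)" for g h t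
  proof (rule linear_on_tspan_eq[where h = "\<lambda>t. act ?T g (act ?T h t)", OF lin _ _ that(3)])
    show "linear_on (tspan (vecs V) (vecs W)) (\<lambda>t. act ?T g (act ?T h t))"
      by (rule linear_on_comp[OF lin _ lin]) (use closed that in auto)
  qed (simp add: tensor that act_mult[OF V] act_mult[OF W] act_closed[OF V] act_closed[OF W])
  show ?thesis unfolding kg_module_def vecs_tensor_mod using lin closed one mult by auto
qed

lemma glider_tensor_simps [simp]:
  "amb (glider_tensor M N) = tensor_mod (amb M) (amb N)"
  "low (glider_tensor M N) = tspan (low M) (low N)"
  "high (glider_tensor M N) = tspan (high M) (high N)"
  by (simp_all add: glider_tensor_def tspan_def)

context finite_group
begin

lemma is_glider_tensor:
  assumes M: "is_glider G M" and N: "is_glider G N"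
  shows "is_glider G (glider_tensor M N)"
proof (rule is_gliderI)
  note M' = is_gliderD[OF M] and N' = is_gliderD[OF N]
  show "kg_module G (amb (glider_tensor M N))"
    using M' N' by (simp add: kg_module_tensor_mod is_group)
  fix g t assume g: "g \<in> carrier G" and t: "t \<in> low (glider_tensor M N)"
  have lin: "linear_on (tspan (low M) (low N)) (act (tensor_mod (amb M) (amb N)) g)"
    unfolding act_tensor_mod
    by (rule tensor_map_linear_tspan[OF M'(8) N'(8)])
  have "act (tensor_mod (amb M) (amb N)) g t \<in> tspan (high M) (high N)"
  proof (rule linear_on_tspan_closed[OF lin subspace_tspan])
    fix x y assume xy: "x \<in> low M" "y \<in> low N"
    then have "act (tensor_mod (amb M) (amb N)) g (tensor_vec x y)
        = tensor_vec (act (amb M) g x) (act (amb N) g y)"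
      using M'(8) N'(8) by (intro act_tensor_vec[OF M'(1) N'(1) g]) auto
    then show "act (tensor_mod (amb M) (amb N)) g (tensor_vec x y) \<in> tspan (high M) (high N)"
      using glider_act[OF M g xy(1)] glider_act[OF N g xy(2)] by (simp add: tspan_base)
  qed (use t in simp)
  then show "act (amb (glider_tensor M N)) g t \<in> high (glider_tensor M N)" by simp
qed (use is_gliderD[OF M] is_gliderD[OF N] in
     \<open>simp_all add: finite_dim_tspan vecs_tensor_mod tspan_mono\<close>)

text \<open>
  A morphism is only defined on \<open>M\<^sub>0\<close>, which need not contain any basis vectors of the ambient space.
  It is extended to a linear map on the whole space before the tensor product is formed.
\<close>

lemma glider_hom_tensor:
  assumes M: "is_glider G M" and N: "is_glider G N" and M': "is_glider G M'" and N': "is_glider G N'"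
    and f: "glider_hom G M M' f" and h: "glider_hom G N N' h"
  obtains k where "glider_hom G (glider_tensor M N) (glider_tensor M' N') k"
    "\<And>x y. \<lbrakk>x \<in> high M; y \<in> high N\<rbrakk> \<Longrightarrow> k (tensor_vec x y) = tensor_vec (f x) (h y)"
proof -
  note MD = is_gliderD[OF M] and ND = is_gliderD[OF N]
  note M'D = is_gliderD[OF M'] and N'D = is_gliderD[OF N']
  obtain F where F: "linear_on UNIV F" "\<And>x. x \<in> high M \<Longrightarrow> F x = f x"
    using linear_on_extend[of "high M" f] f MD(4) by (auto simp: glider_hom_def)
  obtain H where H: "linear_on UNIV H" "\<And>y. y \<in> high N \<Longrightarrow> H y = h y"
    using linear_on_extend[of "high N" h] h ND(4) by (auto simp: glider_hom_def)
  define k where "k = tensor_map F H"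
  have fsv: "high M \<subseteq> fsv UNIV" "high N \<subseteq> fsv UNIV"
    using MD(7) ND(7) by (auto simp: vecs_def fsv_def)
  have k: "k (tensor_vec x y) = tensor_vec (f x) (h y)" if "x \<in> high M" "y \<in> high N" for x y
    using tensor_map_tensor_vec[OF linear_on_subset[OF F(1)] linear_on_subset[OF H(1)], of UNIV UNIV x y]
      that fsv F(2) H(2) by (auto simp: k_def)
  have lin: "linear_on (tspan (high M) (high N)) k"
    unfolding k_def by (rule tensor_map_linear_tspan[OF MD(7) ND(7)])
  have low_high: "tspan (low M) (low N) \<subseteq> tspan (high M) (high N)"
    using MD(6) ND(6) by (rule tspan_mono)
  have low_lin: "linear_on (tspan (low M) (low N)) k"
    using linear_on_subset[OF lin low_high] .
  have fh: "f x \<in> high M'" if "x \<in> high M" for x using f that by (auto simp: glider_hom_def)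
  have hh: "h x \<in> high N'" if "x \<in> high N" for x using h that by (auto simp: glider_hom_def)
  have fl: "f x \<in> low M'" if "x \<in> low M" for x using f that by (auto simp: glider_hom_def)
  have hl: "h x \<in> low N'" if "x \<in> low N" for x using h that by (auto simp: glider_hom_def)
  have khigh: "k t \<in> tspan (high M') (high N')" if "t \<in> tspan (high M) (high N)" for t
    by (rule linear_on_tspan_closed[OF lin subspace_tspan _ that]) (simp add: k fh hh tspan_base)
  have klow: "k t \<in> tspan (low M') (low N')" if "t \<in> tspan (low M) (low N)" for t
    by (rule linear_on_tspan_closed[OF low_lin subspace_tspan _ that])
       (use MD(6) ND(6) in \<open>auto simp: k fl hl tspan_base subset_iff\<close>)
  let ?V = "tensor_mod (amb M) (amb N)" and ?V' = "tensor_mod (amb M') (amb N')"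
  have equiv: "k (act ?V g t) = act ?V' g (k t)" if g: "g \<in> carrier G" and t: "t \<in> tspan (low M) (low N)" for g t
  proof (rule linear_on_tspan_eq[where f = "\<lambda>t. k (act ?V g t)" and h = "\<lambda>t. act ?V' g (k t)", OF _ _ _ t])
    have "linear_on (tspan (low M) (low N)) (act ?V g)"
      unfolding act_tensor_mod
      by (rule tensor_map_linear_tspan[OF MD(8) ND(8)])
    then show "linear_on (tspan (low M) (low N)) (\<lambda>t. k (act ?V g t))"
      using glider_act[OF is_glider_tensor[OF M N] g] by (intro linear_on_comp[OF _ _ lin]) auto
    have "linear_on (tspan (low M') (low N')) (act ?V' g)"
      unfolding act_tensor_mod
      by (rule tensor_map_linear_tspan[OF M'D(8) N'D(8)])
    then show "linear_on (tspan (low M) (low N)) (\<lambda>t. act ?V' g (k t))"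
      using klow by (intro linear_on_comp[OF low_lin]) auto
  next
    fix x y assume xy: "x \<in> low M" "y \<in> low N"
    have "act ?V g (tensor_vec x y) = tensor_vec (act (amb M) g x) (act (amb N) g y)"
      using act_tensor_vec[OF MD(1) ND(1) g] xy MD(8) ND(8) by blast
    then have "k (act ?V g (tensor_vec x y)) = tensor_vec (f (act (amb M) g x)) (h (act (amb N) g y))"
      using k glider_act[OF M g xy(1)] glider_act[OF N g xy(2)] by simp
    also have "\<dots> = tensor_vec (act (amb M') g (f x)) (act (amb N') g (h y))"
      using glider_hom_act[OF f g xy(1)] glider_hom_act[OF h g xy(2)] by simp
    also have "\<dots> = act ?V' g (tensor_vec (f x) (h y))"
      using fl[OF xy(1)] hl[OF xy(2)] M'D(8) N'D(8)
      by (intro act_tensor_vec[OF M'D(1) N'D(1) g, symmetric]) auto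
    also have "tensor_vec (f x) (h y) = k (tensor_vec x y)" using xy MD(6) ND(6) by (intro k[symmetric]) auto
    finally show "k (act ?V g (tensor_vec x y)) = act ?V' g (k (tensor_vec x y))" .
  qed
  have "glider_hom G (glider_tensor M N) (glider_tensor M' N') k"
  proof (rule glider_homI[OF is_glider_tensor[OF M N]], unfold glider_tensor_simps)
    show "k (act ?V g t) = act ?V' g (k t)" if "g \<in> carrier G" "t \<in> tspan (low M) (low N)" for g t
      using that by (rule equiv)
    show "linear_on (tspan (high M) (high N)) k" by (rule lin)
    show "k ` tspan (high M) (high N) \<subseteq> tspan (high M') (high N')"
      by (rule image_subsetI) (rule khigh)
    show "k ` tspan (low M) (low N) \<subseteq> tspan (low M') (low N')"
      by (rule image_subsetI) (rule klow)
  qed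
  then show ?thesis using k by (rule that)
qed

lemma glider_iso_tensor:
  assumes M: "is_glider G M" "is_glider G M'" and N: "is_glider G N" "is_glider G N'"
    and iso: "glider_iso G M M'" "glider_iso G N N'"
  shows "glider_iso G (glider_tensor M N) (glider_tensor M' N')"
proof -
  have inverse: "k' (k t) = t"
    if k: "glider_hom G (glider_tensor M N) (glider_tensor M' N') k"
        "\<And>x y. \<lbrakk>x \<in> high M; y \<in> high N\<rbrakk> \<Longrightarrow> k (tensor_vec x y) = tensor_vec (f x) (h y)"
      and k': "glider_hom G (glider_tensor M' N') (glider_tensor M N) k'"
        "\<And>x y. \<lbrakk>x \<in> high M'; y \<in> high N'\<rbrakk> \<Longrightarrow> k' (tensor_vec x y) = tensor_vec (f' x) (h' y)"
      and f: "f ` high M \<subseteq> high M'" "\<And>x. x \<in> high M \<Longrightarrow> f' (f x) = x"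
      and h: "h ` high N \<subseteq> high N'" "\<And>x. x \<in> high N \<Longrightarrow> h' (h x) = x"
      and t: "t \<in> tspan (high M) (high N)"
    for k k' f f' h h' t and M M' N N' :: "('a, 'c::field) glider"
  proof (rule linear_on_tspan_eq[where f = "\<lambda>t. k' (k t)" and h = "\<lambda>t. t", OF _ _ _ t])
    show "linear_on (tspan (high M) (high N)) (\<lambda>t. k' (k t))"
      using glider_homD(1,2)[OF k(1)] glider_homD(1)[OF k'(1)]
      unfolding glider_tensor_simps by (rule linear_on_comp)
    show "linear_on (tspan (high M) (high N)) (\<lambda>t. t)" by (simp add: linear_on_def)
    show "k' (k (tensor_vec x y)) = tensor_vec x y" if "x \<in> high M" "y \<in> high N" for x y
      using that f h k(2) k'(2) by (simp add: image_subset_iff)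
  qed
  obtain f f' where f: "glider_hom G M M' f" "glider_hom G M' M f'"
    "\<And>x. x \<in> high M \<Longrightarrow> f' (f x) = x" "\<And>y. y \<in> high M' \<Longrightarrow> f (f' y) = y"
    using iso(1) unfolding glider_iso_def by blast
  obtain h h' where h: "glider_hom G N N' h" "glider_hom G N' N h'"
    "\<And>x. x \<in> high N \<Longrightarrow> h' (h x) = x" "\<And>y. y \<in> high N' \<Longrightarrow> h (h' y) = y"
    using iso(2) unfolding glider_iso_def by blast
  have im: "f ` high M \<subseteq> high M'" "h ` high N \<subseteq> high N'" "f' ` high M' \<subseteq> high M" "h' ` high N' \<subseteq> high N"
    using f(1,2) h(1,2) by (auto dest: glider_homD)
  obtain k where k: "glider_hom G (glider_tensor M N) (glider_tensor M' N') k"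
    "\<And>x y. \<lbrakk>x \<in> high M; y \<in> high N\<rbrakk> \<Longrightarrow> k (tensor_vec x y) = tensor_vec (f x) (h y)"
    by (rule glider_hom_tensor[OF M(1) N(1) M(2) N(2) f(1) h(1)]) (rule that)
  obtain k' where k': "glider_hom G (glider_tensor M' N') (glider_tensor M N) k'"
    "\<And>x y. \<lbrakk>x \<in> high M'; y \<in> high N'\<rbrakk> \<Longrightarrow> k' (tensor_vec x y) = tensor_vec (f' x) (h' y)"
    by (rule glider_hom_tensor[OF M(2) N(2) M(1) N(1) f(2) h(2)]) (rule that)
  show ?thesis
    unfolding glider_iso_def
  proof (rule exI[of _ k], rule exI[of _ k'], intro conjI ballI)
    show "k' (k t) = t" if "t \<in> high (glider_tensor M N)" for t
      by (rule inverse[OF k k' im(1) f(3) im(2) h(3)]) (use that in auto)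
    show "k (k' t) = t" if "t \<in> high (glider_tensor M' N')" for t
      by (rule inverse[OF k' k im(3) f(4) im(4) h(4)]) (use that in auto)
  qed (rule k(1), rule k'(1))
qed

end


section \<open>Direct sums\<close>

lemma component_add: "component s (x + y) = component s x + component s y"
  by (auto simp: component_def vec_apply fun_eq_iff)

lemma component_smul: "component s (smul c x) = smul c (component s x)"
  by (auto simp: component_def vec_apply fun_eq_iff)

lemma component_zero [simp]: "component s 0 = 0"
  by (auto simp: component_def vec_apply fun_eq_iff)

lemma vec_eq_componentsI:
  assumes "\<And>s. component s x = component s y" shows "x = y"
  by (rule vec_eq_pairsI) (use assms in \<open>simp add: component_def fun_eq_iff\<close>)

lemma component_dsum_vec: "component s (dsum_vec xs) = (if s < length xs then xs ! s else 0)"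
  by (auto simp: component_def dsum_vec_def fun_eq_iff vec_apply)

lemma in_vecs_dsum:
  "x \<in> vecs (dsum_mod Vs) \<longleftrightarrow>
     (\<forall>s<length Vs. component s x \<in> vecs (Vs ! s)) \<and> (\<forall>s\<ge>length Vs. component s x = 0)" (is "?L = ?R")
proof
  assume L: ?L
  then have fin: "finite {k. x k \<noteq> 0}"
    and sub: "\<And>k. x k \<noteq> 0 \<Longrightarrow> \<exists>s i. k = prod_encode (s, i) \<and> s < length Vs \<and> i \<in> index (Vs ! s)"
    by (auto simp: vecs_def dsum_mod_def)
  have "finite {i. component s x i \<noteq> 0}" for s
  proof (rule finite_imageD)
    show "finite ((\<lambda>i. prod_encode (s, i)) ` {i. component s x i \<noteq> 0})"
      by (rule finite_subset[OF _ fin]) (auto simp: component_def)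
  qed (auto simp: inj_on_def)
  moreover have "s < length Vs \<and> i \<in> index (Vs ! s)" if "component s x i \<noteq> 0" for s i
    using sub[of "prod_encode (s, i)"] that by (auto simp: component_def)
  ultimately have fin: "\<And>s. finite {i. component s x i \<noteq> 0}"
    and ind: "\<And>s i. component s x i \<noteq> 0 \<Longrightarrow> s < length Vs \<and> i \<in> index (Vs ! s)"
    by blast+
  have "component s x = 0" if "s \<ge> length Vs" for s
  proof
    show "component s x i = 0 i" for i using ind[of s i] that by (auto simp: zero_fun_apply)
  qed
  then show ?R using fin ind by (auto simp: vecs_def)
next
  assume R: ?R
  have supp: "{k. x k \<noteq> 0} \<subseteq> prod_encode ` (SIGMA s:{..<length Vs}. {i. component s x i \<noteq> 0})"
  proof
    fix k assume "k \<in> {k. x k \<noteq> 0}"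
    moreover obtain s i where k: "k = prod_encode (s, i)" by (metis prod_decode_inverse surj_pair)
    ultimately have "component s x i \<noteq> 0" by (simp add: component_def)
    moreover from this have "s < length Vs" using R by (metis not_less zero_fun_apply)
    ultimately show "k \<in> prod_encode ` (SIGMA s:{..<length Vs}. {i. component s x i \<noteq> 0})"
      using k by blast
  qed
  have "finite (prod_encode ` (SIGMA s:{..<length Vs}. {i. component s x i \<noteq> 0}))"
    using R by (intro finite_imageI finite_SigmaI) (simp_all add: vecs_def)
  then have fin: "finite {k. x k \<noteq> 0}" using supp by (rule finite_subset[rotated])
  have "i \<in> index (Vs ! s)" if "s < length Vs" "component s x i \<noteq> 0" for s i
    using R that by (simp add: vecs_def subset_iff)
  then have "prod_encode ` (SIGMA s:{..<length Vs}. {i. component s x i \<noteq> 0}) \<subseteq> index (dsum_mod Vs)"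
    unfolding dsum_mod_def kgmod.simps by blast
  with supp have "{k. x k \<noteq> 0} \<subseteq> index (dsum_mod Vs)" by (rule subset_trans)
  then show ?L using fin by (simp add: vecs_def)
qed

lemma component_act_dsum:
  "component s (act (dsum_mod Vs) g x) = (if s < length Vs then act (Vs ! s) g (component s x) else 0)"
  by (simp add: dsum_mod_def component_dsum_vec)

lemma kg_module_dsum:
  fixes G (structure)
  assumes Vs: "\<And>V. V \<in> set Vs \<Longrightarrow> kg_module G V" shows "kg_module G (dsum_mod Vs)"
proof -
  have V: "kg_module G (Vs ! s)" if "s < length Vs" for s using Vs that by simp
  show ?thesis
    unfolding kg_module_def
  proof (intro conjI ballI)
    fix g assume g: "g \<in> carrier G"
    show "act (dsum_mod Vs) g ` vecs (dsum_mod Vs) \<subseteq> vecs (dsum_mod Vs)"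
    proof (rule image_subsetI)
      fix x assume "x \<in> vecs (dsum_mod Vs)"
      then show "act (dsum_mod Vs) g x \<in> vecs (dsum_mod Vs)"
        unfolding in_vecs_dsum component_act_dsum by (simp add: act_closed[OF V g])
    qed
    show "linear_on (vecs (dsum_mod Vs)) (act (dsum_mod Vs) g)"
      unfolding linear_on_def
    proof (intro conjI ballI allI)
      fix x y assume "x \<in> vecs (dsum_mod Vs)" "y \<in> vecs (dsum_mod Vs)"
      then show "act (dsum_mod Vs) g (x + y) = act (dsum_mod Vs) g x + act (dsum_mod Vs) g y"
        by - (rule vec_eq_componentsI, simp add: in_vecs_dsum component_act_dsum component_add linear_on_add[OF act_linear[OF V g]])
    next
      fix c x assume "x \<in> vecs (dsum_mod Vs)"
      then show "act (dsum_mod Vs) g (smul c x) = smul c (act (dsum_mod Vs) g x)"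
        by - (rule vec_eq_componentsI, simp add: in_vecs_dsum component_act_dsum component_smul linear_on_smul[OF act_linear[OF V g]])
    qed
    fix h x assume "h \<in> carrier G" "x \<in> vecs (dsum_mod Vs)"
    then show "act (dsum_mod Vs) (g \<otimes> h) x = act (dsum_mod Vs) g (act (dsum_mod Vs) h x)"
      by - (rule vec_eq_componentsI, simp add: in_vecs_dsum component_act_dsum act_mult[OF V g])
  next
    fix x assume "x \<in> vecs (dsum_mod Vs)"
    then show "act (dsum_mod Vs) \<one> x = x"
      by - (rule vec_eq_componentsI, simp add: in_vecs_dsum component_act_dsum act_one[OF V])
  qed
qed

definition inject :: "nat \<Rightarrow> 'k::field vec \<Rightarrow> 'k vec" where
  "inject s x = (\<lambda>k. case prod_decode k of (t, i) \<Rightarrow> if t = s then x i else 0)"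

lemma component_inject: "component t (inject s x) = (if t = s then x else 0)"
  by (auto simp: component_def inject_def fun_eq_iff vec_apply)

lemma inject_linear: "linear_on S (inject s)"
  unfolding linear_on_def
  by (intro conjI ballI allI; rule vec_eq_componentsI)
     (simp_all add: component_inject component_add component_smul)

lemma component_sum: "component s (\<Sum>a\<in>A. f a) = (\<Sum>a\<in>A. component s (f a))"
  by (auto simp: component_def vec_apply fun_eq_iff)

lemma finite_dim_vecs_dsum:
  assumes "\<And>V. V \<in> set Vs \<Longrightarrow> finite_dim (vecs V)" shows "finite_dim (vecs (dsum_mod Vs))"
proof -
  have "\<forall>s<length Vs. \<exists>B. finite B \<and> vs.span B = vecs (Vs ! s)"
    using assms unfolding finite_dim_def by simp
  then obtain B where B: "\<And>s. s < length Vs \<Longrightarrow> finite (B s) \<and> vs.span (B s) = vecs (Vs ! s)"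
    by metis
  let ?B = "\<Union>s<length Vs. inject s ` B s"
  have inj: "inject s x \<in> vecs (dsum_mod Vs)" if "s < length Vs" "x \<in> vecs (Vs ! s)" for s x
    using that by (simp add: in_vecs_dsum component_inject vs.subspace_0[OF subspace_vecs])
  have "vs.span ?B = vecs (dsum_mod Vs)"
  proof
    show "vs.span ?B \<subseteq> vecs (dsum_mod Vs)"
      using B inj by (intro vs.span_minimal) (auto intro: vs.span_base)
    show "vecs (dsum_mod Vs) \<subseteq> vs.span ?B"
    proof
      fix x assume x: "x \<in> vecs (dsum_mod Vs)"
      have sum: "x = (\<Sum>s<length Vs. inject s (component s x))"
        using x by - (rule vec_eq_componentsI, simp add: component_sum component_inject in_vecs_dsum)
      have "inject s (component s x) \<in> vs.span ?B" if "s < length Vs" for s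
      proof (rule linear_on_span_closed[OF inject_linear vs.subspace_UNIV])
        show "component s x \<in> vs.span (B s)" using x that B by (simp add: in_vecs_dsum)
        show "inject s y \<in> vs.span ?B" if "y \<in> B s" for y
          using that \<open>s < length Vs\<close> by (intro vs.span_base) blast
      qed auto
      then have "(\<Sum>s<length Vs. inject s (component s x)) \<in> vs.span ?B"
        by (intro vs.span_sum) simp
      then show "x \<in> vs.span ?B" by (subst sum)
    qed
  qed
  moreover have "finite ?B" using B by blast
  ultimately show ?thesis unfolding finite_dim_def by blast
qed

definition dpair :: "'k::field vec set \<Rightarrow> 'k vec set \<Rightarrow> 'k vec set" where
  "dpair S T = {dsum_vec [x, y] | x y. x \<in> S \<and> y \<in> T}"

lemma component_dsum_vec2 [simp]:
  "component 0 (dsum_vec [x, y]) = x" "component (Suc 0) (dsum_vec [x, y]) = y"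
  "s \<ge> 2 \<Longrightarrow> component s (dsum_vec [x, y]) = 0"
  by (simp_all add: component_dsum_vec)

lemma vec_eq_components2I:
  assumes "component 0 x = component 0 y" "component 1 x = component 1 y"
    "\<And>s. s \<ge> 2 \<Longrightarrow> component s x = component s y"
  shows "x = y"
proof (rule vec_eq_componentsI)
  show "component s x = component s y" for s
  proof -
    consider "s = 0" | "s = 1" | "s \<ge> 2" by linarith
    then show ?thesis by cases (use assms in auto)
  qed
qed

lemma dpair_iff:
  "t \<in> dpair S T \<longleftrightarrow> component 0 t \<in> S \<and> component 1 t \<in> T \<and> (\<forall>s\<ge>2. component s t = 0)"
proof
  assume R: "component 0 t \<in> S \<and> component 1 t \<in> T \<and> (\<forall>s\<ge>2. component s t = 0)"
  then have "t = dsum_vec [component 0 t, component 1 t]" by - (rule vec_eq_components2I, auto)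
  then show "t \<in> dpair S T" using R unfolding dpair_def by blast
qed (auto simp: dpair_def)

lemma dsum_vec_in_dpair [simp]: "dsum_vec [x, y] \<in> dpair S T \<longleftrightarrow> x \<in> S \<and> y \<in> T"
  by (simp add: dpair_iff)

lemma subspace_dpair:
  assumes "vs.subspace S" "vs.subspace T" shows "vs.subspace (dpair S T)"
  by (rule vs.subspaceI)
     (auto simp: dpair_iff component_add component_smul vs.subspace_0[OF assms(1)] vs.subspace_0[OF assms(2)]
       intro: vs.subspace_add[OF assms(1)] vs.subspace_add[OF assms(2)]
         vs.subspace_scale[OF assms(1)] vs.subspace_scale[OF assms(2)])

lemma dsum_vec_split: "dsum_vec [x, y] = inject 0 x + inject 1 y"
  by (rule vec_eq_components2I) (auto simp: component_add component_inject)

lemma finite_dim_dpair: assumes "finite_dim S" "finite_dim T" shows "finite_dim (dpair S T)"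
proof -
  obtain A B where A: "finite A" "vs.span A = S" and B: "finite B" "vs.span B = T"
    using assms unfolding finite_dim_def by blast
  have "vs.span (inject 0 ` A \<union> inject 1 ` B) = {x + y | x y. x \<in> inject 0 ` S \<and> y \<in> inject 1 ` T}"
    unfolding vs.span_Un linear_on_image_span[OF inject_linear vs.subspace_UNIV subset_UNIV, symmetric]
      A(2) B(2) ..
  also have "\<dots> = dpair S T" unfolding dpair_def dsum_vec_split by blast
  finally have "vs.span (inject 0 ` A \<union> inject 1 ` B) = dpair S T" .
  moreover have "finite (inject 0 ` A \<union> inject 1 ` B)" using A B by blast
  ultimately show ?thesis unfolding finite_dim_def by metis
qed

lemma glider_dsum_simps [simp]:
  "amb (glider_dsum M N) = dsum_mod [amb M, amb N]"
  "low (glider_dsum M N) = dpair (low M) (low N)"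
  "high (glider_dsum M N) = dpair (high M) (high N)"
  by (simp_all add: glider_dsum_def dpair_def)

lemma vecs_dsum2: "vecs (dsum_mod [V, W]) = dpair (vecs V) (vecs W)"
  by (rule Set.set_eqI) (auto simp: in_vecs_dsum dpair_iff numeral_2_eq_2 All_less_Suc)

lemma act_dsum2: "act (dsum_mod [V, W]) g t = dsum_vec [act V g (component 0 t), act W g (component 1 t)]"
  by (rule vec_eq_components2I) (simp_all add: component_act_dsum)

context finite_group
begin

lemma is_glider_dsum:
  assumes M: "is_glider G M" and N: "is_glider G N"
  shows "is_glider G (glider_dsum M N)"
proof (rule is_gliderI)
  note MD = is_gliderD[OF M] and ND = is_gliderD[OF N]
  show "kg_module G (amb (glider_dsum M N))"
    using MD(1) ND(1) by (auto intro!: kg_module_dsum)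
  show "act (amb (glider_dsum M N)) g x \<in> high (glider_dsum M N)"
    if "g \<in> carrier G" "x \<in> low (glider_dsum M N)" for g x
    using that glider_act[OF M that(1)] glider_act[OF N that(1)] by (auto simp: act_dsum2 dpair_iff)
  show "low (glider_dsum M N) \<subseteq> high (glider_dsum M N)" "high (glider_dsum M N) \<subseteq> vecs (amb (glider_dsum M N))"
    using MD ND unfolding glider_dsum_simps vecs_dsum2 by (auto simp: dpair_iff)
qed (use is_gliderD[OF M] is_gliderD[OF N] in \<open>simp_all add: finite_dim_dpair subspace_dpair\<close>)


section \<open>Commutativity and distributivity up to isomorphism\<close>

text \<open>
  Both isomorphisms only rename coordinates, along a bijection of the natural numbers.
\<close>

lemma relabel_linear: "linear_on S (\<lambda>t. t \<circ> \<pi>)"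
  by (auto simp: linear_on_def vec_apply fun_eq_iff)

lemma glider_iso_relabel:
  assumes "is_glider G P" "is_glider G Q" and \<pi>: "surj \<pi>"
    and "(\<lambda>t. t \<circ> \<pi>) ` high P = high Q" "(\<lambda>t. t \<circ> \<pi>) ` low P = low Q"
    and "\<And>g t. \<lbrakk>g \<in> carrier G; t \<in> low P\<rbrakk> \<Longrightarrow> act (amb P) g t \<circ> \<pi> = act (amb Q) g (t \<circ> \<pi>)"
  shows "glider_iso G P Q"
proof (rule glider_isoI[OF assms(1,2)])
  show "linear_on (high P) (\<lambda>t. t \<circ> \<pi>)" by (rule relabel_linear)
  have "inj_on (\<lambda>t. t \<circ> \<pi>) (high P)"
  proof (rule inj_onI, rule ext)
    fix s t k assume eq: "s \<circ> \<pi> = t \<circ> \<pi>"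
    obtain l where "k = \<pi> l" using \<pi> by (rule surjE)
    then show "s k = t k" using fun_cong[OF eq, of l] by simp
  qed
  then show "bij_betw (\<lambda>t. t \<circ> \<pi>) (high P) (high Q)" using assms(4) by (simp add: bij_betw_def)
qed (use assms in auto)

definition swap_index :: "nat \<Rightarrow> nat" where
  "swap_index k = (case prod_decode k of (i, j) \<Rightarrow> prod_encode (j, i))"

lemma swap_index: "swap_index (prod_encode (i, j)) = prod_encode (j, i)"
  by (simp add: swap_index_def)

lemma surj_swap_index: "surj swap_index"
proof (rule surjI)
  fix k :: nat
  obtain i j where "k = prod_encode (i, j)" by (metis prod_decode_inverse surj_pair)
  then show "swap_index (swap_index k) = k" by (simp add: swap_index)
qed

lemma tensor_vec_swap: "tensor_vec x y \<circ> swap_index = (tensor_vec y x :: 'k::field vec)"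
  by (rule vec_eq_pairsI) (simp add: swap_index mult.commute)

lemma tspan_swap: "(\<lambda>t. t \<circ> swap_index) ` tspan S T = (tspan T S :: 'k::field vec set)"
proof -
  have "(\<lambda>t. t \<circ> swap_index) ` {tensor_vec x y | x y. x \<in> S \<and> y \<in> T}
      = {tensor_vec x y | x y. x \<in> T \<and> y \<in> S}" (is "?f ` ?A = ?B")
  proof
    show "?f ` ?A \<subseteq> ?B" using tensor_vec_swap by blast
    show "?B \<subseteq> ?f ` ?A"
    proof
      fix t assume "t \<in> ?B"
      then obtain x y where "t = tensor_vec y x \<circ> swap_index" "x \<in> T" "y \<in> S"
        unfolding tensor_vec_swap by blast
      then show "t \<in> ?f ` ?A" by blast
    qed
  qed
  then show ?thesis
    unfolding tspan_def linear_on_image_span[OF relabel_linear vs.subspace_UNIV subset_UNIV] by (rule arg_cong)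
qed

lemma act_tensor_linear:
  assumes "is_glider G M" "is_glider G N"
  shows "linear_on (tspan (low M) (low N)) (act (tensor_mod (amb M) (amb N)) g)"
  unfolding act_tensor_mod
  by (rule tensor_map_linear_tspan[OF is_gliderD(8)[OF assms(1)] is_gliderD(8)[OF assms(2)]])

lemma glider_tensor_commute:
  assumes M: "is_glider G M" and N: "is_glider G N"
  shows "glider_iso G (glider_tensor M N) (glider_tensor N M)"
proof (rule glider_iso_relabel[OF is_glider_tensor[OF M N] is_glider_tensor[OF N M] surj_swap_index])
  let ?V = "tensor_mod (amb M) (amb N)" and ?W = "tensor_mod (amb N) (amb M)"
  note MD = is_gliderD[OF M] and ND = is_gliderD[OF N]
  fix g t assume g: "g \<in> carrier G" and t: "t \<in> low (glider_tensor M N)"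
  have "act ?V g t \<circ> swap_index = act ?W g (t \<circ> swap_index)"
  proof (rule linear_on_tspan_eq[where f = "\<lambda>t. act ?V g t \<circ> swap_index" and h = "\<lambda>t. act ?W g (t \<circ> swap_index)"])
    show "linear_on (tspan (low M) (low N)) (\<lambda>t. act ?V g t \<circ> swap_index)"
      by (rule linear_on_comp[OF act_tensor_linear[OF M N] order_refl relabel_linear])
    show "linear_on (tspan (low M) (low N)) (\<lambda>t. act ?W g (t \<circ> swap_index))"
      by (rule linear_on_comp[OF relabel_linear _ act_tensor_linear[OF N M]]) (simp add: tspan_swap)
  next
    fix x y assume "x \<in> low M" "y \<in> low N"
    then have "x \<in> vecs (amb M)" "y \<in> vecs (amb N)" using MD(8) ND(8) by auto
    then show "act ?V g (tensor_vec x y) \<circ> swap_index = act ?W g (tensor_vec x y \<circ> swap_index)"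
      by (simp add: tensor_vec_swap act_tensor_vec[OF MD(1) ND(1) g] act_tensor_vec[OF ND(1) MD(1) g])
  qed (use t in simp)
  then show "act (amb (glider_tensor M N)) g t \<circ> swap_index = act (amb (glider_tensor N M)) g (t \<circ> swap_index)"
    by simp
qed (simp_all add: tspan_swap)

definition distrib_index :: "nat \<Rightarrow> nat" where
  "distrib_index k = (case prod_decode k of (s, r) \<Rightarrow> case prod_decode r of (i, j) \<Rightarrow>
     prod_encode (prod_encode (s, i), j))"

lemma distrib_index:
  "distrib_index (prod_encode (s, prod_encode (i, j))) = prod_encode (prod_encode (s, i), j)"
  by (simp add: distrib_index_def)

lemma surj_distrib_index: "surj distrib_index"
proof -
  have "\<exists>k. distrib_index k = l" for l
  proof -
    obtain r j where l: "l = prod_encode (r, j)" by (metis prod_decode_inverse surj_pair)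
    obtain s i where "r = prod_encode (s, i)" by (metis prod_decode_inverse surj_pair)
    then show ?thesis using l distrib_index by blast
  qed
  then show ?thesis unfolding surj_def by metis
qed

lemma tensor_vec_distrib:
  "tensor_vec (dsum_vec [x, y]) z \<circ> distrib_index = dsum_vec [tensor_vec x z, tensor_vec y (z :: 'k::field vec)]"
proof -
  have 1: "component s (tensor_vec w z \<circ> distrib_index) = tensor_vec (component s w) z" for s and w :: "'k vec"
    by (rule vec_eq_pairsI) (simp add: component_def distrib_index)
  have 2: "tensor_vec 0 z = 0" by (rule vec_eq_pairsI) (simp add: vec_apply)
  show ?thesis by (rule vec_eq_components2I) (simp_all add: 1 2)
qed

lemma tspan_distrib:
  assumes S: "vs.subspace S" and T: "vs.subspace T"
  shows "(\<lambda>t. t \<circ> distrib_index) ` tspan (dpair S T) R = (dpair (tspan S R) (tspan T R) :: 'k::field vec set)"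
    (is "?f ` _ = _")
proof
  have "?f t \<in> dpair (tspan S R) (tspan T R)" if "t \<in> tspan (dpair S T) R" for t
  proof (rule linear_on_tspan_closed[OF relabel_linear _ _ that])
    fix w z assume "w \<in> dpair S T" and z: "z \<in> R"
    then obtain x y where "w = dsum_vec [x, y]" "x \<in> S" "y \<in> T" by (auto simp: dpair_def)
    then show "tensor_vec w z \<circ> distrib_index \<in> dpair (tspan S R) (tspan T R)"
      using z by (simp add: tensor_vec_distrib tspan_base)
  qed (simp add: subspace_dpair)
  then show "?f ` tspan (dpair S T) R \<subseteq> dpair (tspan S R) (tspan T R)" by blast
  have sub: "vs.subspace (?f ` tspan (dpair S T) R)"
    by (rule subspace_linear_image[OF relabel_linear subspace_tspan])
  have 0: "tensor_vec 0 z = 0" for z :: "'k vec" by (rule vec_eq_pairsI) (simp add: vec_apply)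
  have inj: "inject 0 a = dsum_vec [a, 0]" "inject 1 a = dsum_vec [0, a]" for a :: "'k vec"
    by (rule vec_eq_components2I; simp add: component_inject)+
  have gen: "dsum_vec [tensor_vec x z, tensor_vec y z] \<in> ?f ` tspan (dpair S T) R"
    if "x \<in> S" "y \<in> T" "z \<in> R" for x y z
    unfolding tensor_vec_distrib[symmetric] by (rule imageI, rule tspan_base) (use that in auto)
  have 1: "inject 0 a \<in> ?f ` tspan (dpair S T) R" if "a \<in> tspan S R" for a
    by (rule linear_on_tspan_closed[OF inject_linear sub _ that])
       (use gen[of _ 0] vs.subspace_0[OF T] in \<open>simp add: inj 0\<close>)
  have 2: "inject 1 a \<in> ?f ` tspan (dpair S T) R" if "a \<in> tspan T R" for a
    by (rule linear_on_tspan_closed[OF inject_linear sub _ that])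
       (use gen[of 0] vs.subspace_0[OF S] in \<open>simp add: inj(2)[unfolded One_nat_def] 0\<close>)
  show "dpair (tspan S R) (tspan T R) \<subseteq> ?f ` tspan (dpair S T) R"
  proof
    fix t assume "t \<in> dpair (tspan S R) (tspan T R)"
    then obtain a b where "t = inject 0 a + inject 1 b" "a \<in> tspan S R" "b \<in> tspan T R"
      unfolding dpair_def dsum_vec_split by blast
    then show "t \<in> ?f ` tspan (dpair S T) R" using vs.subspace_add[OF sub 1 2] by simp
  qed
qed

lemma glider_tensor_distrib:
  assumes M: "is_glider G M" and N: "is_glider G N" and L: "is_glider G L"
  shows "glider_iso G (glider_tensor (glider_dsum M N) L) (glider_dsum (glider_tensor M L) (glider_tensor N L))"
    (is "glider_iso G ?P ?Q")
proof (rule glider_iso_relabel[OF _ _ surj_distrib_index])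
  note MN = is_glider_dsum[OF M N] and MxL = is_glider_tensor[OF M L] and NxL = is_glider_tensor[OF N L]
  note MD = is_gliderD[OF M] and ND = is_gliderD[OF N] and LD = is_gliderD[OF L] and MND = is_gliderD[OF MN]
  show P: "is_glider G ?P" and Q: "is_glider G ?Q"
    using is_glider_tensor[OF MN L] is_glider_dsum[OF MxL NxL] by auto
  fix g t assume g: "g \<in> carrier G" and t: "t \<in> low ?P"
  have t': "t \<in> tspan (dpair (low M) (low N)) (low L)" using t by simp
  have low: "(\<lambda>t. t \<circ> distrib_index) ` tspan (dpair (low M) (low N)) (low L) = low ?Q"
    using tspan_distrib[OF MD(2) ND(2)] by simp
  show "act (amb ?P) g t \<circ> distrib_index = act (amb ?Q) g (t \<circ> distrib_index)"
  proof (rule linear_on_tspan_eq[where f = "\<lambda>t. act (amb ?P) g t \<circ> distrib_index"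
        and h = "\<lambda>t. act (amb ?Q) g (t \<circ> distrib_index)", OF _ _ _ t'])
    show "linear_on (tspan (dpair (low M) (low N)) (low L)) (\<lambda>t. act (amb ?P) g t \<circ> distrib_index)"
      using linear_on_comp[OF act_tensor_linear[OF MN L] order_refl relabel_linear] by simp
    have "linear_on (low ?Q) (act (amb ?Q) g)"
      by (rule linear_on_subset[OF act_linear[OF is_gliderD(1)[OF Q] g] is_gliderD(8)[OF Q]])
    then show "linear_on (tspan (dpair (low M) (low N)) (low L)) (\<lambda>t. act (amb ?Q) g (t \<circ> distrib_index))"
      by (rule linear_on_comp[OF relabel_linear, rotated]) (simp only: low order_refl)
  next
    fix w z assume w: "w \<in> dpair (low M) (low N)" and z: "z \<in> low L"
    then obtain x y where xy: "w = dsum_vec [x, y]" "x \<in> low M" "y \<in> low N" by (auto simp: dpair_def)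
    have V: "x \<in> vecs (amb M)" "y \<in> vecs (amb N)" "z \<in> vecs (amb L)"
      "w \<in> vecs (dsum_mod [amb M, amb N])"
      using xy z w MD(8) ND(8) LD(8) MND(8) by auto
    have "act (amb ?P) g (tensor_vec w z)
        = tensor_vec (dsum_vec [act (amb M) g x, act (amb N) g y]) (act (amb L) g z)"
      using act_tensor_vec[OF MND(1) LD(1) g, of w z] V xy(1) by (simp add: act_dsum2)
    then show "act (amb ?P) g (tensor_vec w z) \<circ> distrib_index = act (amb ?Q) g (tensor_vec w z \<circ> distrib_index)"
      using V by (simp add: xy(1) tensor_vec_distrib act_dsum2 act_tensor_vec[OF MD(1) LD(1) g]
          act_tensor_vec[OF ND(1) LD(1) g])
  qed
qed (simp_all add: tspan_distrib is_gliderD[OF M] is_gliderD[OF N])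


section \<open>Splitting off gliders of length zero\<close>

text \<open>
  Every subset of a finite-dimensional space has a maximal independent subset, which is finite.
\<close>

lemma finite_dim_subspace:
  assumes "finite_dim T" "vs.subspace S" "S \<subseteq> T" shows "finite_dim S"
proof -
  obtain A where A: "finite A" "vs.span A = T" using assms(1) unfolding finite_dim_def by blast
  obtain B where B: "B \<subseteq> S" "vs.independent B" "S \<subseteq> vs.span B"
    using vs.maximal_independent_subset[of S] by blast
  have "finite B" using vs.independent_span_bound[OF A(1) B(2)] A(2) B(1) assms(3) by blast
  moreover have "vs.span B = S" using B(1,3) assms(2) by (simp add: vs.span_subspace)
  ultimately show ?thesis unfolding finite_dim_def by blast
qed

text \<open>
  The complement is spanned by the vectors that extend a basis of \<open>S\<close> to a basis of \<open>T\<close>; the projection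
  \<open>P\<close> onto \<open>S\<close> along it shows that the intersection is \<open>0\<close>.
\<close>

lemma subspace_complement:
  assumes S: "vs.subspace S" "S \<subseteq> T" and T: "vs.subspace (T :: 'k::field vec set)"
  obtains C where "vs.subspace C" "C \<subseteq> T" "S \<inter> C = {0}" "\<And>x. x \<in> T \<Longrightarrow> \<exists>a\<in>S. \<exists>c\<in>C. x = a + c"
proof -
  obtain B where B: "B \<subseteq> S" "vs.independent B" "S \<subseteq> vs.span B"
    using vs.maximal_independent_subset[of S] by blast
  obtain B' where B': "B \<subseteq> B'" "B' \<subseteq> T" "vs.independent B'" "T \<subseteq> vs.span B'"
    using vs.maximal_independent_subset_extend[of B T] B S by (metis subset_trans)
  interpret p: vector_space_pair "smul :: 'k \<Rightarrow> 'k vec \<Rightarrow> 'k vec" "smul :: 'k \<Rightarrow> 'k vec \<Rightarrow> 'k vec"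
    by unfold_locales
  define P where "P = p.construct B' (\<lambda>b. if b \<in> B then b else 0)"
  have P: "linear_on UNIV P"
    using p.linear_add[OF p.linear_construct[OF B'(3)]] p.linear_scale[OF p.linear_construct[OF B'(3)]]
    by (simp add: linear_on_def P_def)
  have PB: "P b = (if b \<in> B then b else 0)" if "b \<in> B'" for b
    using p.construct_basis[OF B'(3) that] by (simp add: P_def)
  have spanB: "vs.span B = S" using B S by (simp add: vs.span_subspace)
  let ?C = "vs.span (B' - B)"
  have 1: "P x = x" if "x \<in> vs.span B" for x
    by (rule linear_on_span_eq[OF P _ vs.subspace_UNIV _ _ that]) (use PB B'(1) in \<open>auto simp: linear_on_def\<close>)
  have 2: "P x = 0" if "x \<in> ?C" for x
    by (rule linear_on_span_eq[OF P _ vs.subspace_UNIV _ _ that]) (use PB in \<open>auto simp: linear_on_def\<close>)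
  have "S \<inter> ?C = {0}"
  proof
    show "S \<inter> ?C \<subseteq> {0}"
    proof
      fix x assume "x \<in> S \<inter> ?C"
      then have "P x = x" "P x = 0" using 1[of x] 2[of x] spanB by auto
      then show "x \<in> {0}" by simp
    qed
    show "{0} \<subseteq> S \<inter> ?C" using vs.span_zero vs.subspace_0[OF S(1)] by blast
  qed
  moreover have "\<exists>a\<in>S. \<exists>c\<in>?C. x = a + c" if "x \<in> T" for x
  proof -
    have "B \<union> (B' - B) = B'" using B'(1) by blast
    then have "x \<in> {a + c | a c. a \<in> vs.span B \<and> c \<in> ?C}" using B'(4) that vs.span_Un[of B "B' - B"] by auto
    then show ?thesis using spanB by blast
  qed
  moreover have "?C \<subseteq> T" using B'(2) T by (intro vs.span_minimal) auto
  ultimately show ?thesis using that[of ?C] by simp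
qed

text \<open>
  This is an irreducible glider if \<open>M\<^sub>-\<^sub>1\<close> is a line.
\<close>

definition core :: "('a, 'k::field) glider \<Rightarrow> ('a, 'k) glider" where
  "core M = M\<lparr>high := alg_span G (amb M) (low M)\<rparr>"

lemma core_simps [simp]:
  "amb (core M) = amb M" "low (core M) = low M" "high (core M) = alg_span G (amb M) (low M)"
  by (simp_all add: core_def)

lemma low_subset_alg_span:
  assumes "is_glider G M" shows "low M \<subseteq> alg_span G (amb M) (low M)"
proof
  fix x assume x: "x \<in> low M"
  have "act (amb M) \<one> x \<in> alg_span G (amb M) (low M)"
    using alg_span_subset_iff[of "alg_span G (amb M) (low M)" "amb M" "low M"] x
    by (simp add: alg_span_def)
  then show "x \<in> alg_span G (amb M) (low M)"
    using act_one[OF is_gliderD(1)[OF assms]] is_gliderD(8)[OF assms] x by auto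
qed

lemma is_glider_core: assumes M: "is_glider G M" shows "is_glider G (core M)"
proof (rule is_gliderI)
  note MD = is_gliderD[OF M]
  have sub: "alg_span G (amb M) (low M) \<subseteq> high M" using M by (simp add: is_glider_def)
  show "finite_dim (high (core M))"
    using finite_dim_subspace[OF MD(5) _ sub] by (simp add: alg_span_def)
  show "high (core M) \<subseteq> vecs (amb (core M))" using sub MD(7) by simp
  show "act (amb (core M)) g x \<in> high (core M)" if "g \<in> carrier G" "x \<in> low (core M)" for g x
    using that alg_span_subset_iff[of "alg_span G (amb M) (low M)" "amb M" "low M"]
    by (simp add: alg_span_def)
qed (use is_gliderD[OF M] low_subset_alg_span[OF M] in \<open>simp_all add: alg_span_def\<close>)

text \<open>
  A linear complement of \<open>K[G] M\<^sub>-\<^sub>1\<close> in \<open>M\<^sub>0\<close> is a direct summand: it need not be stable under \<open>G\<close>,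
  because morphisms only respect the action on \<open>M\<^sub>-\<^sub>1\<close>.
\<close>

lemma glider_core_splits:
  assumes M: "is_glider G M"
  obtains N where "is_glider G N" "low N = {0}" "glider_iso G (glider_dsum (core M) N) M"
proof -
  note MD = is_gliderD[OF M]
  let ?H = "alg_span G (amb M) (low M)"
  have sub: "?H \<subseteq> high M" using M by (simp add: is_glider_def)
  have H: "vs.subspace ?H" by (simp add: alg_span_def)
  obtain C where C: "vs.subspace C" "C \<subseteq> high M" "?H \<inter> C = {0}"
    and split: "\<And>x. x \<in> high M \<Longrightarrow> \<exists>a\<in>?H. \<exists>c\<in>C. x = a + c"
    using subspace_complement[OF H sub MD(4)] by blast
  define N where "N = \<lparr>amb = amb M, low = {0}, high = C\<rparr>"
  have N0: "act (amb M) g 0 = 0" if "g \<in> carrier G" for g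
    by (rule linear_on_zero[OF act_linear[OF MD(1) that] subspace_vecs])
  have N: "is_glider G N"
  proof (rule is_gliderI)
    show "finite_dim (low N)" unfolding finite_dim_def N_def by (rule exI[of _ "{}"]) simp
    show "act (amb N) g x \<in> high N" if "g \<in> carrier G" "x \<in> low N" for g x
      using that N0 vs.subspace_0[OF C(1)] by (simp add: N_def)
  qed (use MD C vs.subspace_0[OF C(1)] finite_dim_subspace[OF MD(5) C(1,2)] in \<open>auto simp: N_def\<close>)
  let ?f = "\<lambda>t. component 0 t + component 1 t"
  have "glider_iso G (glider_dsum (core M) N) M"
  proof (rule glider_isoI[OF is_glider_dsum[OF is_glider_core[OF M] N] M])
    have [simp]: "low N = {0}" "high N = C" "high (glider_dsum (core M) N) = dpair ?H C" "low (glider_dsum (core M) N) = dpair (low M) {0}"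
      by (simp_all add: N_def)
    show lin: "linear_on (high (glider_dsum (core M) N)) ?f"
      by (simp add: linear_on_def component_add component_smul vs.scale_right_distrib algebra_simps)
    have "?f ` dpair ?H C = high M"
    proof
      show "?f ` dpair ?H C \<subseteq> high M"
        using sub C(2) by (auto simp: dpair_def intro!: vs.subspace_add[OF MD(4)])
      show "high M \<subseteq> ?f ` dpair ?H C"
      proof
        fix x assume "x \<in> high M"
        then obtain a c where "a \<in> ?H" "c \<in> C" "x = ?f (dsum_vec [a, c])" using split by fastforce
        then show "x \<in> ?f ` dpair ?H C" by (intro image_eqI[of _ _ "dsum_vec [a, c]"]) auto
      qed
    qed
    moreover have "inj_on ?f (dpair ?H C)"
    proof (rule inj_onI)
      fix s t assume s: "s \<in> dpair ?H C" and t: "t \<in> dpair ?H C" and eq: "?f s = ?f t"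
      have "component 0 s - component 0 t = component 1 t - component 1 s"
        using eq by (simp add: algebra_simps)
      moreover have "component 0 s - component 0 t \<in> ?H" "component 1 t - component 1 s \<in> C"
        using s t vs.subspace_diff[OF H] vs.subspace_diff[OF C(1)] by (auto simp: dpair_iff)
      ultimately have "component 0 s - component 0 t \<in> ?H \<inter> C" by simp
      then have "component 0 s - component 0 t = 0" unfolding C(3) by simp
      then have "component 0 s = component 0 t" "component 1 s = component 1 t" using eq by simp_all
      then show "s = t" using s t by - (rule vec_eq_components2I, auto simp: dpair_iff)
    qed
    ultimately show "bij_betw ?f (high (glider_dsum (core M) N)) (high M)" by (simp add: bij_betw_def)
    show "?f ` low (glider_dsum (core M) N) = low M"
    proof
      show "?f ` low (glider_dsum (core M) N) \<subseteq> low M" by (auto simp: dpair_def)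
      show "low M \<subseteq> ?f ` low (glider_dsum (core M) N)"
      proof
        fix x assume "x \<in> low M"
        then show "x \<in> ?f ` low (glider_dsum (core M) N)" by (intro image_eqI[of _ _ "dsum_vec [x, 0]"]) auto
      qed
    qed
    show "?f (act (amb (glider_dsum (core M) N)) g t) = act (amb M) g (?f t)"
      if g: "g \<in> carrier G" and "t \<in> low (glider_dsum (core M) N)" for g t
      using that N0[OF g] by (auto simp: dpair_def act_dsum2 N_def)
  qed
  then show ?thesis using that N by (simp add: N_def)
qed


section \<open>Coefficient spaces\<close>

text \<open>
  Coordinates are used in place of general functionals. They give the same space, because on the
  finite set of vectors \<open>g u\<close> only finitely many coordinates are nonzero.
\<close>

definition matrix_coeff :: "('a, 'k::field) kgmod \<Rightarrow> 'k vec \<Rightarrow> nat \<Rightarrow> 'a \<Rightarrow> 'k" where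
  "matrix_coeff V u i = (\<lambda>g. if g \<in> carrier G then act V g u i else 0)"

definition coeffs :: "('a, 'k::field) kgmod \<Rightarrow> 'k vec \<Rightarrow> ('a \<Rightarrow> 'k) set" where
  "coeffs V u = fs.span (range (matrix_coeff V u))"

lemma subspace_coeffs [simp]: "fs.subspace (coeffs V u)"
  by (simp add: coeffs_def)

lemma coeffs_fun_on: "coeffs V u \<subseteq> fun_on (carrier G)"
  unfolding coeffs_def
  by (rule fs.span_minimal[OF _ subspace_fun_on]) (auto simp: matrix_coeff_def fun_on_def)

lemma sum_fsmul_apply: "(\<Sum>j\<in>J. fsmul (c j) (f j)) g = (\<Sum>j\<in>J. c j * f j g)"
  by (induction J rule: infinite_finite_induct) (auto simp: plus_fun_apply zero_fun_apply fsmul_def)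

text \<open>
  The \<open>i\<close>-th coordinate of \<open>h (g u)\<close> is a linear function of \<open>g u\<close>, and therefore a combination of the
  coordinates of \<open>g u\<close> with coefficients from the matrix of \<open>h\<close>.
\<close>

lemma translate_matrix_coeff:
  assumes V: "kg_module G V" and u: "u \<in> vecs V" and h: "h \<in> carrier G"
  shows "translate G h (matrix_coeff V u i) \<in> coeffs V u"
proof -
  let ?J = "\<Union>g\<in>carrier G. {j. act V g u j \<noteq> 0}"
  have gu: "act V g u \<in> vecs V" if "g \<in> carrier G" for g using act_closed[OF V that u] .
  have fin: "finite ?J" using gu finite_carrier by (auto simp: vecs_def)
  have index: "?J \<subseteq> index V" using gu by (auto simp: vecs_def)
  have unit: "smul c (unit_vec j) \<in> vecs V" if "j \<in> ?J" for c j
    using index that by (intro vs.subspace_scale[OF subspace_vecs]) (auto simp: vecs_fsv intro: unit_vec_in_fsv)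
  have "translate G h (matrix_coeff V u i) = (\<Sum>j\<in>?J. fsmul (act V h (unit_vec j) i) (matrix_coeff V u j))"
  proof
    fix g
    show "translate G h (matrix_coeff V u i) g
        = (\<Sum>j\<in>?J. fsmul (act V h (unit_vec j) i) (matrix_coeff V u j)) g"
    proof (cases "g \<in> carrier G")
      case True
      have sum: "act V g u = (\<Sum>j\<in>?J. smul (act V g u j) (unit_vec j))"
        by (rule fsv_expand[OF fin]) (use True in blast)
      have "act V h (act V g u) = act V h (\<Sum>j\<in>?J. smul (act V g u j) (unit_vec j))"
        using sum by simp
      also have "\<dots> = (\<Sum>j\<in>?J. act V h (smul (act V g u j) (unit_vec j)))"
        by (rule linear_on_sum[OF act_linear[OF V h] subspace_vecs unit])
      also have "\<dots> = (\<Sum>j\<in>?J. smul (act V g u j) (act V h (unit_vec j)))"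
        by (rule sum.cong[OF refl], rule linear_on_smul[OF act_linear[OF V h]])
           (use unit[of _ 1] in simp)
      finally have "act V h (act V g u) i = (\<Sum>j\<in>?J. act V g u j * act V h (unit_vec j) i)"
        by (simp add: sum_fun_apply smul_apply)
      moreover have "act V (h \<otimes> g) u = act V h (act V g u)"
        using act_mult[OF V h True u] .
      ultimately show ?thesis
        using True h by (simp add: sum_fsmul_apply translate_def matrix_coeff_def mult.commute)
    next
      case False
      then show ?thesis by (simp add: sum_fsmul_apply translate_def matrix_coeff_def)
    qed
  qed
  also have "\<dots> \<in> coeffs V u"
    unfolding coeffs_def by (rule fs.span_sum, rule fs.span_scale, rule fs.span_base) blast
  finally show ?thesis .
qed

lemma translation_invariant_coeffs:
  assumes "kg_module G V" "u \<in> vecs V" shows "translation_invariant G (coeffs V u)"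
  unfolding translation_invariant_def
proof (intro ballI image_subsetI)
  fix h f assume h: "h \<in> carrier G" and f: "f \<in> coeffs V u"
  show "translate G h f \<in> coeffs V u"
    unfolding coeffs_def
    by (rule translate_span[OF _ f[unfolded coeffs_def]])
       (use translate_matrix_coeff[OF assms h] in \<open>auto simp: coeffs_def\<close>)
qed

lemma coeffs_nonzero:
  assumes "kg_module G V" "u \<in> vecs V" "u \<noteq> 0" obtains f where "f \<in> coeffs V u" "f \<noteq> 0"
proof -
  obtain i where i: "u i \<noteq> 0" using assms(3) by (auto simp: fun_eq_iff zero_fun_apply)
  then have "matrix_coeff V u i \<one> \<noteq> 0" using act_one[OF assms(1,2)] by (simp add: matrix_coeff_def)
  then have "matrix_coeff V u i \<noteq> 0" by (metis zero_fun_apply)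
  then show ?thesis using that[of "matrix_coeff V u i"] unfolding coeffs_def by (blast intro: fs.span_base)
qed

lemma coeffs_tensor:
  assumes V: "kg_module G V" and W: "kg_module G W" and u: "u \<in> vecs V" and v: "v \<in> vecs W"
  shows "coeffs (tensor_mod V W) (tensor_vec u v) = fprod (coeffs V u) (coeffs W v)"
proof -
  have mc: "matrix_coeff (tensor_mod V W) (tensor_vec u v) (prod_encode (i, j))
      = matrix_coeff V u i * matrix_coeff W v j" for i j
  proof
    fix g
    show "matrix_coeff (tensor_mod V W) (tensor_vec u v) (prod_encode (i, j)) g
        = (matrix_coeff V u i * matrix_coeff W v j) g"
      using act_tensor_vec[OF V W _ u v, of g] by (simp add: matrix_coeff_def times_fun_apply)
  qed
  have "range (matrix_coeff (tensor_mod V W) (tensor_vec u v))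
      = {f * g | f g. f \<in> range (matrix_coeff V u) \<and> g \<in> range (matrix_coeff W v)}" (is "?A = ?B")
  proof
    show "?A \<subseteq> ?B"
    proof
      fix f assume "f \<in> ?A"
      then obtain k where "f = matrix_coeff (tensor_mod V W) (tensor_vec u v) k" by blast
      moreover obtain i j where "k = prod_encode (i, j)" by (metis prod_decode_inverse surj_pair)
      ultimately have "f = matrix_coeff V u i * matrix_coeff W v j" using mc by simp
      then show "f \<in> ?B" by blast
    qed
    show "?B \<subseteq> ?A"
    proof
      fix f assume "f \<in> ?B"
      then obtain i j where "f = matrix_coeff V u i * matrix_coeff W v j" by blast
      then show "f \<in> ?A" unfolding mc[symmetric] by blast
    qed
  qed
  then show ?thesis unfolding coeffs_def fprod_span by (rule arg_cong)
qed

lemma subspace_orthogonal: "fs.subspace {f. (\<Sum>g\<in>carrier G. a g * f g) = (0 :: 'k::field)}"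
proof (rule fs.subspaceI)
  fix c f assume "f \<in> {f. (\<Sum>g\<in>carrier G. a g * f g) = 0}"
  then have "c * (\<Sum>g\<in>carrier G. a g * f g) = 0" by simp
  then show "fsmul c f \<in> {f. (\<Sum>g\<in>carrier G. a g * f g) = 0}"
    by (simp add: fsmul_def sum_distrib_left mult.left_commute)
qed (simp_all add: zero_fun_apply plus_fun_apply distrib_left sum.distrib)

text \<open>
  A linear relation \<open>a u = 0\<close> says that \<open>a\<close>, as a functional on the functions on \<open>G\<close>, vanishes on the
  coordinate functions of \<open>u\<close>. So the coefficient space is dual to the annihilator.
\<close>

lemma alg_act_zero_iff:
  "alg_act G V a u = 0 \<longleftrightarrow> (\<forall>f\<in>coeffs V u. (\<Sum>g\<in>carrier G. a g * f g) = 0)"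
proof
  assume 0: "alg_act G V a u = 0"
  show "\<forall>f\<in>coeffs V u. (\<Sum>g\<in>carrier G. a g * f g) = 0"
  proof
    fix f assume "f \<in> coeffs V u"
    moreover have "coeffs V u \<subseteq> {f. (\<Sum>g\<in>carrier G. a g * f g) = 0}"
      unfolding coeffs_def
    proof (rule fs.span_minimal)
      show "range (matrix_coeff V u) \<subseteq> {f. (\<Sum>g\<in>carrier G. a g * f g) = 0}"
      proof
        fix f assume "f \<in> range (matrix_coeff V u)"
        then obtain i where "f = matrix_coeff V u i" by blast
        then have "(\<Sum>g\<in>carrier G. a g * f g) = alg_act G V a u i"
          by (simp add: alg_act_def matrix_coeff_def sum_fun_apply smul_apply)
        then show "f \<in> {f. (\<Sum>g\<in>carrier G. a g * f g) = 0}" using 0 by (simp add: zero_fun_apply)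
      qed
    qed (rule subspace_orthogonal)
    ultimately show "(\<Sum>g\<in>carrier G. a g * f g) = 0" by blast
  qed
next
  assume R: "\<forall>f\<in>coeffs V u. (\<Sum>g\<in>carrier G. a g * f g) = 0"
  show "alg_act G V a u = 0"
  proof
    fix i
    have "matrix_coeff V u i \<in> coeffs V u" unfolding coeffs_def by (blast intro: fs.span_base)
    then have "(\<Sum>g\<in>carrier G. a g * matrix_coeff V u i g) = 0" using R by blast
    then show "alg_act G V a u i = 0 i"
      by (simp add: alg_act_def matrix_coeff_def sum_fun_apply smul_apply zero_fun_apply)
  qed
qed

text \<open>
  Summation over \<open>G\<close>, as a functional on functions, maps \<open>1\<close> to \<open>|G|\<close>, which is nonzero in
  characteristic \<open>0\<close>.
\<close>

lemma sum_act_nonzero: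
  fixes V :: "('a, 'k::field_char_0) kgmod"
  assumes "unit_fun (carrier G) \<in> coeffs V u" shows "alg_act G V (\<lambda>_. 1) u \<noteq> 0"
proof
  assume "alg_act G V (\<lambda>_. 1) u = 0"
  then have "(\<Sum>g\<in>carrier G. 1 * unit_fun (carrier G) g) = (0 :: 'k)"
    using assms unfolding alg_act_zero_iff by blast
  then have "of_nat (card (carrier G)) = (0 :: 'k)" by (simp add: unit_fun_def)
  then show False using finite_carrier by auto
qed


section \<open>Multiplication of glider classes\<close>

lemma glider_classes_mult:
  assumes M: "is_glider G M" and N: "is_glider G N"
  shows "glider_class G M \<otimes>\<^bsub>glider_classes G\<^esub> glider_class G N = glider_class G (glider_tensor M N)"
proof -
  have "(\<exists>M'\<in>glider_class G M. \<exists>N'\<in>glider_class G N. glider_iso G L (glider_tensor M' N'))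
      \<longleftrightarrow> glider_iso G (glider_tensor M N) L" for L
  proof
    assume "\<exists>M'\<in>glider_class G M. \<exists>N'\<in>glider_class G N. glider_iso G L (glider_tensor M' N')"
    then obtain M' N' where M': "is_glider G M'" "glider_iso G M M'" and N': "is_glider G N'" "glider_iso G N N'"
      and L: "glider_iso G L (glider_tensor M' N')" by (auto simp: glider_class_def)
    have "glider_iso G (glider_tensor M N) (glider_tensor M' N')"
      by (rule glider_iso_tensor[OF M M'(1) N N'(1) M'(2) N'(2)])
    then show "glider_iso G (glider_tensor M N) L" by (rule glider_iso_trans[OF _ glider_iso_sym[OF L]])
  next
    assume "glider_iso G (glider_tensor M N) L"
    moreover have "M \<in> glider_class G M" "N \<in> glider_class G N"
      using M N by (simp_all add: glider_class_def glider_iso_refl)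
    ultimately show "\<exists>M'\<in>glider_class G M. \<exists>N'\<in>glider_class G N. glider_iso G L (glider_tensor M' N')"
      by (blast intro: glider_iso_sym)
  qed
  then show ?thesis by (auto simp: glider_classes_def glider_class_def)
qed

lemma glider_class_carrier: "is_glider G M \<Longrightarrow> glider_class G M \<in> carrier (glider_classes G)"
  by (auto simp: glider_classes_def)

lemma glider_class_cases:
  assumes "C \<in> carrier (glider_classes G)" obtains M where "is_glider G M" "C = glider_class G M"
  using assms by (auto simp: glider_classes_def)

lemma glider_class_ring: "nonassoc_ring (monoid_ring (glider_classes G :: ('a, 'k::field) glider set monoid))"
proof (rule nonassoc_ring_monoid_ring)
  fix C D :: "('a, 'k) glider set"
  assume "C \<in> carrier (glider_classes G)" "D \<in> carrier (glider_classes G)"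
  then obtain M N where "is_glider G M" "C = glider_class G M" "is_glider G N" "D = glider_class G N"
    using glider_class_cases by metis
  then show "C \<otimes>\<^bsub>glider_classes G\<^esub> D \<in> carrier (glider_classes G)"
    by (simp add: glider_classes_mult is_glider_tensor glider_class_carrier)
qed

abbreviation fc :: "('a, 'k::field) glider \<Rightarrow> ('a, 'k) glider set \<Rightarrow>\<^sub>0 int" where
  "fc M \<equiv> frag_of (glider_class G M)"

lemma fc_mult:
  "\<lbrakk>is_glider G M; is_glider G N\<rbrakk> \<Longrightarrow> fc M \<otimes>\<^bsub>monoid_ring (glider_classes G)\<^esub> fc N = fc (glider_tensor M N)"
  by (simp add: glider_classes_mult)

lemma fc_eqI: "\<lbrakk>is_glider G M; is_glider G N; glider_iso G M N\<rbrakk> \<Longrightarrow> fc M = fc N"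
  using glider_class_eq_iff by metis

text \<open>
  Multiplication from the right by a glider maps the relation for \<open>M\<close> and \<open>N\<close> to the relation for the
  two products, by distributivity. For multiplication from the left, commutativity reduces to this
  case.
\<close>

lemma split_relations_ideal:
  "nonassoc_ideal (split_relations G) (monoid_ring (glider_classes G :: ('a, 'k::field) glider set monoid))"
  unfolding split_relations_def
proof (rule nonassoc_idealI[OF glider_class_ring])
  let ?R = "monoid_ring (glider_classes G :: ('a, 'k) glider set monoid)"
  let ?S = "{fc (glider_dsum M N) - fc M - fc N | M N :: ('a, 'k) glider. is_glider G M \<and> is_glider G N}"
  show "frag_of ` carrier (glider_classes G) \<subseteq> carrier ?R" by auto
  show "carrier ?R = add_span ?R (frag_of ` carrier (glider_classes G))"
    by (rule carrier_monoid_ring_generated[OF glider_class_ring])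
  show "?S \<subseteq> carrier ?R"
  proof
    fix c assume "c \<in> ?S"
    then obtain M N :: "('a, 'k) glider" where
      MN: "c = fc (glider_dsum M N) - fc M - fc N" "is_glider G M" "is_glider G N" by blast
    have "Poly_Mapping.keys c \<subseteq> {glider_class G (glider_dsum M N), glider_class G M, glider_class G N}"
      unfolding MN(1) by (rule order_trans[OF keys_diff] Un_least)+ (auto intro: order_trans[OF keys_diff])
    then show "c \<in> carrier ?R" using MN by (auto simp: glider_class_carrier is_glider_dsum)
  qed
  fix s t assume "s \<in> ?S" "t \<in> frag_of ` carrier (glider_classes G :: ('a, 'k) glider set monoid)"
  then obtain M N L :: "('a, 'k) glider" where s: "s = fc (glider_dsum M N) - fc M - fc N" and t: "t = fc L"
    and MN: "is_glider G M" "is_glider G N" and L: "is_glider G L"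
    by (auto elim!: glider_class_cases)
  note MxL = is_glider_tensor[OF MN(1) L] and NxL = is_glider_tensor[OF MN(2) L] and S = is_glider_dsum[OF MN]
  have distrib: "fc (glider_tensor (glider_dsum M N) L) = fc (glider_dsum (glider_tensor M L) (glider_tensor N L))"
    by (rule fc_eqI[OF is_glider_tensor[OF S L] is_glider_dsum[OF MxL NxL] glider_tensor_distrib[OF MN L]])
  have st: "s \<otimes>\<^bsub>?R\<^esub> t = fc (glider_tensor (glider_dsum M N) L) - fc (glider_tensor M L) - fc (glider_tensor N L)"
    using MN L S by (simp add: s t monoid_ring_mult frag_extend_diff glider_classes_mult)
  also have "\<dots> \<in> add_span ?R ?S"
    unfolding distrib by (rule generate.incl) (use MxL NxL in blast)
  finally show "s \<otimes>\<^bsub>?R\<^esub> t \<in> add_span ?R ?S" .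
  have comm: "fc (glider_tensor L P) = fc (glider_tensor P L)" if "is_glider G P" for P :: "('a, 'k) glider"
    by (rule fc_eqI[OF is_glider_tensor[OF L that] is_glider_tensor[OF that L] glider_tensor_commute[OF L that]])
  have "t \<otimes>\<^bsub>?R\<^esub> s = fc (glider_tensor L (glider_dsum M N)) - fc (glider_tensor L M) - fc (glider_tensor L N)"
    using MN L S by (simp add: s t monoid_ring_mult frag_extend_diff glider_classes_mult)
  also have "\<dots> = s \<otimes>\<^bsub>?R\<^esub> t" unfolding st comm[OF MN(1)] comm[OF MN(2)] comm[OF S] ..
  finally show "t \<otimes>\<^bsub>?R\<^esub> s \<in> add_span ?R ?S" using \<open>s \<otimes>\<^bsub>?R\<^esub> t \<in> add_span ?R ?S\<close> by simp
qed

lemma fc_carrier: "is_glider G M \<Longrightarrow> fc M \<in> carrier (monoid_ring (glider_classes G))"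
  by (simp add: glider_class_carrier)

lemma split_ring_nonassoc: "nonassoc_ring (split_ring G :: (('a, 'k::field) glider set \<Rightarrow>\<^sub>0 int) set ring)"
  unfolding split_ring_def by (rule nonassoc_ideal.quotient_nonassoc_ring[OF split_relations_ideal])

lemma split_class_carrier: "is_glider G M \<Longrightarrow> split_class G M \<in> carrier (split_ring G)"
  unfolding split_ring_def split_class_def
  by (rule nonassoc_ideal.coset_closed[OF split_relations_ideal fc_carrier])

lemma split_class_mult:
  assumes "is_glider G M" "is_glider G N"
  shows "split_class G M \<otimes>\<^bsub>split_ring G\<^esub> split_class G N = split_class G (glider_tensor M N)"
  unfolding split_ring_def split_class_def
  using nonassoc_ideal.coset_mult[OF split_relations_ideal fc_carrier fc_carrier] fc_mult assms by metis

lemma split_class_dsum: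
  fixes M N :: "('a, 'k::field) glider"
  assumes M: "is_glider G M" and N: "is_glider G N"
  shows "split_class G (glider_dsum M N) = split_class G M \<oplus>\<^bsub>split_ring G\<^esub> split_class G N"
proof -
  let ?R = "monoid_ring (glider_classes G :: ('a, 'k) glider set monoid)"
  interpret I: nonassoc_ideal "split_relations G" ?R by (rule split_relations_ideal)
  have c: "fc M \<oplus>\<^bsub>?R\<^esub> fc N \<in> carrier ?R" by (rule I.add.m_closed[OF fc_carrier[OF M] fc_carrier[OF N]])
  have "fc (glider_dsum M N) - fc M - fc N \<in> split_relations G"
    unfolding split_relations_def by (rule generate.incl) (use M N in blast)
  then have "fc (glider_dsum M N) \<ominus>\<^bsub>?R\<^esub> (fc M \<oplus>\<^bsub>?R\<^esub> fc N) \<in> split_relations G"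
    using c by (simp add: diff_diff_eq)
  then show ?thesis
    unfolding split_class_def split_ring_def
    using I.coset_eq_iff[OF fc_carrier[OF is_glider_dsum[OF M N]] c]
      I.coset_add[OF fc_carrier[OF M] fc_carrier[OF N]] by simp
qed

lemma split_ring_generated:
  "carrier (split_ring G :: (('a, 'k::field) glider set \<Rightarrow>\<^sub>0 int) set ring) =
     add_span (split_ring G) {split_class G M | M. is_glider G M}"
proof -
  let ?R = "monoid_ring (glider_classes G :: ('a, 'k) glider set monoid)"
  interpret I: nonassoc_ideal "split_relations G" ?R by (rule split_relations_ideal)
  have classes: "(+>\<^bsub>?R\<^esub>) (split_relations G) ` frag_of ` carrier (glider_classes G) =
      {split_class G M | M :: ('a, 'k) glider. is_glider G M}"
    by (auto simp: split_class_def glider_classes_def)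
  have "frag_of ` carrier (glider_classes G) \<subseteq> carrier ?R" by auto
  from I.quotient_generated[OF this carrier_monoid_ring_generated[OF glider_class_ring]]
  show ?thesis unfolding classes split_ring_def .
qed

lemma tspan_zero: "tspan {0} S = {0 :: 'k::field vec}"
proof -
  have "tensor_vec 0 y = (0 :: 'k vec)" for y by (rule vec_eq_pairsI) (simp add: zero_fun_apply)
  then have "tspan {0} S \<subseteq> {0 :: 'k vec}" by (intro tspan_minimal) auto
  then show ?thesis using vs.subspace_0[OF subspace_tspan] by blast
qed

lemma length0_ideal_ideal:
  "nonassoc_ideal (length0_ideal G) (split_ring G :: (('a, 'k::field) glider set \<Rightarrow>\<^sub>0 int) set ring)"
  unfolding length0_ideal_def
proof (rule nonassoc_idealI[OF split_ring_nonassoc])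
  let ?R = "split_ring G :: (('a, 'k) glider set \<Rightarrow>\<^sub>0 int) set ring"
  let ?S = "{split_class G M | M :: ('a, 'k) glider. is_glider G M \<and> low M = {0}}"
  let ?T = "{split_class G M | M :: ('a, 'k) glider. is_glider G M}"
  show "?S \<subseteq> carrier ?R" "?T \<subseteq> carrier ?R" using split_class_carrier by blast+
  show "carrier ?R = add_span ?R ?T" by (rule split_ring_generated)
  fix s t assume "s \<in> ?S" "t \<in> ?T"
  then obtain M N :: "('a, 'k) glider" where M: "s = split_class G M" "is_glider G M" "low M = {0}"
    and N: "t = split_class G N" "is_glider G N" by blast
  have 0: "low (glider_tensor M N) = {0}" using M(3) tspan_zero by simp
  have "low (glider_tensor N M) = {0}"
    using tspan_swap[of "{0}" "low N"] M(3) tspan_zero[of "low N"] by (auto simp: fun_eq_iff zero_fun_apply)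
  with 0 show "s \<otimes>\<^bsub>?R\<^esub> t \<in> add_span ?R ?S" "t \<otimes>\<^bsub>?R\<^esub> s \<in> add_span ?R ?S"
    unfolding M(1) N(1) split_class_mult[OF M(2) N(2)] split_class_mult[OF N(2) M(2)]
    by (blast intro: generate.incl is_glider_tensor[OF M(2) N(2)] is_glider_tensor[OF N(2) M(2)])+
qed

lemma red_split_ring_nonassoc:
  "nonassoc_ring (red_split_ring G :: (('a, 'k::field) glider set \<Rightarrow>\<^sub>0 int) set set ring)"
  unfolding red_split_ring_def by (rule nonassoc_ideal.quotient_nonassoc_ring[OF length0_ideal_ideal])

lemma red_class_carrier: "is_glider G M \<Longrightarrow> red_class G M \<in> carrier (red_split_ring G)"
  unfolding red_split_ring_def red_class_def
  by (rule nonassoc_ideal.coset_closed[OF length0_ideal_ideal split_class_carrier])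

lemma red_class_mult:
  assumes "is_glider G M" "is_glider G N"
  shows "red_class G M \<otimes>\<^bsub>red_split_ring G\<^esub> red_class G N = red_class G (glider_tensor M N)"
  unfolding red_split_ring_def red_class_def
  using nonassoc_ideal.coset_mult[OF length0_ideal_ideal split_class_carrier split_class_carrier]
    split_class_mult assms by metis

lemma red_class_iso:
  assumes "is_glider G M" "is_glider G N" "glider_iso G M N" shows "red_class G M = red_class G N"
proof -
  have "glider_class G M = glider_class G N" using assms by (simp add: glider_class_eq_iff)
  then show ?thesis by (simp add: red_class_def split_class_def)
qed

text \<open>
  The complement split off from \<open>M\<close> has length \<open>0\<close>, hence is zero in the quotient.
\<close>

lemma red_class_core:
  fixes M :: "('a, 'k::field) glider"
  assumes M: "is_glider G M" shows "red_class G M = red_class G (core M)"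
proof -
  interpret I: nonassoc_ideal "length0_ideal G" "split_ring G :: (('a, 'k) glider set \<Rightarrow>\<^sub>0 int) set ring"
    by (rule length0_ideal_ideal)
  obtain N where N: "is_glider G N" "low N = {0}" and iso: "glider_iso G (glider_dsum (core M) N) M"
    using glider_core_splits[OF M] by blast
  note core = is_glider_core[OF M]
  have "red_class G M = red_class G (glider_dsum (core M) N)"
    using red_class_iso[OF is_glider_dsum[OF core N(1)] M iso] by simp
  also have "\<dots> = red_class G (core M)"
  proof -
    have "split_class G N \<in> length0_ideal G"
      unfolding length0_ideal_def by (rule generate.incl) (use N in blast)
    then have "split_class G (core M) \<oplus>\<^bsub>split_ring G\<^esub> split_class G N \<in> length0_ideal G +>\<^bsub>split_ring G\<^esub> split_class G (core M)"
      unfolding a_r_coset_def'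
      using I.a_comm[OF split_class_carrier[OF core] split_class_carrier[OF N(1)]] by auto
    then show ?thesis
      unfolding red_class_def split_class_dsum[OF core N(1)]
      using I.a_repr_independence'[OF _ split_class_carrier[OF core]] by simp
  qed
  finally show ?thesis .
qed

end


section \<open>Tensor products of rings\<close>

lemma ring_nonassoc_ring: assumes "ring R" shows "nonassoc_ring R"
proof -
  interpret ring R by fact
  show ?thesis by unfold_locales (auto simp: l_distr r_distr)
qed

lemma monoid_ring_diff_mult:
  "(c - d) \<otimes>\<^bsub>monoid_ring A\<^esub> e = c \<otimes>\<^bsub>monoid_ring A\<^esub> e - d \<otimes>\<^bsub>monoid_ring A\<^esub> e"
  by (simp add: monoid_ring_mult frag_extend_diff)

lemma monoid_ring_mult_diff_frag:
  "frag_of x \<otimes>\<^bsub>monoid_ring A\<^esub> (c - d) = frag_of x \<otimes>\<^bsub>monoid_ring A\<^esub> c - frag_of x \<otimes>\<^bsub>monoid_ring A\<^esub> d"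
  by (simp add: monoid_ring_mult frag_extend_diff)

lemma keys_frag_diff3: "Poly_Mapping.keys (frag_of a - frag_of b - frag_of c) \<subseteq> {a, b, c}"
proof
  fix k assume "k \<in> Poly_Mapping.keys (frag_of a - frag_of b - frag_of c)"
  then show "k \<in> {a, b, c}" by (auto simp: in_keys_iff lookup_minus split: if_splits)
qed

lemma tensor_pairs_ring:
  assumes A: "nonassoc_ring A" and B: "nonassoc_ring B" shows "nonassoc_ring (monoid_ring (A \<times>\<times> B))"
  by (rule nonassoc_ring_monoid_ring)
     (auto simp: nonassoc_ring.mult_closed[OF A] nonassoc_ring.mult_closed[OF B])

lemma tensor_relations_ideal:
  fixes A :: "('a, 'm) ring_scheme" and B :: "('b, 'n) ring_scheme"
  assumes A: "nonassoc_ring A" and B: "nonassoc_ring B"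
  shows "nonassoc_ideal (tensor_relations A B) (monoid_ring (A \<times>\<times> B))"
  unfolding tensor_relations_def
proof (rule nonassoc_idealI[OF tensor_pairs_ring[OF A B]])
  interpret A: nonassoc_ring A by fact
  interpret B: nonassoc_ring B by fact
  let ?R = "monoid_ring (A \<times>\<times> B)"
  let ?S1 = "{frag_of (a \<oplus>\<^bsub>A\<^esub> a', b) - frag_of (a, b) - frag_of (a', b) | a a' b.
         a \<in> carrier A \<and> a' \<in> carrier A \<and> b \<in> carrier B}"
  let ?S2 = "{frag_of (a, b \<oplus>\<^bsub>B\<^esub> b') - frag_of (a, b) - frag_of (a, b') | a b b'.
         a \<in> carrier A \<and> b \<in> carrier B \<and> b' \<in> carrier B}"
  show "frag_of ` carrier (A \<times>\<times> B) \<subseteq> carrier ?R" by auto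
  show "carrier ?R = add_span ?R (frag_of ` carrier (A \<times>\<times> B))"
    by (rule carrier_monoid_ring_generated[OF tensor_pairs_ring[OF A B]])
  show "?S1 \<union> ?S2 \<subseteq> carrier ?R"
  proof
    fix s assume "s \<in> ?S1 \<union> ?S2"
    then obtain x y z where "s = frag_of x - frag_of y - frag_of z"
      "x \<in> carrier (A \<times>\<times> B)" "y \<in> carrier (A \<times>\<times> B)" "z \<in> carrier (A \<times>\<times> B)"
      by auto
    then show "s \<in> carrier ?R" using keys_frag_diff3[of x y z] by (simp only: monoid_ring_simps) blast
  qed
  fix s t assume s: "s \<in> ?S1 \<union> ?S2" and "t \<in> frag_of ` carrier (A \<times>\<times> B)"
  then obtain c d where t: "t = frag_of (c, d)" "c \<in> carrier A" "d \<in> carrier B" by auto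
  from s have "s \<otimes>\<^bsub>?R\<^esub> t \<in> ?S1 \<union> ?S2 \<and> t \<otimes>\<^bsub>?R\<^esub> s \<in> ?S1 \<union> ?S2"
  proof
    assume "s \<in> ?S1"
    then obtain a a' b where s: "s = frag_of (a \<oplus>\<^bsub>A\<^esub> a', b) - frag_of (a, b) - frag_of (a', b)"
      and ab: "a \<in> carrier A" "a' \<in> carrier A" "b \<in> carrier B" by blast
    have "s \<otimes>\<^bsub>?R\<^esub> t = frag_of (a \<otimes>\<^bsub>A\<^esub> c \<oplus>\<^bsub>A\<^esub> a' \<otimes>\<^bsub>A\<^esub> c, b \<otimes>\<^bsub>B\<^esub> d)
        - frag_of (a \<otimes>\<^bsub>A\<^esub> c, b \<otimes>\<^bsub>B\<^esub> d) - frag_of (a' \<otimes>\<^bsub>A\<^esub> c, b \<otimes>\<^bsub>B\<^esub> d)"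
      "t \<otimes>\<^bsub>?R\<^esub> s = frag_of (c \<otimes>\<^bsub>A\<^esub> a \<oplus>\<^bsub>A\<^esub> c \<otimes>\<^bsub>A\<^esub> a', d \<otimes>\<^bsub>B\<^esub> b)
        - frag_of (c \<otimes>\<^bsub>A\<^esub> a, d \<otimes>\<^bsub>B\<^esub> b) - frag_of (c \<otimes>\<^bsub>A\<^esub> a', d \<otimes>\<^bsub>B\<^esub> b)"
      unfolding s t(1) monoid_ring_diff_mult monoid_ring_mult_diff_frag
      using ab t by (simp_all add: A.mult_add_left A.mult_add_right)
    then have "s \<otimes>\<^bsub>?R\<^esub> t \<in> ?S1" "t \<otimes>\<^bsub>?R\<^esub> s \<in> ?S1"
      using ab t A.mult_closed B.mult_closed
      by (simp_all only: mem_Collect_eq) (intro exI conjI, rule refl, simp_all)+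
    then show ?thesis by (simp only: Un_iff simp_thms)
  next
    assume "s \<in> ?S2"
    then obtain a b b' where s: "s = frag_of (a, b \<oplus>\<^bsub>B\<^esub> b') - frag_of (a, b) - frag_of (a, b')"
      and ab: "a \<in> carrier A" "b \<in> carrier B" "b' \<in> carrier B" by blast
    have "s \<otimes>\<^bsub>?R\<^esub> t = frag_of (a \<otimes>\<^bsub>A\<^esub> c, b \<otimes>\<^bsub>B\<^esub> d \<oplus>\<^bsub>B\<^esub> b' \<otimes>\<^bsub>B\<^esub> d)
        - frag_of (a \<otimes>\<^bsub>A\<^esub> c, b \<otimes>\<^bsub>B\<^esub> d) - frag_of (a \<otimes>\<^bsub>A\<^esub> c, b' \<otimes>\<^bsub>B\<^esub> d)"
      "t \<otimes>\<^bsub>?R\<^esub> s = frag_of (c \<otimes>\<^bsub>A\<^esub> a, d \<otimes>\<^bsub>B\<^esub> b \<oplus>\<^bsub>B\<^esub> d \<otimes>\<^bsub>B\<^esub> b')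
        - frag_of (c \<otimes>\<^bsub>A\<^esub> a, d \<otimes>\<^bsub>B\<^esub> b) - frag_of (c \<otimes>\<^bsub>A\<^esub> a, d \<otimes>\<^bsub>B\<^esub> b')"
      unfolding s t(1) monoid_ring_diff_mult monoid_ring_mult_diff_frag
      using ab t by (simp_all add: B.mult_add_left B.mult_add_right)
    then have "s \<otimes>\<^bsub>?R\<^esub> t \<in> ?S2" "t \<otimes>\<^bsub>?R\<^esub> s \<in> ?S2"
      using ab t A.mult_closed B.mult_closed
      by (simp_all only: mem_Collect_eq) (intro exI conjI, rule refl, simp_all)+
    then show ?thesis by (simp only: Un_iff simp_thms)
  qed
  then show "s \<otimes>\<^bsub>?R\<^esub> t \<in> add_span ?R (?S1 \<union> ?S2)" "t \<otimes>\<^bsub>?R\<^esub> s \<in> add_span ?R (?S1 \<union> ?S2)"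
    by (meson generate.incl)+
qed

lemma pure_tensor_mult:
  assumes A: "nonassoc_ring A" and B: "nonassoc_ring B"
    and "a \<in> carrier A" "a' \<in> carrier A" "b \<in> carrier B" "b' \<in> carrier B"
  shows "pure_tensor A B a b \<otimes>\<^bsub>tensor_ring A B\<^esub> pure_tensor A B a' b' = pure_tensor A B (a \<otimes>\<^bsub>A\<^esub> a') (b \<otimes>\<^bsub>B\<^esub> b')"
  using nonassoc_ideal.coset_mult[OF tensor_relations_ideal[OF A B], of "frag_of (a, b)" "frag_of (a', b')"] assms
  by (simp add: pure_tensor_def tensor_ring_def)

lemma tensor_ring_nonassoc:
  assumes "nonassoc_ring A" "nonassoc_ring B" shows "nonassoc_ring (tensor_ring A B)"
  unfolding tensor_ring_def
  by (rule nonassoc_ideal.quotient_nonassoc_ring[OF tensor_relations_ideal[OF assms]])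

lemma rat_ring_simps [simp]:
  "carrier rat_ring = UNIV" "a \<otimes>\<^bsub>rat_ring\<^esub> b = a * b" "a \<oplus>\<^bsub>rat_ring\<^esub> b = a + b" "\<one>\<^bsub>rat_ring\<^esub> = 1"
  by (simp_all add: ring_of_type_algebra_def)

lemma rat_ring_nonassoc: "nonassoc_ring rat_ring"
  by (rule ring_nonassoc_ring) (rule ring_from_type_algebra)

text \<open>
  The function \<open>q \<otimes> b \<mapsto> q \<rho>(b)\<close> is well defined on the tensor product and takes the value \<open>\<rho>(b)\<close>
  on \<open>1 \<otimes> b\<close>.
\<close>

lemma pure_tensor_eqD:
  fixes B :: "('b, 'n) ring_scheme"
  assumes B: "nonassoc_ring B" and \<rho>: "additive_on B \<rho>"
    and b: "b \<in> carrier B" "b' \<in> carrier B" and eq: "pure_tensor rat_ring B 1 b = pure_tensor rat_ring B 1 b'"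
  shows "\<rho> b = \<rho> b'"
proof -
  let ?R = "monoid_ring (rat_ring \<times>\<times> B)"
  let ?S = "{frag_of (a \<oplus>\<^bsub>rat_ring\<^esub> a', b) - frag_of (a, b) - frag_of (a', b) | a a' b.
         a \<in> carrier rat_ring \<and> a' \<in> carrier rat_ring \<and> b \<in> carrier B} \<union>
      {frag_of (a, b \<oplus>\<^bsub>B\<^esub> b') - frag_of (a, b) - frag_of (a, b') | a b b'.
         a \<in> carrier rat_ring \<and> b \<in> carrier B \<and> b' \<in> carrier B}"
  define f where "f = (\<lambda>(q, b). q * \<rho> b)"
  interpret I: nonassoc_ideal "tensor_relations rat_ring B" ?R
    by (rule tensor_relations_ideal[OF rat_ring_nonassoc B])
  have add: "additive_on ?R (frag_eval f)" by (rule additive_on_frag_eval)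
  have "frag_eval f j = 0" if "j \<in> tensor_relations rat_ring B" for j
  proof (rule I.additive_on_add_span_zero[OF add _ _ that[unfolded tensor_relations_def]])
    fix s assume "s \<in> ?S"
    then consider a a' b where "s = frag_of (a + a', b) - frag_of (a, b) - frag_of (a', b)"
      | a b b' where "s = frag_of (a, b \<oplus>\<^bsub>B\<^esub> b') - frag_of (a, b) - frag_of (a, b')"
          "b \<in> carrier B" "b' \<in> carrier B"
      by auto
    then show "frag_eval f s = 0"
      by cases (use \<rho> in \<open>simp_all add: frag_eval_diff f_def additive_on_def distrib_left distrib_right\<close>)
  next
    show "?S \<subseteq> carrier ?R"
      by (rule subset_trans[OF _ I.a_subset[unfolded tensor_relations_def]]) (rule subsetI, rule generate.incl)
  qed
  note val = I.quot_fun_coset[OF add this]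
  have "quot_fun (frag_eval f) (pure_tensor rat_ring B 1 b) = \<rho> b" if "b \<in> carrier B" for b
    unfolding pure_tensor_def using val[of "frag_of (1, b)"] that by (simp add: f_def)
  from this[OF b(1)] this[OF b(2)] show ?thesis unfolding eq by simp
qed

context finite_group
begin

section \<open>The ring of irreducible gliders\<close>

lemma trivial_mod_module: "kg_module G trivial_mod"
  by (auto simp: kg_module_def trivial_mod_def linear_on_def)

lemma vecs_trivial_mod: "vecs trivial_mod = vs.span {unit_vec 0}"
  by (simp add: vecs_fsv fsv_span trivial_mod_def)

lemma glider_unit_simps:
  "amb glider_unit = trivial_mod" "low glider_unit = vs.span {unit_vec 0}" "high glider_unit = vs.span {unit_vec 0}"
  by (simp_all add: glider_unit_def vecs_trivial_mod)

lemma is_glider_unit: "is_glider G (glider_unit :: ('a, 'k::field) glider)"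
proof (rule is_gliderI)
  show "finite_dim (low (glider_unit :: ('a, 'k) glider))" "finite_dim (high (glider_unit :: ('a, 'k) glider))"
    unfolding glider_unit_simps finite_dim_def by blast+
qed (auto simp: glider_unit_simps trivial_mod_module vecs_trivial_mod, simp add: trivial_mod_def)

lemma coeffs_unit: "coeffs trivial_mod (unit_vec 0) = fs.span {unit_fun (carrier G) :: 'a \<Rightarrow> 'k::field}"
proof -
  have mc: "matrix_coeff trivial_mod (unit_vec 0) i = (if i = 0 then unit_fun (carrier G) else (0 :: 'a \<Rightarrow> 'k))" for i
    by (auto simp: matrix_coeff_def trivial_mod_def unit_vec_def unit_fun_def zero_fun_apply fun_eq_iff)
  have "range (matrix_coeff trivial_mod (unit_vec 0)) = insert 0 {unit_fun (carrier G) :: 'a \<Rightarrow> 'k}"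
    unfolding mc by auto
  then show ?thesis unfolding coeffs_def by simp
qed

lemma rep_ring_simps [simp]:
  "x \<otimes>\<^bsub>rep_ring G\<^esub> y = x \<otimes>\<^bsub>red_split_ring G\<^esub> y" "x \<oplus>\<^bsub>rep_ring G\<^esub> y = x \<oplus>\<^bsub>red_split_ring G\<^esub> y"
  by (simp_all add: rep_ring_def)

lemma one_red_split_ring: "\<one>\<^bsub>red_split_ring G\<^esub> = red_class G glider_unit"
  by (simp add: red_split_ring_def red_class_def split_class_def split_ring_def FactRing_def
      glider_classes_def)

lemma one_rep_ring: "\<one>\<^bsub>rep_ring G\<^esub> = red_class G glider_unit"
  by (simp add: rep_ring_def one_red_split_ring)

lemma red_class_subset:
  "{red_class G M | M :: ('a, 'k::field) glider. irreducible_glider1 G M} \<subseteq> carrier (red_split_ring G)"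
  using red_class_carrier by (auto simp: irreducible_glider1_def)

lemma rep_ring_nonassoc:
  "nonassoc_ring (rep_ring G :: (('a, 'k::field) glider set \<Rightarrow>\<^sub>0 int) set set ring)"
  unfolding rep_ring_def
  by (rule nonassoc_ring.nonassoc_ring_generate_ring[OF red_split_ring_nonassoc red_class_subset])
     (simp add: one_red_split_ring red_class_carrier[OF is_glider_unit])

lemma rep_ring_subset:
  "carrier (rep_ring G :: (('a, 'k::field) glider set \<Rightarrow>\<^sub>0 int) set set ring) \<subseteq> carrier (red_split_ring G)"
  using nonassoc_ring.generate_ring_closed[OF red_split_ring_nonassoc red_class_subset]
    red_class_carrier[OF is_glider_unit] by (simp add: rep_ring_def one_red_split_ring)

definition rep_glider :: "('a, 'k::field) glider \<Rightarrow> bool" where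
  "rep_glider M \<longleftrightarrow> is_glider G M \<and> red_class G M \<in> carrier (rep_ring G)"

lemma dim_singleton: assumes "u \<noteq> 0" shows "vs.dim {u} = 1"
  using vs.dim_eq_card_independent[of "{u}"] assms by simp

lemma dim_zero: "vs.dim {0 :: 'k::field vec} = 0"
  using vs.dim_span[of "{} :: 'k vec set"] vs.dim_eq_card_independent[of "{} :: 'k vec set"]
    vs.independent_empty by simp

text \<open>
  The core of a glider with one-dimensional \<open>M\<^sub>-\<^sub>1\<close> is irreducible, and it has the same class.
\<close>

lemma rep_glider_cyclic:
  assumes M: "is_glider G M" and u: "low M = vs.span {u}" "u \<noteq> 0" shows "rep_glider M"
proof -
  have "irreducible_glider1 G (core M)"
    using is_glider_core[OF M] u by (simp add: irreducible_glider1_def dim_singleton)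
  then have "red_class G (core M) \<in> carrier (rep_ring G)"
    unfolding rep_ring_def by (auto intro!: generate_ring.incl)
  then show ?thesis using M red_class_core[OF M] by (simp add: rep_glider_def)
qed

lemma Q_glider_nonassoc: "nonassoc_ring (Q_glider G :: ('a, 'k::field) qelem ring)"
  unfolding Q_glider_def by (rule tensor_ring_nonassoc[OF rat_ring_nonassoc rep_ring_nonassoc])

lemma Q_class_mult:
  assumes "rep_glider M" "rep_glider N"
  shows "Q_class G M \<otimes>\<^bsub>Q_glider G\<^esub> Q_class G N = Q_class G (glider_tensor M N)"
  using pure_tensor_mult[OF rat_ring_nonassoc rep_ring_nonassoc, of 1 1 "red_class G M" "red_class G N"] assms
  by (simp add: Q_class_def Q_glider_def rep_glider_def red_class_mult)

lemma one_Q_glider: "\<one>\<^bsub>Q_glider G\<^esub> = Q_class G glider_unit"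
  by (simp add: Q_glider_def Q_class_def tensor_ring_def pure_tensor_def FactRing_def one_rep_ring)

lemma Q_span_empty: "Q_span G {} = {\<zero>\<^bsub>Q_glider G\<^esub> :: ('a, 'k::field) qelem}"
proof -
  interpret Q: nonassoc_ring "Q_glider G :: ('a, 'k) qelem ring" by (rule Q_glider_nonassoc)
  have "additive_subgroup {\<zero>\<^bsub>Q_glider G\<^esub>} (Q_glider G :: ('a, 'k) qelem ring)"
    using Q.add.triv_subgroup by (simp add: additive_subgroup.intro)
  then have "add_span (Q_glider G) {} \<subseteq> {\<zero>\<^bsub>Q_glider G\<^esub> :: ('a, 'k) qelem}"
    by (rule Q.add_span_minimal) simp
  moreover have "\<zero>\<^bsub>Q_glider G\<^esub> \<in> add_span (Q_glider G) ({} :: ('a, 'k) qelem set)"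
    using generate.one[of "add_monoid (Q_glider G :: ('a, 'k) qelem ring)" "{}"] by simp
  ultimately show ?thesis unfolding Q_span_def by auto
qed


section \<open>The rank of the averaging operator as an invariant\<close>

lemma dim_linear_image:
  fixes S :: "'k::field vec set"
  assumes f: "linear_on S f" "inj_on f S" and S: "vs.subspace S" shows "vs.dim (f ` S) = vs.dim S"
proof -
  obtain F where F: "linear_on UNIV F" "\<And>x. x \<in> S \<Longrightarrow> F x = f x"
    by (rule linear_on_extend[OF f(1) S]) (rule that)
  interpret p: vector_space_pair "smul :: 'k \<Rightarrow> 'k vec \<Rightarrow> 'k vec" "smul :: 'k \<Rightarrow> 'k vec \<Rightarrow> 'k vec"
    by unfold_locales
  have lin: "Vector_Spaces.linear smul smul F"
    using F(1) by (simp add: Vector_Spaces.linear_iff linear_on_def vs.vector_space_axioms)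
  obtain B where B: "B \<subseteq> S" "vs.independent B" "S \<subseteq> vs.span B" "card B = vs.dim S"
    using vs.basis_exists[of S] by blast
  have span: "vs.span B = S" using B S by (simp add: vs.span_subspace)
  have fF: "F ` S = f ` S" "inj_on F S" using F(2) f(2) by (auto simp: inj_on_def)
  have "vs.independent (F ` B)"
    using p.linear_independent_injective_image[OF lin B(2)] fF(2) span by simp
  moreover have "F ` S \<subseteq> vs.span (F ` B)"
    using linear_on_image_span[OF F(1) vs.subspace_UNIV, of B] span by simp
  moreover have "card (F ` B) = card B"
    using fF(2) B(1) by (intro card_image) (auto intro: inj_on_subset)
  ultimately show ?thesis
    using vs.basis_card_eq_dim[of "F ` B" "F ` S"] B(1,4) fF(1) by (metis image_mono)
qed

lemma dim_dpair:
  fixes S T :: "'k::field vec set"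
  assumes S: "vs.subspace S" "finite_dim S" and T: "vs.subspace T" "finite_dim T"
  shows "vs.dim (dpair S T) = vs.dim S + vs.dim T"
proof -
  have basis: "\<exists>B. finite B \<and> vs.independent B \<and> vs.span B = R \<and> card B = vs.dim R"
    if "vs.subspace R" "finite_dim R" for R :: "'k vec set"
  proof -
    obtain A where A: "finite A" "vs.span A = R" using \<open>finite_dim R\<close> unfolding finite_dim_def by blast
    obtain B where B: "B \<subseteq> R" "vs.independent B" "R \<subseteq> vs.span B" "card B = vs.dim R"
      using vs.basis_exists[of R] by blast
    have "finite B" using vs.independent_span_bound[OF A(1) B(2)] A(2) B(1) by blast
    then show ?thesis using B that(1) vs.span_subspace by blast
  qed
  obtain A where A: "finite A" "vs.independent A" "vs.span A = S" "card A = vs.dim S" using basis[OF S] by blast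
  obtain B where B: "finite B" "vs.independent B" "vs.span B = T" "card B = vs.dim T" using basis[OF T] by blast
  let ?A = "inject 0 ` A" and ?B = "inject 1 ` B"
  have inj: "inj_on (inject s) R" for s :: nat and R :: "'k vec set"
    by (rule inj_onI) (metis component_inject)
  have "vs.span (?A \<union> ?B) = {x + y | x y. x \<in> inject 0 ` S \<and> y \<in> inject 1 ` T}"
    unfolding vs.span_Un linear_on_image_span[OF inject_linear vs.subspace_UNIV subset_UNIV, symmetric] A(3) B(3) ..
  also have "\<dots> = dpair S T" unfolding dpair_def dsum_vec_split by blast
  finally have span: "vs.span (?A \<union> ?B) = dpair S T" .
  have comp: "component s (\<Sum>x\<in>inject t ` R. smul (f x) x) = (if s = t then \<Sum>x\<in>R. smul (f (inject t x)) x else 0)"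
    for s t f and R :: "'k vec set"
    by (simp add: sum.reindex[OF inj] component_sum component_smul component_inject)
  have disjoint: "?A \<inter> ?B = {}"
  proof -
    have "0 \<notin> A" using A(2) vs.dependent_zero by blast
    moreover have "a = 0" if "inject 0 a = inject 1 b" for a b :: "'k vec"
      using arg_cong[OF that, of "component 0"] by (simp add: component_inject)
    ultimately show ?thesis by blast
  qed
  have indep: "vs.independent (?A \<union> ?B)"
  proof (rule vs.independent_if_scalars_zero)
    show "finite (?A \<union> ?B)" using A(1) B(1) by blast
    fix f x assume 0: "(\<Sum>x\<in>?A \<union> ?B. smul (f x) x) = 0" and x: "x \<in> ?A \<union> ?B"
    have "(\<Sum>x\<in>?A. smul (f x) x) + (\<Sum>x\<in>?B. smul (f x) x) = (\<Sum>x\<in>?A \<union> ?B. smul (f x) x)"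
      by (rule sum.union_disjoint[symmetric, OF _ _ disjoint]) (use A(1) B(1) in simp_all)
    then have sum: "(\<Sum>x\<in>?A. smul (f x) x) + (\<Sum>x\<in>?B. smul (f x) x) = 0"
      unfolding 0 .
    have "(\<Sum>x\<in>A. smul (f (inject 0 x)) x) = 0"
      using arg_cong[OF sum, of "component 0"] by (simp add: component_add comp)
    then have a: "f (inject 0 x) = 0" if "x \<in> A" for x
      using vs.independentD[OF A(2,1) order_refl, of "\<lambda>x. f (inject 0 x)"] that by blast
    have "(\<Sum>x\<in>B. smul (f (inject 1 x)) x) = 0"
      using arg_cong[OF sum, of "component 1"] by (simp add: component_add comp)
    then have "f (inject 1 x) = 0" if "x \<in> B" for x
      using vs.independentD[OF B(2,1) order_refl, of "\<lambda>x. f (inject 1 x)"] that by blast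
    then show "f x = 0" using a x by blast
  qed
  have "vs.dim (dpair S T) = card (?A \<union> ?B)"
    using vs.dim_span_eq_card_independent[OF indep] unfolding span .
  also have "\<dots> = card A + card B"
    using card_Un_disjoint[OF _ _ disjoint] A(1) B(1) card_image[OF inj] by simp
  finally show ?thesis using A(4) B(4) by simp
qed

text \<open>
  The action of \<open>\<Sum>\<^sub>g g\<close>. It is not divided by \<open>|G|\<close>, so that it makes sense over every field; only
  its rank is used.
\<close>

definition average :: "('a, 'k::field) kgmod \<Rightarrow> 'k vec \<Rightarrow> 'k vec" where
  "average V = alg_act G V (\<lambda>_. 1)"

definition average_rank :: "('a, 'k::field) glider \<Rightarrow> rat" where
  "average_rank M = of_nat (vs.dim (average (amb M) ` low M))"

lemma average_linear: assumes "is_glider G M" shows "linear_on (low M) (average (amb M))"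
  unfolding average_def
  using linear_on_subset[OF alg_act_linear[OF is_gliderD(1)[OF assms]] is_gliderD(8)[OF assms]] .

lemma average_subspace: assumes "is_glider G M" shows "vs.subspace (average (amb M) ` low M)"
  by (rule subspace_linear_image[OF average_linear[OF assms] is_gliderD(2)[OF assms]])

lemma average_in_high:
  assumes M: "is_glider G M" and x: "x \<in> low M" shows "average (amb M) x \<in> high M"
  unfolding average_def
  by (rule alg_act_in_subspace[OF is_gliderD(4)[OF M]]) (rule glider_act[OF M _ x])

lemma average_finite_dim: assumes M: "is_glider G M" shows "finite_dim (average (amb M) ` low M)"
  using finite_dim_subspace[OF is_gliderD(5)[OF M] average_subspace[OF M]] average_in_high[OF M] by blast

lemma average_rank_iso:
  assumes M: "is_glider G M" and N: "is_glider G N" and iso: "glider_iso G M N"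
  shows "average_rank M = average_rank N"
proof -
  obtain f h where f: "glider_hom G M N f" and h: "glider_hom G N M h"
    and hf: "\<And>x. x \<in> high M \<Longrightarrow> h (f x) = x" and fh: "\<And>y. y \<in> high N \<Longrightarrow> f (h y) = y"
    using iso unfolding glider_iso_def by blast
  have "f ` low M = low N"
  proof
    show "f ` low M \<subseteq> low N" by (rule glider_homD(3)[OF f])
    show "low N \<subseteq> f ` low M"
    proof
      fix y assume y: "y \<in> low N"
      then have "y = f (h y)" using fh is_gliderD(6)[OF N] by auto
      then show "y \<in> f ` low M" using glider_homD(3)[OF h] y by blast
    qed
  qed
  moreover have "f (average (amb M) x) = average (amb N) (f x)" if "x \<in> low M" for x
    using f that unfolding glider_hom_def average_def by blast
  then have "f ` average (amb M) ` low M = average (amb N) ` f ` low M"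
    unfolding image_image by (rule image_cong[OF refl])
  ultimately have im: "f ` average (amb M) ` low M = average (amb N) ` low N" by (simp only:)
  have sub: "average (amb M) ` low M \<subseteq> high M" using average_in_high[OF M] by blast
  have "inj_on f (high M)" using hf by (metis inj_onI)
  then have "vs.dim (f ` average (amb M) ` low M) = vs.dim (average (amb M) ` low M)"
    by (intro dim_linear_image linear_on_subset[OF glider_homD(1)[OF f] sub] inj_on_subset[OF _ sub]
        average_subspace[OF M])
  then show ?thesis unfolding average_rank_def im by simp
qed

lemma average_rank_dsum:
  assumes M: "is_glider G M" and N: "is_glider G N"
  shows "average_rank (glider_dsum M N) = average_rank M + average_rank N"
proof -
  have av: "average (dsum_mod [amb M, amb N]) (dsum_vec [x, y]) = dsum_vec [average (amb M) x, average (amb N) y]" for x y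
    by (rule vec_eq_components2I)
       (simp_all add: average_def alg_act_def act_dsum2 component_sum component_smul)
  have "average (dsum_mod [amb M, amb N]) ` dpair (low M) (low N) = dpair (average (amb M) ` low M) (average (amb N) ` low N)"
  proof
    show "average (dsum_mod [amb M, amb N]) ` dpair (low M) (low N) \<subseteq> dpair (average (amb M) ` low M) (average (amb N) ` low N)"
    proof (rule image_subsetI)
      fix t assume "t \<in> dpair (low M) (low N)"
      then obtain x y where "t = dsum_vec [x, y]" "x \<in> low M" "y \<in> low N" unfolding dpair_def by blast
      then show "average (dsum_mod [amb M, amb N]) t \<in> dpair (average (amb M) ` low M) (average (amb N) ` low N)"
        by (simp add: av)
    qed
    show "dpair (average (amb M) ` low M) (average (amb N) ` low N) \<subseteq> average (dsum_mod [amb M, amb N]) ` dpair (low M) (low N)"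
    proof
      fix t assume "t \<in> dpair (average (amb M) ` low M) (average (amb N) ` low N)"
      then obtain x y where "t = average (dsum_mod [amb M, amb N]) (dsum_vec [x, y])" "x \<in> low M" "y \<in> low N"
        unfolding av dpair_def by blast
      then show "t \<in> average (dsum_mod [amb M, amb N]) ` dpair (low M) (low N)" by simp
    qed
  qed
  then show ?thesis
    using dim_dpair[OF average_subspace[OF M] average_finite_dim[OF M] average_subspace[OF N] average_finite_dim[OF N]]
    by (simp add: average_rank_def)
qed

definition class_rank :: "('a, 'k::field) glider set \<Rightarrow> rat" where
  "class_rank C = average_rank (SOME M. M \<in> C)"

lemma class_rank: assumes M: "is_glider G M" shows "class_rank (glider_class G M) = average_rank M"
proof -
  define N where "N = (SOME N. N \<in> glider_class G M)"
  have "M \<in> glider_class G M" using M by (simp add: glider_class_def glider_iso_refl)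
  then have "N \<in> glider_class G M" unfolding N_def by (rule someI)
  then have "is_glider G N" "glider_iso G M N" by (simp_all add: glider_class_def)
  then show ?thesis using average_rank_iso[OF M] by (simp add: class_rank_def N_def[symmetric])
qed

text \<open>
  The rank passes to the free abelian group on the isomorphism classes by linearity, to the split
  Grothendieck ring because it is additive on direct sums, and to the quotient because it vanishes for
  length \<open>0\<close>.
\<close>

lemma red_class_rank:
  obtains \<rho> where "additive_on (red_split_ring G :: (('a, 'k::field) glider set \<Rightarrow>\<^sub>0 int) set set ring) \<rho>"
    "\<And>M :: ('a, 'k) glider. is_glider G M \<Longrightarrow> \<rho> (red_class G M) = average_rank M"
proof -
  let ?R = "monoid_ring (glider_classes G :: ('a, 'k) glider set monoid)"
  let ?R' = "split_ring G :: (('a, 'k) glider set \<Rightarrow>\<^sub>0 int) set ring"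
  interpret I: nonassoc_ideal "split_relations G" ?R by (rule split_relations_ideal)
  interpret J: nonassoc_ideal "length0_ideal G" ?R' by (rule length0_ideal_ideal)
  define \<phi> where "\<phi> = frag_eval (class_rank :: ('a, 'k) glider set \<Rightarrow> rat)"
  have \<phi>: "additive_on ?R \<phi>" unfolding \<phi>_def by (rule additive_on_frag_eval)
  have \<phi>0: "\<phi> j = 0" if "j \<in> split_relations G" for j
  proof (rule I.additive_on_add_span_zero[OF \<phi> _ _ that[unfolded split_relations_def]])
    fix s assume "s \<in> {fc (glider_dsum M N) - fc M - fc N | M N :: ('a, 'k) glider. is_glider G M \<and> is_glider G N}"
    then show "\<phi> s = 0"
      by (auto simp: \<phi>_def frag_eval_diff class_rank is_glider_dsum average_rank_dsum)
  next
    show "{fc (glider_dsum M N) - fc M - fc N | M N :: ('a, 'k) glider. is_glider G M \<and> is_glider G N} \<subseteq> carrier ?R"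
      by (rule subset_trans[OF _ I.a_subset[unfolded split_relations_def]]) (rule subsetI, rule generate.incl)
  qed
  define \<psi> where "\<psi> = quot_fun \<phi>"
  have \<psi>: "additive_on ?R' \<psi>"
    unfolding \<psi>_def split_ring_def by (rule I.additive_on_quot_fun[OF \<phi> \<phi>0])
  have \<psi>M: "\<psi> (split_class G M) = average_rank M" if "is_glider G M" for M :: "('a, 'k) glider"
    unfolding \<psi>_def split_class_def
    using I.quot_fun_coset[OF \<phi> \<phi>0 fc_carrier[OF that]] class_rank[OF that] by (simp add: \<phi>_def)
  have \<psi>0: "\<psi> j = 0" if "j \<in> length0_ideal G" for j
  proof (rule J.additive_on_add_span_zero[OF \<psi> _ _ that[unfolded length0_ideal_def]])
    fix s assume "s \<in> {split_class G M | M :: ('a, 'k) glider. is_glider G M \<and> low M = {0}}"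
    then obtain M :: "('a, 'k) glider" where M: "s = split_class G M" "is_glider G M" "low M = {0}" by blast
    have "average (amb M) ` low M = {0}"
      using linear_on_zero[OF average_linear[OF M(2)] is_gliderD(2)[OF M(2)]] M(3) by simp
    then have "average_rank M = 0" by (simp add: average_rank_def dim_zero)
    then show "\<psi> s = 0" using \<psi>M M by simp
  next
    show "{split_class G M | M :: ('a, 'k) glider. is_glider G M \<and> low M = {0}} \<subseteq> carrier ?R'"
      using split_class_carrier by blast
  qed
  show ?thesis
  proof (rule that)
    show "additive_on (red_split_ring G) (quot_fun \<psi>)"
      unfolding red_split_ring_def by (rule J.additive_on_quot_fun[OF \<psi> \<psi>0])
    show "quot_fun \<psi> (red_class G M) = average_rank M" if "is_glider G M" for M :: "('a, 'k) glider"
      unfolding red_class_def using J.quot_fun_coset[OF \<psi> \<psi>0 split_class_carrier[OF that]] \<psi>M[OF that] by simp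
  qed
qed

lemma Q_class_eq_average_rank:
  fixes M N :: "('a, 'k::field) glider"
  assumes M: "rep_glider M" and N: "rep_glider N" and eq: "Q_class G M = Q_class G N"
  shows "average_rank M = average_rank N"
proof -
  obtain \<rho> where \<rho>: "additive_on (red_split_ring G :: (('a, 'k) glider set \<Rightarrow>\<^sub>0 int) set set ring) \<rho>"
    "\<And>M :: ('a, 'k) glider. is_glider G M \<Longrightarrow> \<rho> (red_class G M) = average_rank M"
    by (rule red_class_rank) (rule that)
  have "additive_on (rep_ring G) \<rho>"
    using \<rho>(1) rep_ring_subset unfolding additive_on_def rep_ring_simps by blast
  then have "\<rho> (red_class G M) = \<rho> (red_class G N)"
    using M N eq unfolding rep_glider_def Q_class_def by (intro pure_tensor_eqD[OF rep_ring_nonassoc]) auto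
  then show ?thesis using \<rho>(2) M N by (simp add: rep_glider_def)
qed


section \<open>Cyclic gliders and their powers\<close>

lemma alg_act_transfer:
  assumes "coeffs V u = coeffs W v"
  shows "alg_act G V a u = alg_act G V b u \<longleftrightarrow> alg_act G W a v = alg_act G W b v"
proof -
  have "alg_act G V a u = alg_act G V b u \<longleftrightarrow> alg_act G V (a - b) u = 0" by (simp add: alg_act_diff)
  also have "\<dots> \<longleftrightarrow> alg_act G W (a - b) v = 0" unfolding alg_act_zero_iff assms ..
  also have "\<dots> \<longleftrightarrow> alg_act G W a v = alg_act G W b v" by (simp add: alg_act_diff)
  finally show ?thesis .
qed

text \<open>
  The coefficient space determines the annihilator, and then \<open>a u \<mapsto> a v\<close> is an isomorphism between the
  gliders generated by \<open>u\<close> and \<open>v\<close>.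
\<close>

lemma red_class_coeffs:
  fixes M N :: "('a, 'k::field) glider"
  assumes M: "is_glider G M" "low M = vs.span {u}" and N: "is_glider G N" "low N = vs.span {v}"
    and eq: "coeffs (amb M) u = coeffs (amb N) v"
  shows "red_class G M = red_class G N"
proof -
  let ?V = "amb M" and ?W = "amb N"
  note MD = is_gliderD[OF M(1)] and ND = is_gliderD[OF N(1)]
  have u: "u \<in> vecs ?V" and v: "v \<in> vecs ?W"
    using M(2) N(2) MD(8) ND(8) vs.span_base[of u "{u}"] vs.span_base[of v "{v}"] by auto
  have high: "high (core M) = range (\<lambda>a. alg_act G ?V a u)" "high (core N) = range (\<lambda>a. alg_act G ?W a v)"
    using alg_span_cyclic[OF MD(1) u] alg_span_cyclic[OF ND(1) v] M(2) N(2) by simp_all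
  define f where "f x = alg_act G ?W (SOME a. alg_act G ?V a u = x) v" for x
  have f: "f (alg_act G ?V a u) = alg_act G ?W a v" for a
  proof -
    have "alg_act G ?V (SOME b. alg_act G ?V b u = alg_act G ?V a u) u = alg_act G ?V a u"
      by (rule someI[of _ a]) (rule refl)
    then show ?thesis unfolding f_def alg_act_transfer[OF eq] .
  qed
  have act: "act V g (smul c w) = alg_act G V (fsmul c (unit_fun {g})) w"
    if "kg_module G V" "g \<in> carrier G" "w \<in> vecs V" for V :: "('a, 'k) kgmod" and g c w
    using that by (simp add: alg_act_fsmul alg_act_unit_fun linear_on_smul[OF act_linear])
  have low: "smul c w = alg_act G V (fsmul c (unit_fun {\<one>})) w"
    if "kg_module G V" "w \<in> vecs V" for V :: "('a, 'k) kgmod" and c w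
    using that by (simp add: alg_act_fsmul alg_act_unit_fun act_one)
  have fu: "f (smul c u) = smul c v" for c
    using f[of "fsmul c (unit_fun {\<one>})"] low[OF MD(1) u, of c] low[OF ND(1) v, of c] by simp
  have "glider_iso G (core M) (core N)"
  proof (rule glider_isoI[OF is_glider_core[OF M(1)] is_glider_core[OF N(1)]])
    show "linear_on (high (core M)) f"
      unfolding linear_on_def high by (auto simp: f alg_act_add[symmetric] alg_act_fsmul[symmetric])
    have "inj_on f (range (\<lambda>a. alg_act G ?V a u))"
    proof (rule inj_onI)
      fix x y assume "x \<in> range (\<lambda>a. alg_act G ?V a u)" "y \<in> range (\<lambda>a. alg_act G ?V a u)" "f x = f y"
      then obtain a b where "x = alg_act G ?V a u" "y = alg_act G ?V b u" "f x = f y" by blast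
      then show "x = y" using alg_act_transfer[OF eq, of a b] by (simp add: f)
    qed
    then show "bij_betw f (high (core M)) (high (core N))"
      unfolding bij_betw_def high image_image f by simp
    show "f ` low (core M) = low (core N)"
      by (simp add: M(2) N(2) vs.span_singleton image_image fu)
    fix g m assume g: "g \<in> carrier G" and "m \<in> low (core M)"
    then obtain c where "m = smul c u" using M(2) by (auto simp: vs.span_singleton)
    then show "f (act (amb (core M)) g m) = act (amb (core N)) g (f m)"
      by (simp add: act[OF MD(1) g u] act[OF ND(1) g v] fu f)
  qed
  then show ?thesis
    using red_class_core[OF M(1)] red_class_core[OF N(1)]
      red_class_iso[OF is_glider_core[OF M(1)] is_glider_core[OF N(1)]] by simp
qed

definition cyclic_with_coeffs :: "('a, 'k::field) glider \<Rightarrow> ('a \<Rightarrow> 'k) set \<Rightarrow> bool" where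
  "cyclic_with_coeffs M C \<longleftrightarrow>
     is_glider G M \<and> (\<exists>u. low M = vs.span {u} \<and> u \<noteq> 0 \<and> coeffs (amb M) u = C)"

lemma cyclic_with_coeffsE:
  assumes "cyclic_with_coeffs M C"
  obtains u where "is_glider G M" "low M = vs.span {u}" "u \<noteq> 0" "u \<in> vecs (amb M)" "kg_module G (amb M)"
    "C = coeffs (amb M) u"
proof -
  obtain u where u: "is_glider G M" "low M = vs.span {u}" "u \<noteq> 0" "C = coeffs (amb M) u"
    using assms unfolding cyclic_with_coeffs_def by blast
  then have "u \<in> vecs (amb M)" using is_gliderD(8)[OF u(1)] vs.span_base[of u "{u}"] by auto
  then show ?thesis using that u is_gliderD(1)[OF u(1)] by blast
qed

lemma cyclic_rep_glider: "cyclic_with_coeffs M C \<Longrightarrow> rep_glider M"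
  by (elim cyclic_with_coeffsE) (rule rep_glider_cyclic)

lemma cyclic_tensor:
  assumes "cyclic_with_coeffs M C" "cyclic_with_coeffs N D"
  shows "cyclic_with_coeffs (glider_tensor M N) (fprod C D)"
proof -
  obtain u where u: "is_glider G M" "low M = vs.span {u}" "u \<noteq> 0" "u \<in> vecs (amb M)" "kg_module G (amb M)"
    "C = coeffs (amb M) u" using assms(1) by (rule cyclic_with_coeffsE)
  obtain v where v: "is_glider G N" "low N = vs.span {v}" "v \<noteq> 0" "v \<in> vecs (amb N)" "kg_module G (amb N)"
    "D = coeffs (amb N) v" using assms(2) by (rule cyclic_with_coeffsE)
  show ?thesis
    unfolding cyclic_with_coeffs_def
    by (intro conjI is_glider_tensor u v exI[of _ "tensor_vec u v"])
       (simp_all add: u(2,6) v(2,6) tspan_singleton tensor_vec_nonzero[OF u(3) v(3)]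
         coeffs_tensor[OF u(5) v(5) u(4) v(4)])
qed

lemma unit_vec_nonzero: "unit_vec i \<noteq> (0 :: 'k::field vec)"
  by (metis unit_vec_def zero_fun_apply zero_neq_one)

lemma cyclic_unit: "cyclic_with_coeffs (glider_unit :: ('a, 'k::field) glider) (fs.span {unit_fun (carrier G)})"
  unfolding cyclic_with_coeffs_def
  by (intro conjI is_glider_unit exI[of _ "unit_vec 0"]) (simp_all add: glider_unit_simps coeffs_unit unit_vec_nonzero)

lemma Q_class_cyclic:
  assumes "cyclic_with_coeffs M C" "cyclic_with_coeffs N C" shows "Q_class G M = Q_class G N"
proof -
  obtain u where "is_glider G M" "low M = vs.span {u}" "C = coeffs (amb M) u"
    using assms(1) by (rule cyclic_with_coeffsE)
  moreover obtain v where "is_glider G N" "low N = vs.span {v}" "C = coeffs (amb N) v"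
    using assms(2) by (rule cyclic_with_coeffsE)
  ultimately show ?thesis unfolding Q_class_def using red_class_coeffs[of M u N v] by simp
qed

lemma average_rank_cyclic:
  assumes M: "is_glider G M" "low M = vs.span {u}"
  shows "average_rank M = (if average (amb M) u = 0 then 0 else 1)"
proof -
  have u: "{u} \<subseteq> low M" using M(2) vs.span_superset[of "{u}"] by simp
  have "average (amb M) ` low M = vs.span {average (amb M) u}"
    using linear_on_image_span[OF average_linear[OF M(1)] is_gliderD(2)[OF M(1)] u] M(2) by simp
  then show ?thesis by (simp add: average_rank_def dim_zero dim_singleton)
qed

lemma average_rank_unit_fun:
  fixes M :: "('a, 'k::field_char_0) glider"
  assumes "cyclic_with_coeffs M C" "unit_fun (carrier G) \<in> C" shows "average_rank M = 1"
proof -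
  obtain u where u: "is_glider G M" "low M = vs.span {u}" "C = coeffs (amb M) u"
    using assms(1) by (rule cyclic_with_coeffsE)
  then have "average (amb M) u \<noteq> 0" unfolding average_def using sum_act_nonzero assms(2) by blast
  then show ?thesis using average_rank_cyclic[OF u(1,2)] by simp
qed

lemma cyclic_power:
  assumes "cyclic_with_coeffs M C"
  shows "\<exists>N. cyclic_with_coeffs N (fpow (carrier G) C n) \<and> Q_class G M [^]\<^bsub>Q_glider G\<^esub> n = Q_class G N"
proof (induction n)
  case 0
  have "Q_class G M [^]\<^bsub>Q_glider G\<^esub> (0 :: nat) = Q_class G glider_unit" by (simp add: one_Q_glider)
  then show ?case unfolding fpow.simps using cyclic_unit by blast
next
  case (Suc n)
  then obtain N where N: "cyclic_with_coeffs N (fpow (carrier G) C n)"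
    "Q_class G M [^]\<^bsub>Q_glider G\<^esub> n = Q_class G N" by blast
  have "Q_class G M [^]\<^bsub>Q_glider G\<^esub> Suc n = Q_class G (glider_tensor N M)"
    using Q_class_mult[OF cyclic_rep_glider[OF N(1)] cyclic_rep_glider[OF assms]] N(2) by simp
  then show ?case unfolding fpow.simps using cyclic_tensor[OF N(1) assms] by blast
qed

text \<open>
  All statements about the powers \<open>y n\<close> are read off from the spaces \<open>C\<^sup>n\<close>: equal spaces give equal powers,
  and \<open>C\<^sup>m C\<^sup>n = C\<^sup>m\<^sup>+\<^sup>n\<close> makes the powers multiply as expected. If \<open>1 \<in> C\<^sup>N\<close> and the spaces \<open>C\<^sup>k\<^sup>N\<close>
  are constant for \<open>k \<ge> K\<close>, then every exponent can be reduced modulo \<open>N\<close> to one below \<open>(K + 1) N\<close>,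
  and \<open>y (K N)\<close> is idempotent.
\<close>

lemma cyclic_glider_powers:
  fixes M :: "('a, 'k::field_char_0) glider"
  assumes M: "cyclic_with_coeffs M C"
  shows "finite (cyclic_semigroup (Q_glider G) (Q_class G M))"
    and "\<exists>N D. cyclic_with_coeffs N D \<and> unit_fun (carrier G) \<in> D \<and>
      idempotent_of (Q_glider G) (Q_class G M) = Q_class G N"
proof -
  let ?P = "fpow (carrier G) C"
  define y where "y n = Q_class G M [^]\<^bsub>Q_glider G\<^esub> n" for n :: nat
  obtain u where u: "u \<noteq> 0" "u \<in> vecs (amb M)" "kg_module G (amb M)" "C = coeffs (amb M) u"
    using M by (rule cyclic_with_coeffsE)
  have C: "fs.subspace C" "C \<subseteq> fun_on (carrier G)" "translation_invariant G C"
    unfolding u(4) using coeffs_fun_on translation_invariant_coeffs[OF u(3,2)] by simp_all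
  obtain f where f: "f \<in> C" "f \<noteq> 0" unfolding u(4) by (rule coeffs_nonzero[OF u(3,2,1)])
  obtain N where N: "N \<ge> 1" "unit_fun (carrier G) \<in> ?P N"
    by (rule unit_fun_in_power[OF finite_carrier C(3,2) f]) (rule that)
  obtain K where K: "K \<ge> 1" "\<And>k. k \<ge> K \<Longrightarrow> ?P (k * N) = ?P (K * N)"
    "\<And>k. unit_fun (carrier G) \<in> ?P (k * N)"
    by (rule fpow_multiples_stabilize[OF finite_carrier C(1) N(2)]) (rule that)
  have y_eq: "y m = y n" if "?P m = ?P n" for m n
    using cyclic_power[OF M, of m] cyclic_power[OF M, of n] that Q_class_cyclic unfolding y_def by metis
  have y_mult: "y m \<otimes>\<^bsub>Q_glider G\<^esub> y n = y (m + n)" for m n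
  proof -
    obtain A where A: "cyclic_with_coeffs A (?P m)" "y m = Q_class G A"
      using cyclic_power[OF M, of m] unfolding y_def by blast
    obtain B where B: "cyclic_with_coeffs B (?P n)" "y n = Q_class G B"
      using cyclic_power[OF M, of n] unfolding y_def by blast
    obtain E where E: "cyclic_with_coeffs E (?P (m + n))" "y (m + n) = Q_class G E"
      using cyclic_power[OF M, of "m + n"] unfolding y_def by blast
    have "cyclic_with_coeffs (glider_tensor A B) (?P (m + n))"
      using cyclic_tensor[OF A(1) B(1)] fpow_add[OF C(1)] by simp
    then show ?thesis
      using Q_class_mult[OF cyclic_rep_glider[OF A(1)] cyclic_rep_glider[OF B(1)]] Q_class_cyclic[OF _ E(1)]
        A(2) B(2) E(2) by simp
  qed
  have y_small: "y n \<in> y ` {..<(K + 1) * N}" for n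
  proof -
    define r k where "r = n mod N" and "k = n div N"
    have n: "n = r + k * N" and r: "r < N" using N(1) by (simp_all add: r_def k_def)
    show ?thesis
    proof (cases "k \<ge> K")
      case True
      have "?P n = fprod (?P r) (?P (k * N))" unfolding n by (rule fpow_add[OF C(1)])
      also have "\<dots> = ?P (r + K * N)" unfolding K(2)[OF True] by (rule fpow_add[OF C(1), symmetric])
      finally have "y n = y (r + K * N)" by (rule y_eq)
      then show ?thesis using r by simp
    next
      case False
      then have "Suc k * N \<le> K * N" by (intro mult_le_mono1) simp
      then show ?thesis using n r by (intro imageI) simp
    qed
  qed
  have "cyclic_semigroup (Q_glider G) (Q_class G M) \<subseteq> y ` {..<(K + 1) * N}"
    using y_small by (auto simp: cyclic_semigroup_def y_def)
  then show "finite (cyclic_semigroup (Q_glider G) (Q_class G M))" by (rule finite_subset) simp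
  have idem: "y (K * N) \<otimes>\<^bsub>Q_glider G\<^esub> y (K * N) = y (K * N)"
    unfolding y_mult using K(2)[of "K + K"] by (intro y_eq) (simp add: add_mult_distrib)
  have "idempotent_of (Q_glider G) (Q_class G M) = y (K * N)"
    unfolding idempotent_of_def
  proof (rule the_equality)
    have "K * N \<ge> 1" using K(1) N(1) by simp
    then show "y (K * N) \<in> cyclic_semigroup (Q_glider G) (Q_class G M) \<and>
        y (K * N) \<otimes>\<^bsub>Q_glider G\<^esub> y (K * N) = y (K * N)"
      using idem unfolding cyclic_semigroup_def y_def by blast
  next
    \<comment> \<open>two idempotent powers \<open>y m\<close> and \<open>y n\<close> both agree with \<open>y (m n)\<close>\<close>
    have multiple: "y (Suc j * n) = y n" if "y n \<otimes>\<^bsub>Q_glider G\<^esub> y n = y n" for j n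
    proof (induction j)
      case (Suc j)
      have "y (Suc (Suc j) * n) = y (Suc j * n) \<otimes>\<^bsub>Q_glider G\<^esub> y n"
        unfolding y_mult by (simp add: add.commute)
      then show ?case using Suc that by simp
    qed simp
    fix e assume e: "e \<in> cyclic_semigroup (Q_glider G) (Q_class G M) \<and> e \<otimes>\<^bsub>Q_glider G\<^esub> e = e"
    then obtain m where m: "e = y m" "m \<ge> 1" unfolding cyclic_semigroup_def y_def by blast
    have "e = y (Suc (K * N - 1) * m)" using multiple[of m] e m(1) by simp
    also have "Suc (K * N - 1) * m = Suc (m - 1) * (K * N)"
    proof -
      have "Suc (K * N - 1) = K * N" "Suc (m - 1) = m" using K(1) N(1) m(2) by simp_all
      then show ?thesis by (simp only: mult.commute)
    qed
    also have "y \<dots> = y (K * N)" by (rule multiple[OF idem])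
    finally show "e = y (K * N)" .
  qed
  moreover obtain E where "cyclic_with_coeffs E (?P (K * N))" "y (K * N) = Q_class G E"
    using cyclic_power[OF M, of "K * N"] unfolding y_def by blast
  ultimately show "\<exists>N D. cyclic_with_coeffs N D \<and> unit_fun (carrier G) \<in> D \<and>
      idempotent_of (Q_glider G) (Q_class G M) = Q_class G N"
    using K(3) by metis
qed


section \<open>Irreducible modules\<close>

lemma kg_iso_refl: "kg_iso G V V"
  unfolding kg_iso_def by (rule exI[of _ "\<lambda>x. x"]) (auto simp: linear_on_def bij_betw_def)

lemma kg_irreducibleD:
  assumes "kg_irreducible G U"
  shows "kg_module G U" "vecs U \<noteq> {0}"
    and irreducible_cases: "\<lbrakk>vs.subspace S; S \<subseteq> vecs U; \<And>g x. \<lbrakk>g \<in> carrier G; x \<in> S\<rbrakk> \<Longrightarrow> act U g x \<in> S\<rbrakk>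
      \<Longrightarrow> S = {0} \<or> S = vecs U"
  using assms unfolding kg_irreducible_def by (auto simp: image_subset_iff)

text \<open>
  Here \<open>L\<close> is a left ideal. If it does not kill \<open>w\<close>, it does not kill \<open>u\<close> either, so irreducibility gives
  \<open>L u = U\<close> and \<open>L w = W\<close>. The map \<open>a u \<mapsto> a w\<close> is then well defined and surjective, and its kernel
  is a proper submodule of \<open>U\<close>, so it is injective.
\<close>

lemma irreducible_iso_if_annihilator:
  fixes U W :: "('a, 'k::field) kgmod"
  assumes U: "kg_irreducible G U" "u \<in> vecs U" and W: "kg_irreducible G W" "w \<in> vecs W"
    and L: "fs.subspace L" "\<And>a h. \<lbrakk>a \<in> L; h \<in> carrier G\<rbrakk> \<Longrightarrow> (\<lambda>g. a (h \<otimes> g)) \<in> L"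
    and ann: "\<And>a. \<lbrakk>a \<in> L; alg_act G U a u = 0\<rbrakk> \<Longrightarrow> alg_act G W a w = 0"
    and nonzero: "a\<^sub>0 \<in> L" "alg_act G W a\<^sub>0 w \<noteq> 0"
  shows "kg_iso G U W"
proof -
  note UD = kg_irreducibleD[OF U(1)] and WD = kg_irreducibleD[OF W(1)]
  have orbit: "(\<lambda>a. alg_act G V a x) ` L = vecs V"
    if V: "kg_irreducible G V" "x \<in> vecs V" and "alg_act G V a\<^sub>0 x \<noteq> 0" for V :: "('a, 'k) kgmod" and x
  proof -
    note VD = kg_irreducibleD(1)[OF V(1)]
    let ?S = "(\<lambda>a. alg_act G V a x) ` L"
    have "vs.subspace ?S"
    proof (rule vs.subspaceI)
      show "0 \<in> ?S" using alg_act_zero[of G V x] fs.subspace_0[OF L(1)] by (metis imageI)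
    next
      fix y z assume "y \<in> ?S" "z \<in> ?S"
      then obtain a b where "a \<in> L" "b \<in> L" "y = alg_act G V a x" "z = alg_act G V b x" by blast
      then show "y + z \<in> ?S" using fs.subspace_add[OF L(1)] by (auto simp: alg_act_add[symmetric])
    next
      fix c y assume "y \<in> ?S"
      then obtain a where "a \<in> L" "y = alg_act G V a x" by blast
      then show "smul c y \<in> ?S" using fs.subspace_scale[OF L(1)] by (auto simp: alg_act_fsmul[symmetric])
    qed
    moreover have "?S \<subseteq> vecs V" using alg_act_closed[OF VD V(2)] by blast
    moreover have "act V g y \<in> ?S" if g: "g \<in> carrier G" and y: "y \<in> ?S" for g y
    proof -
      obtain a where "a \<in> L" "y = alg_act G V a x" using y by blast
      then show ?thesis using act_alg_act[OF VD g V(2), of a] L(2)[of a "inv g"] g by simp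
    qed
    ultimately have "?S = {0} \<or> ?S = vecs V" by (rule irreducible_cases[OF V(1)])
    then show ?thesis using \<open>alg_act G V a\<^sub>0 x \<noteq> 0\<close> nonzero(1) by blast
  qed
  have "alg_act G U a\<^sub>0 u \<noteq> 0" using ann nonzero by blast
  then have orbU: "(\<lambda>a. alg_act G U a u) ` L = vecs U" by (rule orbit[OF U])
  have orbW: "(\<lambda>a. alg_act G W a w) ` L = vecs W" by (rule orbit[OF W nonzero(2)])
  define f where "f x = alg_act G W (SOME a. a \<in> L \<and> alg_act G U a u = x) w" for x
  have f: "f (alg_act G U a u) = alg_act G W a w" if a: "a \<in> L" for a
  proof -
    define b where "b = (SOME b. b \<in> L \<and> alg_act G U b u = alg_act G U a u)"
    have "b \<in> L \<and> alg_act G U b u = alg_act G U a u"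
      unfolding b_def by (rule someI[of _ a]) (use a in simp)
    then have "b - a \<in> L" "alg_act G U (b - a) u = 0"
      using a fs.subspace_diff[OF L(1)] by (simp_all add: alg_act_diff)
    then have "alg_act G W (b - a) w = 0" by (rule ann)
    then show ?thesis by (simp add: f_def b_def[symmetric] alg_act_diff)
  qed
  have lin: "linear_on (vecs U) f"
    unfolding linear_on_def
  proof (intro conjI ballI allI)
    fix x y assume "x \<in> vecs U" "y \<in> vecs U"
    then obtain a b where "a \<in> L" "b \<in> L" "x = alg_act G U a u" "y = alg_act G U b u"
      unfolding orbU[symmetric] by blast
    then show "f (x + y) = f x + f y"
      using f[of "a + b"] f[of a] f[of b] fs.subspace_add[OF L(1)] by (simp add: alg_act_add)
  next
    fix c x assume "x \<in> vecs U"
    then obtain a where "a \<in> L" "x = alg_act G U a u" unfolding orbU[symmetric] by blast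
    then show "f (smul c x) = smul c (f x)"
      using f[of "fsmul c a"] f[of a] fs.subspace_scale[OF L(1)] by (simp add: alg_act_fsmul)
  qed
  have equiv: "f (act U g x) = act W g (f x)" if g: "g \<in> carrier G" and x: "x \<in> vecs U" for g x
  proof -
    obtain a where a: "a \<in> L" "x = alg_act G U a u" using x unfolding orbU[symmetric] by blast
    then show ?thesis
      using act_alg_act[OF UD(1) g U(2), of a] act_alg_act[OF WD(1) g W(2), of a] f[OF a(1)]
        f[OF L(2)[OF a(1) inv_closed[OF g]]] by simp
  qed
  have surj: "f ` vecs U = vecs W"
    unfolding orbU[symmetric] orbW[symmetric] image_image by (rule image_cong[OF refl]) (rule f)
  let ?ker = "{x \<in> vecs U. f x = 0}"
  have "?ker = {0} \<or> ?ker = vecs U"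
  proof (rule irreducible_cases[OF U(1)])
    show "vs.subspace ?ker" using subspace_linear_preimage[OF lin subspace_vecs, of "{0}"] by simp
    fix g x assume "g \<in> carrier G" "x \<in> ?ker"
    then show "act U g x \<in> ?ker"
      using act_closed[OF UD(1)] equiv linear_on_zero[OF act_linear[OF WD(1)] subspace_vecs] by simp
  qed blast
  moreover have "?ker \<noteq> vecs U"
  proof
    assume ker: "?ker = vecs U"
    have "alg_act G W a\<^sub>0 w \<in> vecs W" by (rule alg_act_closed[OF WD(1) W(2)])
    then obtain x where "x \<in> vecs U" "f x = alg_act G W a\<^sub>0 w" unfolding surj[symmetric] by force
    moreover from this(1) have "f x = 0" using ker by blast
    ultimately show False using nonzero(2) by simp
  qed
  ultimately have ker: "?ker = {0}" by blast
  have "inj_on f (vecs U)"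
  proof (rule inj_onI)
    fix x y assume xy: "x \<in> vecs U" "y \<in> vecs U" "f x = f y"
    then have "x - y \<in> ?ker"
      using vs.subspace_diff[OF subspace_vecs] linear_on_diff[OF lin subspace_vecs] by simp
    then show "x = y" unfolding ker by simp
  qed
  then show ?thesis unfolding kg_iso_def bij_betw_def using surj lin equiv by blast
qed

text \<open>
  Suppose that there are infinitely many irreducible modules up to isomorphism, choose nonzero vectors
  \<open>u\<^sub>0, u\<^sub>1, \<dots>\<close> in pairwise non-isomorphic ones, and let \<open>L\<^sub>k\<close> be the left ideal that kills \<open>u\<^sub>0, \<dots>, u\<^sub>k\<^sub>-\<^sub>1\<close>. The orthogonal spaces of the \<open>L\<^sub>k\<close> form an ascending
  chain of spaces of functions on \<open>G\<close>, so it stabilizes, and some \<open>L\<^sub>K\<close> kills \<open>u\<^sub>K\<close>. For the first \<open>i + 1\<close>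
  such that \<open>L\<^sub>i\<^sub>+\<^sub>1\<close> kills \<open>u\<^sub>K\<close>, the left ideal \<open>L\<^sub>i\<close> shows that the modules of \<open>u\<^sub>i\<close> and \<open>u\<^sub>K\<close> are isomorphic,
  a contradiction.
\<close>

lemma finite_irr_reps:
  fixes Irr :: "('a, 'k::field) kgmod set"
  assumes Irr: "irr_reps G Irr" shows "finite Irr"
proof (rule ccontr)
  assume "infinite Irr"
  then obtain U :: "nat \<Rightarrow> ('a, 'k) kgmod" where U: "inj U" "range U \<subseteq> Irr"
    using infinite_countable_subset by blast
  have irr: "kg_irreducible G (U n)" for n using U(2) Irr by (auto simp: irr_reps_def)
  have "\<exists>u. u \<in> vecs (U n) \<and> u \<noteq> 0" for n
    using kg_irreducibleD(2)[OF irr] vs.subspace_0[OF subspace_vecs] by blast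
  then obtain u where u: "\<And>n. u n \<in> vecs (U n)" "\<And>n. u n \<noteq> 0" by metis
  define L where "L k = {a. \<forall>i<k. alg_act G (U i) a (u i) = 0}" for k
  let ?D = "\<lambda>k. fs.span (\<Union>i<k. coeffs (U i) (u i))"
  obtain K where K: "\<And>k. k \<ge> K \<Longrightarrow> ?D k = ?D K"
  proof (rule ascending_chain_stabilizes[OF finite_carrier, of ?D])
    show "?D k \<subseteq> fun_on (carrier G)" for k
      by (rule fs.span_minimal[OF _ subspace_fun_on]) (use coeffs_fun_on in blast)
    show "?D k \<subseteq> ?D (Suc k)" for k by (rule fs.span_mono) (auto simp: less_Suc_eq)
  qed (simp, rule that)
  have dead: "alg_act G (U K) a (u K) = 0" if a: "a \<in> L K" for a
  proof -
    let ?Z = "{f. (\<Sum>g\<in>carrier G. a g * f g) = 0}"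
    have "(\<Union>i<K. coeffs (U i) (u i)) \<subseteq> ?Z" using a unfolding L_def alg_act_zero_iff by blast
    then have "?D K \<subseteq> ?Z" by (rule fs.span_minimal) (rule subspace_orthogonal)
    moreover have "coeffs (U K) (u K) \<subseteq> ?D (Suc K)" by (auto intro: fs.span_base)
    ultimately show ?thesis unfolding alg_act_zero_iff using K[of "Suc K"] by auto
  qed
  define j where "j = (LEAST j. \<forall>a\<in>L j. alg_act G (U K) a (u K) = 0)"
  have j: "\<forall>a\<in>L j. alg_act G (U K) a (u K) = 0" unfolding j_def by (rule LeastI[of _ K]) (use dead in blast)
  have "alg_act G (U K) (unit_fun {\<one>}) (u K) \<noteq> 0"
    using u[of K] by (simp add: alg_act_unit_fun act_one[OF kg_irreducibleD(1)[OF irr]])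
  then have "j \<noteq> 0" using j by (auto simp: L_def)
  then obtain i where i: "j = Suc i" by (cases j) auto
  have "j \<le> K" unfolding j_def by (rule Least_le) (use dead in blast)
  obtain a where a: "a \<in> L i" "alg_act G (U K) a (u K) \<noteq> 0"
    using not_less_Least[of i "\<lambda>j. \<forall>a\<in>L j. alg_act G (U K) a (u K) = 0"] i unfolding j_def[symmetric] by auto
  have "kg_iso G (U i) (U K)"
  proof (rule irreducible_iso_if_annihilator[OF irr u(1) irr u(1) _ _ _ a])
    show "fs.subspace (L i)"
      by (rule fs.subspaceI) (simp_all add: L_def alg_act_zero alg_act_add alg_act_fsmul)
    show "(\<lambda>g. b (h \<otimes> g)) \<in> L i" if b: "b \<in> L i" and h: "h \<in> carrier G" for b h
    proof -
      have "alg_act G (U l) (\<lambda>g. b (h \<otimes> g)) (u l) = 0" if "l < i" for l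
      proof -
        note m = kg_irreducibleD(1)[OF irr, of l]
        have "alg_act G (U l) (\<lambda>g. b (h \<otimes> g)) (u l) = act (U l) (inv h) (alg_act G (U l) b (u l))"
          using act_alg_act[OF m inv_closed[OF h] u(1), of b] h by simp
        also have "\<dots> = 0"
          using b that linear_on_zero[OF act_linear[OF m inv_closed[OF h]] subspace_vecs] by (simp add: L_def)
        finally show ?thesis .
      qed
      then show ?thesis by (simp add: L_def)
    qed
    show "alg_act G (U K) b (u K) = 0" if "b \<in> L i" "alg_act G (U i) b (u i) = 0" for b
      using that j unfolding i L_def less_Suc_eq by blast
  qed
  moreover have "U i \<in> Irr" "U K \<in> Irr" using U(2) by auto
  ultimately have "U i = U K" using Irr irr[of i] kg_iso_refl unfolding irr_reps_def by metis
  then show False using U(1) i \<open>j \<le> K\<close> by (auto dest: injD)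
qed

lemma finite_dim_if_dim_pos:
  assumes "vs.subspace S" "vs.dim S > 0" shows "finite_dim S"
proof -
  obtain B where B: "B \<subseteq> S" "vs.independent B" "S \<subseteq> vs.span B" "card B = vs.dim S"
    using vs.basis_exists[of S] by blast
  then have "finite B" using assms(2) card.infinite by fastforce
  then show ?thesis unfolding finite_dim_def using B assms(1) vs.span_subspace by blast
qed

text \<open>
  A nonzero vector \<open>\<Sum>\<^sub>g g w\<close> would be fixed by \<open>G\<close> and span a proper submodule.
\<close>

lemma average_irreducible:
  fixes U :: "('a, 'k::field) kgmod"
  assumes U: "kg_irreducible G U" and dim: "vs.dim (vecs U) > 1" and w: "w \<in> vecs U"
  shows "average U w = 0"
proof (rule ccontr)
  assume nonzero: "average U w \<noteq> 0"
  note UD = kg_irreducibleD[OF U]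
  have y: "average U w \<in> vecs U" unfolding average_def by (rule alg_act_closed[OF UD(1) w])
  have fixed: "act U g (average U w) = average U w" if "g \<in> carrier G" for g
    unfolding average_def by (rule act_alg_act[OF UD(1) that w])
  let ?S = "vs.span {average U w}"
  have "?S = {0} \<or> ?S = vecs U"
  proof (rule irreducible_cases[OF U])
    show "?S \<subseteq> vecs U" using y by (intro vs.span_minimal) auto
    fix g x assume g: "g \<in> carrier G" and "x \<in> ?S"
    then obtain c where "x = smul c (average U w)" by (auto simp: vs.span_singleton)
    then have "act U g x = x" using linear_on_smul[OF act_linear[OF UD(1) g] y] fixed[OF g] by simp
    then show "act U g x \<in> ?S" using \<open>x \<in> ?S\<close> by simp
  qed simp
  moreover have "?S \<noteq> {0}" using nonzero vs.span_base[of "average U w" "{average U w}"] by auto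
  ultimately have "vecs U = ?S" by blast
  then have "vs.dim (vecs U) = 1" using dim_singleton[OF nonzero] by simp
  then show False using dim by simp
qed


section \<open>The gliders of the parametrization\<close>

lemma vector_glider_simps:
  "amb (vector_glider xs) = dsum_mod (map fst xs)"
  "low (vector_glider xs) = vs.span {dsum_vec (map snd xs)}"
  "high (vector_glider xs) = vecs (dsum_mod (map fst xs))"
  by (simp_all add: vector_glider_def Let_def)

lemma component_vector: "s < length xs \<Longrightarrow> component s (dsum_vec (map snd xs)) = snd (xs ! s)"
  by (simp add: component_dsum_vec)

lemma is_glider_vector_glider:
  assumes xs: "\<And>V w. (V, w) \<in> set xs \<Longrightarrow> kg_module G V \<and> finite_dim (vecs V) \<and> w \<in> vecs V"
  shows "is_glider G (vector_glider xs)"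
proof (rule is_gliderI)
  have "snd (xs ! s) \<in> vecs (fst (xs ! s))" if "s < length xs" for s
    using xs[of "fst (xs ! s)" "snd (xs ! s)"] that by simp
  then have v: "dsum_vec (map snd xs) \<in> vecs (dsum_mod (map fst xs))"
    by (simp add: in_vecs_dsum component_dsum_vec)
  then show sub: "low (vector_glider xs) \<subseteq> high (vector_glider xs)"
    unfolding vector_glider_simps by (intro vs.span_minimal) auto
  show V: "kg_module G (amb (vector_glider xs))"
    unfolding vector_glider_simps by (rule kg_module_dsum) (use xs in auto)
  show "finite_dim (high (vector_glider xs))"
    unfolding vector_glider_simps by (rule finite_dim_vecs_dsum) (use xs in auto)
  show "finite_dim (low (vector_glider xs))" unfolding vector_glider_simps finite_dim_def by blast
  show "act (amb (vector_glider xs)) g x \<in> high (vector_glider xs)"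
    if "g \<in> carrier G" "x \<in> low (vector_glider xs)" for g x
    using act_closed[OF V that(1)] sub that(2) unfolding vector_glider_simps by blast
qed (simp_all add: vector_glider_simps)

lemma cyclic_vector_glider:
  assumes "is_glider G (vector_glider xs)" "(V, w) \<in> set xs" "w \<noteq> 0"
  shows "\<exists>C. cyclic_with_coeffs (vector_glider xs) C"
proof -
  obtain s where s: "s < length xs" "xs ! s = (V, w)" using assms(2) by (auto simp: in_set_conv_nth)
  then have "component s (dsum_vec (map snd xs)) \<noteq> 0" using component_vector[OF s(1)] assms(3) by simp
  then have "dsum_vec (map snd xs) \<noteq> 0" by force
  then show ?thesis using assms(1) unfolding cyclic_with_coeffs_def vector_glider_simps by blast
qed

lemma average_rank_vector_glider:
  assumes M: "is_glider G (vector_glider xs)" and zero: "\<And>V w. (V, w) \<in> set xs \<Longrightarrow> average V w = 0"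
  shows "average_rank (vector_glider xs) = 0"
proof -
  have "average (dsum_mod (map fst xs)) (dsum_vec (map snd xs)) = 0"
  proof (rule vec_eq_componentsI)
    fix s
    show "component s (average (dsum_mod (map fst xs)) (dsum_vec (map snd xs))) = component s 0"
    proof (cases "s < length xs")
      case True
      then have "average (fst (xs ! s)) (snd (xs ! s)) = 0" using zero[of "fst (xs ! s)" "snd (xs ! s)"] by simp
      then show ?thesis
        using True by (simp add: average_def alg_act_def component_sum component_smul component_act_dsum component_vector)
    next
      case False
      then show ?thesis by (simp add: average_def alg_act_def component_sum component_smul component_act_dsum)
    qed
  qed
  then show ?thesis using average_rank_cyclic[OF M vector_glider_simps(2)] by (simp add: vector_glider_simps)
qed

lemma onedim_param_module:
  assumes T: "onedim_param G T" and z: "z \<in> carrier (abelianization G)"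
  shows "kg_module G (T z)" "finite_dim (vecs (T z))" "\<exists>t. t \<in> vecs (T z) \<and> t \<noteq> 0"
proof -
  show mod: "kg_module G (T z)" using T z by (simp add: onedim_param_def)
  have "kg_class G (T z) \<in> carrier (onedim_group G)"
    using T z by (auto simp: onedim_param_def iso_def hom_def)
  then obtain V where V: "kg_class G (T z) = kg_class G V" "kg_module G V" "vs.dim (vecs V) = 1"
    by (auto simp: onedim_group_def)
  have "T z \<in> kg_class G (T z)" using mod by (simp add: kg_class_def kg_iso_refl)
  then have "kg_iso G V (T z)" unfolding V(1) by (simp add: kg_class_def)
  then obtain f where f: "bij_betw f (vecs V) (vecs (T z))" "linear_on (vecs V) f"
    unfolding kg_iso_def by blast
  obtain A where A: "finite A" "vs.span A = vecs V"
    using finite_dim_if_dim_pos[OF subspace_vecs, of V] V(3) unfolding finite_dim_def by auto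
  have im: "f ` vecs V = vecs (T z)" using f(1) by (simp add: bij_betw_def)
  have "vs.span (f ` A) = vecs (T z)"
    using linear_on_image_span[OF f(2) subspace_vecs, of A] A(2) vs.span_superset[of A] im by simp
  then show "finite_dim (vecs (T z))" unfolding finite_dim_def using A(1) by blast
  have "vecs (T z) \<noteq> {0}"
  proof
    assume "vecs (T z) = {0}"
    then have "vs.dim (f ` vecs V) = 0" unfolding im by (simp add: dim_zero)
    moreover have "vs.dim (f ` vecs V) = vs.dim (vecs V)"
      by (rule dim_linear_image[OF f(2) _ subspace_vecs]) (use f(1) in \<open>simp add: bij_betw_def\<close>)
    ultimately show False using V(3) by simp
  qed
  then show "\<exists>t. t \<in> vecs (T z) \<and> t \<noteq> 0" using vs.subspace_0[OF subspace_vecs] by blast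
qed

lemma S_G_point:
  assumes Irr: "irr_reps G Irr" and B: "B \<in> S_G Irr" "(U, W) \<in> B"
  shows "kg_irreducible G U" "vs.dim (vecs U) > 1" "finite_dim (vecs U)" "vs.subspace W" "W \<subseteq> vecs U"
    "vs.dim W \<ge> 1"
proof -
  have UW: "U \<in> Irr" "vs.dim (vecs U) > 1" "W \<in> Gr_all U" using B by (auto simp: S_G_def)
  then show "kg_irreducible G U" "vs.dim (vecs U) > 1" using Irr by (auto simp: irr_reps_def)
  show "finite_dim (vecs U)" using UW(2) by (intro finite_dim_if_dim_pos) auto
  show "vs.subspace W" "W \<subseteq> vecs U" "vs.dim W \<ge> 1" using UW(3) by (auto simp: Gr_all_def Gr_def)
qed

lemma finite_S_G: assumes "irr_reps G Irr" "B \<in> S_G Irr" shows "finite B"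
proof (rule finite_imageD)
  have "fst ` B \<subseteq> Irr" using assms(2) by (auto simp: S_G_def)
  then show "finite (fst ` B)" using finite_irr_reps[OF assms(1)] by (rule finite_subset)
  show "inj_on fst B"
  proof (rule inj_onI)
    fix p q assume "p \<in> B" "q \<in> B" "fst p = fst q"
    then show "p = q" using assms(2) unfolding S_G_def by (cases p; cases q) auto
  qed
qed

lemma presents_exists:
  fixes T :: "'a set \<Rightarrow> ('a, 'k::field) kgmod"
  assumes T: "onedim_param G T" and Irr: "irr_reps G Irr" and AB: "(A, B) \<in> params G Irr"
  shows "\<exists>xs. presents T A B xs"
proof -
  have A: "A \<subseteq> carrier (abelianization G)" and B: "B \<in> S_G Irr" using AB by (auto simp: params_def)
  have "finite (carrier (abelianization G))"
    using finite_carrier by (simp add: abelianization_def FactGroup_def RCOSETS_def)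
  then obtain zs where zs: "distinct zs" "set zs = A"
    using A finite_distinct_list[of A] finite_subset by metis
  obtain Bs where Bs: "distinct Bs" "set Bs = B" using finite_distinct_list[OF finite_S_G[OF Irr B]] by blast
  have "\<forall>z\<in>A. \<exists>t. t \<in> vecs (T z) \<and> t \<noteq> 0" using onedim_param_module(3)[OF T] A by blast
  then obtain t where t: "\<forall>z\<in>A. t z \<in> vecs (T z) \<and> t z \<noteq> 0" by (rule bchoice[THEN exE])
  have "\<forall>p\<in>B. \<exists>l. distinct l \<and> vs.independent (set l) \<and> vs.span (set l) = snd p"
  proof
    fix p assume "p \<in> B"
    then obtain U W where p: "p = (U, W)" "(U, W) \<in> B" by (cases p) auto
    note W = S_G_point[OF Irr B p(2)]
    obtain S where S: "S \<subseteq> W" "vs.independent S" "W \<subseteq> vs.span S" "card S = vs.dim W"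
      using vs.basis_exists[of W] by blast
    then have "finite S" using W(6) card.infinite by fastforce
    then obtain l where "distinct l" "set l = S" using finite_distinct_list by blast
    moreover have "vs.span S = W" using S W(4) by (simp add: vs.span_subspace)
    ultimately show "\<exists>l. distinct l \<and> vs.independent (set l) \<and> vs.span (set l) = snd p"
      using S(2) p(1) by auto
  qed
  then obtain b where b: "\<forall>p\<in>B. distinct (b p) \<and> vs.independent (set (b p)) \<and> vs.span (set (b p)) = snd p"
    by (rule bchoice[THEN exE])
  then have "\<forall>(U, W)\<in>B. distinct (b (U, W)) \<and> vs.independent (set (b (U, W))) \<and> vs.span (set (b (U, W))) = W"
    by auto
  then show ?thesis unfolding presents_def using zs t Bs by blast
qed

lemma presents_summand_cases:
  assumes "presents T A B xs" "(V, w) \<in> set xs"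
  obtains z where "z \<in> A" "V = T z" "w \<in> vecs (T z)"
  | W where "(V, W) \<in> B" "w \<in> W"
proof -
  obtain zs t Bs b where A: "set zs = A" "\<forall>z\<in>A. t z \<in> vecs (T z) \<and> t z \<noteq> 0" and B: "set Bs = B"
      "\<forall>(U, W)\<in>B. distinct (b (U, W)) \<and> vs.independent (set (b (U, W))) \<and> vs.span (set (b (U, W))) = W"
    and xs: "xs = map (\<lambda>z. (T z, t z)) zs @ concat (map (\<lambda>(U, W). map (\<lambda>w. (U, w)) (b (U, W))) Bs)"
    using assms(1) unfolding presents_def by blast
  have "(\<exists>z\<in>A. V = T z \<and> w = t z) \<or> (\<exists>W. (V, W) \<in> B \<and> w \<in> set (b (V, W)))"
    using assms(2) unfolding xs A(1)[symmetric] B(1)[symmetric] by auto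
  then show ?thesis
  proof
    assume "\<exists>z\<in>A. V = T z \<and> w = t z"
    then show ?thesis using that(1) A(2) by blast
  next
    assume "\<exists>W. (V, W) \<in> B \<and> w \<in> set (b (V, W))"
    then obtain W where W: "(V, W) \<in> B" "w \<in> set (b (V, W))" by blast
    then have "w \<in> W" using B(2) vs.span_base[of w "set (b (V, W))"] by auto
    then show ?thesis using that(2) W(1) by blast
  qed
qed

lemma presents_nonzero:
  assumes Irr: "irr_reps G Irr" and AB: "(A, B) \<in> params G Irr" and xs: "presents T A B xs"
  shows "\<exists>V w. (V, w) \<in> set xs \<and> w \<noteq> 0"
proof -
  obtain zs t Bs b where A: "set zs = A" "\<forall>z\<in>A. t z \<in> vecs (T z) \<and> t z \<noteq> 0" and B: "set Bs = B"
      "\<forall>(U, W)\<in>B. distinct (b (U, W)) \<and> vs.independent (set (b (U, W))) \<and> vs.span (set (b (U, W))) = W"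
    and xs: "xs = map (\<lambda>z. (T z, t z)) zs @ concat (map (\<lambda>(U, W). map (\<lambda>w. (U, w)) (b (U, W))) Bs)"
    using xs unfolding presents_def by blast
  show ?thesis
  proof (cases "A = {}")
    case False
    then obtain z where "z \<in> A" by blast
    then have "(T z, t z) \<in> set xs" "t z \<noteq> 0" using A unfolding xs by auto
    then show ?thesis by blast
  next
    case True
    then obtain U W where UW: "(U, W) \<in> B" using AB by (auto simp: params_def)
    have "B \<in> S_G Irr" using AB by (simp add: params_def)
    note W = S_G_point[OF Irr this UW]
    have b: "vs.independent (set (b (U, W)))" "vs.span (set (b (U, W))) = W" using B(2) UW by auto
    have "set (b (U, W)) \<noteq> {}"
    proof
      assume "set (b (U, W)) = {}"
      then have "W = {0}" using b(2) by simp
      then show False using W(6) by (simp add: dim_zero)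
    qed
    then obtain w where w: "w \<in> set (b (U, W))" by (auto simp only: ex_in_conv[symmetric])
    then have "w \<noteq> 0" using b(1) vs.dependent_zero by blast
    moreover have "(U, w) \<in> set xs" using w UW B(1) unfolding xs by force
    ultimately show ?thesis by blast
  qed
qed

text \<open>
  The glider is cyclic because the chosen vector is nonzero: \<open>A\<close> contributes nonzero components, and
  \<open>B\<close> contributes bases of nonzero spaces. For \<open>A = \<emptyset>\<close> all summands are irreducible of dimension
  greater than \<open>1\<close>, so that \<open>\<Sum>\<^sub>g g\<close> kills the vector.
\<close>

lemma glider_M_vector:
  fixes T :: "'a set \<Rightarrow> ('a, 'k::field) kgmod"
  assumes T: "onedim_param G T" and Irr: "irr_reps G Irr" and AB: "(A, B) \<in> params G Irr"
  obtains M C where "glider_M G T A B = Q_class G M" "cyclic_with_coeffs M C"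
    "A = {} \<Longrightarrow> average_rank M = 0"
proof -
  define xs where "xs = (SOME xs. presents T A B xs)"
  have xs: "presents T A B xs" unfolding xs_def by (rule someI_ex[OF presents_exists[OF T Irr AB]])
  have A: "A \<subseteq> carrier (abelianization G)" and B: "B \<in> S_G Irr" using AB by (auto simp: params_def)
  have summand: "kg_module G V \<and> finite_dim (vecs V) \<and> w \<in> vecs V" if "(V, w) \<in> set xs" for V w
    using xs that
  proof (cases rule: presents_summand_cases)
    case (1 z)
    then show ?thesis using onedim_param_module[OF T, of z] A by auto
  next
    case (2 W)
    note W = S_G_point[OF Irr B 2(1)]
    show ?thesis using kg_irreducibleD(1)[OF W(1)] W(3,5) 2(2) by auto
  qed
  note M = is_glider_vector_glider[OF summand]
  have zero: "average_rank (vector_glider xs) = 0" if "A = {}"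
  proof (rule average_rank_vector_glider[OF M])
    fix V w assume "(V, w) \<in> set xs"
    with xs show "average V w = 0"
    proof (cases rule: presents_summand_cases)
      case (1 z)
      then show ?thesis using that by simp
    next
      case (2 W)
      note W = S_G_point[OF Irr B 2(1)]
      show ?thesis using average_irreducible[OF W(1,2)] W(5) 2(2) by auto
    qed
  qed
  obtain V w where "(V, w) \<in> set xs" "w \<noteq> 0" using presents_nonzero[OF Irr AB xs] by blast
  then obtain C where C: "cyclic_with_coeffs (vector_glider xs) C"
    using cyclic_vector_glider[OF M] by blast
  have "glider_M G T A B = Q_class G (vector_glider xs)" by (simp add: glider_M_def xs_def)
  then show ?thesis using C zero by (rule that)
qed

lemma P_space_zero:
  fixes T :: "'a set \<Rightarrow> ('a, 'k::field_char_0) kgmod"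
  assumes T: "onedim_param G T" and Irr: "irr_reps G Irr"
  shows "P_space G T Irr = {\<zero>\<^bsub>Q_glider G\<^esub>}"
proof -
  have "finite (cyclic_semigroup (Q_glider G) (glider_M G T A B))" if AB: "(A, B) \<in> params G Irr" for A B
  proof -
    obtain M C where "glider_M G T A B = Q_class G M" "cyclic_with_coeffs M C"
      by (rule glider_M_vector[OF T Irr AB])
    then show ?thesis using cyclic_glider_powers(1) by simp
  qed
  then have "{glider_M G T A B | A B. (A, B) \<in> params G Irr \<and>
      infinite (cyclic_semigroup (Q_glider G) (glider_M G T A B))} = {}" by blast
  then show ?thesis unfolding P_space_def by (simp only: Q_span_empty)
qed

lemma E_space_zero:
  fixes T :: "'a set \<Rightarrow> ('a, 'k::field_char_0) kgmod"
  assumes T: "onedim_param G T" and Irr: "irr_reps G Irr"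
  shows "E_space G T Irr = {\<zero>\<^bsub>Q_glider G\<^esub>}"
proof -
  have "idempotent_of (Q_glider G) (glider_M G T A B) \<noteq> glider_M G T {} D"
    if AB: "(A, B) \<in> params G Irr" and D: "({}, D) \<in> params G Irr" for A B D
  proof
    assume eq: "idempotent_of (Q_glider G) (glider_M G T A B) = glider_M G T {} D"
    obtain M C where M: "glider_M G T A B = Q_class G M" "cyclic_with_coeffs M C"
      by (rule glider_M_vector[OF T Irr AB])
    obtain M' C' where M': "glider_M G T {} D = Q_class G M'" "cyclic_with_coeffs M' C'" "average_rank M' = 0"
      by (rule glider_M_vector[OF T Irr D]) (rule that; simp)
    obtain N F where N: "cyclic_with_coeffs N F" "unit_fun (carrier G) \<in> F"
      "idempotent_of (Q_glider G) (Q_class G M) = Q_class G N"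
      using cyclic_glider_powers(2)[OF M(2)] by blast
    have "Q_class G N = Q_class G M'" using eq M(1) M'(1) N(3) by simp
    then have "average_rank N = average_rank M'"
      using Q_class_eq_average_rank[OF cyclic_rep_glider[OF N(1)] cyclic_rep_glider[OF M'(2)]] by blast
    then show False using average_rank_unit_fun[OF N(1,2)] M'(3) by simp
  qed
  then have "{glider_M G T A B | A B. (A, B) \<in> params G Irr \<and>
      glider_M G T A B \<notin> P_space G T Irr \<and>
      (\<exists>D. ({}, D) \<in> params G Irr \<and>
         idempotent_of (Q_glider G) (glider_M G T A B) = glider_M G T {} D)} = {}" by blast
  then show ?thesis unfolding E_space_def by (simp only: Q_span_empty)
qed

end

theorem corollary7p2:
  fixes G :: "('g, 'm) monoid_scheme"
    and T :: "'g set \<Rightarrow> ('g, 'k::{alg_closed_field, field_char_0}) kgmod"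
    and Irr :: "('g, 'k) kgmod set"
  assumes "group G" and "finite (carrier G)" and "nilpotent_of_class G 2"
    and "onedim_param G T" and "irr_reps G Irr"
  shows "P_space G T Irr = {\<zero>\<^bsub>Q_glider G\<^esub>} \<and> E_space G T Irr = {\<zero>\<^bsub>Q_glider G\<^esub>}"
proof -
  interpret finite_group G using assms(1,2) by (intro finite_group.intro finite_group_axioms.intro)
  show ?thesis using P_space_zero[OF assms(4,5)] E_space_zero[OF assms(4,5)] by (rule conjI)
qed

end
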